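(* Let $\mathcal{D}$ be an open disk centred at the origin with radius $r_0>0$, and let the Ginibre ensembles $\mathcal{G}_n$ $(n\ge1)$ and $\mathcal{G}$ be coupled on one probability space so that almost surely $\mathcal{G}_n\subset\mathcal{G}_{n+1}\subset\mathcal{G}$ for all $n\ge1$ and $\mathcal{G}_n\to\mathcal{G}$. With $\alpha_l(n)$ and $\alpha_l$ as defined in the context, for each $l\ge1$ we have $\alpha_l(n)\to\alpha_l$ in probability as $n\to\infty$. Hence there is a subsequence such that, almost surely, $\alpha_l(n)\to\alpha_l$ as $n\to\infty$ along this subsequence, simultaneously for all $l$.
   Context: $\mathcal{G}_n$ is the determinantal point process on $\mathbb{C}$ with kernel $\sum_{k=0}^{n-1}\frac{(z\overline w)^k}{k!}$ with respect to $\frac1\pi e^{-|z|^2}d\mathcal{L}(z)$ ($\mathcal{L}$ = Lebesgue measure), i.e. the eigenvalues of an $n\times n$ matrix of i.i.d. standard complex Gaussians; $\mathcal{G}$ is the determinantal process with kernel $e^{z\overline w}$ with respect to the same measure. For a point process $\Pi$, $[\Pi]=\sum_{z\in\Pi}\delta_z$. Convergence of configurations is weak convergence of the counting measures. $\varphi$ is a non-negative radial $C_c^\infty$ function on $\mathbb{C}$ supported on $\{r_0\le|z|\le3r_0\}$, with (as a function of $|z|$) $\varphi=1$ on $[\frac{3r_0}2,2r_0]$ and $\varphi(r_0+r)=1-\varphi(2r_0+2r)$ for $0\le r\le\frac12r_0$. $\widetilde\varphi$ is the radial function with $\widetilde\varphi=1$ for $r_0\le|z|\le\frac{3r_0}2$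 and $\widetilde\varphi=\varphi$ otherwise. $\psi_L(z):=\psi(z/L)$. The functions $\widetilde\varphi,\varphi_{2^j}$ $(j\ge1)$ form a partition of unity on $\mathcal{D}^c$. For $l\ge1$: $S_l(n)=\sum_{\omega\in\mathcal{G}_n\cap\mathcal{D}^c}\frac1{\omega^l}$ and $S_l=\int\frac{\widetilde\varphi(z)}{z^l}d[\mathcal{G}](z)+\sum_{j=1}^\infty\int\frac{\varphi_{2^j}(z)}{z^l}d[\mathcal{G}](z)$ (a well-defined random variable with finite first moment); $S_l(\mathcal{D},n)=\sum_{z\in\mathcal{G}_n\cap\mathcal{D}}\frac1{z^l}$ and $S_l(\mathcal{D})=\sum_{z\in\mathcal{G}\cap\mathcal{D}}\frac1{z^l}$. Set $\alpha_l(n)=S_l(\mathcal{D},n)+S_l(n)=\sum_{z\in\mathcal{G}_n}\frac1{z^l}$ and $\alpha_l=S_l(\mathcal{D})+S_l$. (Almost surely no point lies at the origin.) *)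

theory Defs
  imports "HOL-Probability.Probability" "Jordan_Normal_Form.Determinant"
begin

text \<open>All point processes here are simple, so a configuration is a set.\<close>

definition locally_finite_config :: "complex set \<Rightarrow> bool" where
  "locally_finite_config S \<longleftrightarrow> (\<forall>B. bounded B \<longrightarrow> finite (S \<inter> B))"

definition config_space :: "complex set measure" where
  "config_space = sigma {S. locally_finite_config S}
     {{S. locally_finite_config S \<and> card (S \<inter> B) = k} | B k. B \<in> sets borel \<and> bounded B}"

text \<open>The measure \<open>[S] = \<Sum>z\<in>S. \<delta>\<^sub>z\<close> on the Borel sets.\<close>

definition config_measure :: "complex set \<Rightarrow> complex measure" where
  "config_measure S = distr (count_space S) borel (\<lambda>z. z)"

text \<open>The total masses may be infinite, so the weak convergence of counting measures is tested
  against continuous functions of compact support.\<close>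

definition config_tendsto :: "(nat \<Rightarrow> complex set) \<Rightarrow> complex set \<Rightarrow> bool" where
  "config_tendsto S T \<longleftrightarrow>
     (\<forall>f :: complex \<Rightarrow> real. continuous_on UNIV f \<longrightarrow> compact (closure {z. f z \<noteq> 0}) \<longrightarrow>
        (\<lambda>n. \<integral>z. f z \<partial>config_measure (S n)) \<longlonglongrightarrow> (\<integral>z. f z \<partial>config_measure T))"

text \<open>A determinantal process: its \<open>k\<close>-point correlation function with respect to \<open>\<mu>\<close> is
  \<open>det (K (z\<^sub>i) (z\<^sub>j))\<close>, i.e. this determinant integrates over \<open>B\<^sub>1 \<times> \<dots> \<times> B\<^sub>k\<close>, for disjoint \<open>B\<^sub>i\<close>,
  to the expectation of the product of the numbers of points in the \<open>B\<^sub>i\<close>.\<close>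

definition determinantal_process ::
    "'w measure \<Rightarrow> ('w \<Rightarrow> complex set) \<Rightarrow> (complex \<Rightarrow> complex \<Rightarrow> complex) \<Rightarrow> complex measure \<Rightarrow> bool" where
  "determinantal_process M X K \<mu> \<longleftrightarrow>
     X \<in> measurable M config_space \<and>
     (\<forall>k B. (\<forall>i<k. B i \<in> sets borel \<and> bounded (B i)) \<longrightarrow> disjoint_family_on B {..<k} \<longrightarrow>
        set_integrable (PiM {..<k} (\<lambda>_. \<mu>)) (PiE {..<k} B)
          (\<lambda>z. Determinant.det (Matrix.mat k k (\<lambda>(i, j). K (z i) (z j)))) \<and>
        has_bochner_integral M (\<lambda>\<omega>. \<Prod>i<k. of_nat (card (X \<omega> \<inter> B i)))
          (LINT z:PiE {..<k} B|PiM {..<k} (\<lambda>_. \<mu>).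
             Determinant.det (Matrix.mat k k (\<lambda>(i, j). K (z i) (z j)))))"

definition gauss_measure :: "complex measure" where
  "gauss_measure = density lborel (\<lambda>z. ennreal (exp (- (norm z)\<^sup>2) / pi))"

definition finite_ginibre :: "'w measure \<Rightarrow> nat \<Rightarrow> ('w \<Rightarrow> complex set) \<Rightarrow> bool" where
  "finite_ginibre M n X \<longleftrightarrow>
     determinantal_process M X (\<lambda>z w. \<Sum>k<n. (z * cnj w) ^ k / fact k) gauss_measure"

definition infinite_ginibre :: "'w measure \<Rightarrow> ('w \<Rightarrow> complex set) \<Rightarrow> bool" where
  "infinite_ginibre M X \<longleftrightarrow> determinantal_process M X (\<lambda>z w. exp (z * cnj w)) gauss_measure"

text \<open>\<open>C\<^sup>k\<close> in the real sense: all partial derivatives up to order \<open>k\<close> exist and are continuous.\<close>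

primrec Ck_function :: "nat \<Rightarrow> ('a::euclidean_space \<Rightarrow> real) \<Rightarrow> bool" where
  "Ck_function 0 f \<longleftrightarrow> continuous_on UNIV f"
| "Ck_function (Suc k) f \<longleftrightarrow>
     (\<forall>x. f differentiable (at x)) \<and>
     (\<forall>b\<in>Basis. Ck_function k (\<lambda>x. frechet_derivative f (at x) b))"

definition smooth_function :: "('a::euclidean_space \<Rightarrow> real) \<Rightarrow> bool" where
  "smooth_function f \<longleftrightarrow> (\<forall>k. Ck_function k f)"

definition radial :: "(complex \<Rightarrow> real) \<Rightarrow> bool" where
  "radial f \<longleftrightarrow> (\<forall>z w. norm z = norm w \<longrightarrow> f z = f w)"

text \<open>For radial \<open>\<phi>\<close>, the value at radius \<open>t \<ge> 0\<close> is \<open>\<phi> (complex_of_real t)\<close>.\<close>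

definition cutoff :: "real \<Rightarrow> (complex \<Rightarrow> real) \<Rightarrow> bool" where
  "cutoff r0 \<phi> \<longleftrightarrow>
     smooth_function \<phi> \<and> radial \<phi> \<and> (\<forall>z. \<phi> z \<ge> 0) \<and>
     closure {z. \<phi> z \<noteq> 0} \<subseteq> {z. r0 \<le> norm z \<and> norm z \<le> 3 * r0} \<and>
     (\<forall>t\<in>{3 * r0 / 2 .. 2 * r0}. \<phi> (complex_of_real t) = 1) \<and>
     (\<forall>r\<in>{0 .. r0 / 2}.
        \<phi> (complex_of_real (r0 + r)) = 1 - \<phi> (complex_of_real (2 * r0 + 2 * r)))"

definition cutoff_tilde :: "real \<Rightarrow> (complex \<Rightarrow> real) \<Rightarrow> complex \<Rightarrow> real" where
  "cutoff_tilde r0 \<phi> z = (if r0 \<le> norm z \<and> norm z \<le> 3 * r0 / 2 then 1 else \<phi> z)"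

definition dilate :: "real \<Rightarrow> (complex \<Rightarrow> real) \<Rightarrow> complex \<Rightarrow> real" where
  "dilate L \<psi> z = \<psi> (z / complex_of_real L)"

definition S_in :: "real \<Rightarrow> nat \<Rightarrow> complex set \<Rightarrow> complex" where
  "S_in r0 l G = (\<Sum>z\<in>G \<inter> ball 0 r0. 1 / z ^ l)"

text \<open>Meaningful for finite configurations; \<open>\<G>\<^sub>n\<close> is almost surely one.\<close>

definition S_out_fin :: "real \<Rightarrow> nat \<Rightarrow> complex set \<Rightarrow> complex" where
  "S_out_fin r0 l G = (\<Sum>z\<in>G - ball 0 r0. 1 / z ^ l)"

text \<open>The summation index \<open>j\<close> is shifted by one. The series converges almost surely for the
  infinite Ginibre process, but the sum of \<open>1 / z ^ l\<close> over its points need not converge absolutely.\<close>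

definition S_out :: "real \<Rightarrow> (complex \<Rightarrow> real) \<Rightarrow> nat \<Rightarrow> complex set \<Rightarrow> complex" where
  "S_out r0 \<phi> l G =
     (\<integral>z. complex_of_real (cutoff_tilde r0 \<phi> z) / z ^ l \<partial>config_measure G) +
     (\<Sum>j. \<integral>z. complex_of_real (dilate (2 ^ Suc j) \<phi> z) / z ^ l \<partial>config_measure G)"

definition alpha_fin :: "real \<Rightarrow> nat \<Rightarrow> complex set \<Rightarrow> complex" where
  "alpha_fin r0 l G = S_in r0 l G + S_out_fin r0 l G"

definition alpha_inf :: "real \<Rightarrow> (complex \<Rightarrow> real) \<Rightarrow> nat \<Rightarrow> complex set \<Rightarrow> complex" where
  "alpha_inf r0 \<phi> l G = S_in r0 l G + S_out r0 \<phi> l G"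

text \<open>Measurability is part of the notion, since \<open>measure\<close> is \<open>0\<close> on non-measurable sets; finitely
  many \<open>X n\<close> are unconstrained.\<close>

definition tendsto_in_prob ::
    "'w measure \<Rightarrow> (nat \<Rightarrow> 'w \<Rightarrow> 'b::{metric_space, second_countable_topology}) \<Rightarrow> ('w \<Rightarrow> 'b) \<Rightarrow> bool" where
  "tendsto_in_prob M X Y \<longleftrightarrow>
     (\<forall>\<^sub>F n in sequentially. X n \<in> borel_measurable M) \<and> Y \<in> borel_measurable M \<and>
     (\<forall>\<epsilon>>0. (\<lambda>n. measure M {\<omega> \<in> space M. dist (X n \<omega>) (Y \<omega>) > \<epsilon>}) \<longlonglongrightarrow> 0)"

end

theory Submission
  imports Defs
begin

text \<open>Cut the sum over \<open>\<G>\<^sub>n\<close> into dyadic annuli by the partition of unity, and let \<open>T\<^sub>j(n)\<close> be the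
  part at scale \<open>L = 2\<^sup>j\<close>. Since \<open>z\<^sup>-\<^sup>l\<close> shifts the orthonormal basis of normalised monomials, the second
  moment of \<open>T\<^sub>j(n)\<close> is a sum over \<open>k < n\<close> of nonnegative terms not depending on \<open>n\<close>, each essentially
  the variance of a slowly varying function of a Gamma variable; a Lipschitz bound for the cutoff
  makes the sum \<open>O(1 / L)\<close>, uniformly in \<open>n\<close>. On every bounded set \<open>\<G>\<^sub>n\<close> eventually coincides with
  \<open>\<G>\<close>, so \<open>T\<^sub>j(n)\<close> converges almost surely to the corresponding part \<open>T\<^sub>j\<close> for \<open>\<G>\<close>, which inherits the
  bound by Fatou's lemma. Dominated convergence over the scales \<open>j\<close> then shows that
  \<open>\<alpha>\<^sub>l(n) - \<alpha>\<^sub>l\<close> tends to \<open>0\<close> in the metric \<open>E (min 1 |X - Y|)\<close>, and a Borel-Cantelli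
  argument yields the common subsequence.\<close>

section \<open>The Gaussian measure on the plane\<close>

text \<open>A ring at scale L holds about L^2 points of modulus about L, so for l \<le> 2 the
  absolute values 1 / |z|^l of one ring add up to something that does not decay; only the
  cancellation measured by the variance makes the rings summable. The mean of a ring sum vanishes
  because a suitable rotation multiplies z^-l by a factor other than 1, so second moment and
  variance coincide. A second moment of order 1 / L gives a first moment of order L^(-1/2), hence a
  geometric series over L = 2^j. Inside the disc the obstacle is the opposite one: for l \<ge> 2 the
  expected sum of |z|^-l is infinite, because of points close to the origin. The truncation at 1 in
  the metric makes almost sure convergence of this part sufficient. Correlation functions speak only
  of counts in disjoint bounded sets. Sums over points are therefore approximated by functions that
  are constant on cells, and sums over pairs by functions vanishing on the diagonal, so that two
  points sharing a cell never contribute.\<close>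

lemma lborel_shear_fst:
  "distr lborel borel (\<lambda>p::real \<times> real. (fst p + a * snd p, snd p)) = lborel"
proof (rule measure_eqI)
  fix A :: "(real \<times> real) set" assume "A \<in> sets (distr lborel borel (\<lambda>p. (fst p + a * snd p, snd p)))"
  then have [measurable]: "A \<in> sets borel" by simp
  have [measurable]: "(\<lambda>p::real\<times>real. (fst p + a * snd p, snd p)) \<in> borel \<rightarrow>\<^sub>M borel"
    by (intro borel_measurable_continuous_onI continuous_intros)
  have shift: "(\<integral>\<^sup>+x. indicator A (x + a * y, y) \<partial>lborel) = (\<integral>\<^sup>+x. indicator A (x, y) \<partial>lborel)" for y
    using nn_integral_real_affine[of "\<lambda>x. indicator A (x, y)" 1 "a * y"] by (simp add: add.commute)
  have "emeasure (distr lborel borel (\<lambda>p. (fst p + a * snd p, snd p))) A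
      = (\<integral>\<^sup>+p. indicator A (fst p + a * snd p, snd p) \<partial>lborel)"
    by (subst nn_integral_indicator[symmetric], simp, subst nn_integral_distr) auto
  also have "\<dots> = (\<integral>\<^sup>+p. indicator A (fst p + a * snd p, snd p) \<partial>(lborel \<Otimes>\<^sub>M lborel))"
    by (simp add: lborel_prod)
  also have "\<dots> = (\<integral>\<^sup>+y. \<integral>\<^sup>+x. indicator A (x + a * y, y) \<partial>lborel \<partial>lborel)"
    by (subst lborel_pair.nn_integral_snd[symmetric]) (simp_all add: lborel_prod)
  also have "\<dots> = (\<integral>\<^sup>+y. \<integral>\<^sup>+x. indicator A (x, y) \<partial>lborel \<partial>lborel)"
    by (simp only: shift)
  also have "\<dots> = (\<integral>\<^sup>+p. indicator A p \<partial>(lborel \<Otimes>\<^sub>M lborel))"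
    by (subst lborel_pair.nn_integral_snd[symmetric]) (simp_all add: lborel_prod)
  also have "\<dots> = emeasure lborel A" by (simp add: lborel_prod)
  finally show "emeasure (distr lborel borel (\<lambda>p. (fst p + a * snd p, snd p))) A = emeasure lborel A" .
qed simp

lemma lborel_swap: "distr lborel borel (\<lambda>p::real \<times> real. (snd p, fst p)) = lborel"
proof -
  have "lborel \<Otimes>\<^sub>M (lborel::real measure) = distr (lborel \<Otimes>\<^sub>M lborel) (lborel \<Otimes>\<^sub>M lborel) (\<lambda>(x, y). (y, x))"
    by (rule lborel_pair.distr_pair_swap)
  then show ?thesis
    unfolding lborel_prod case_prod_beta'
    by (metis (no_types, lifting) distr_cong sets_lborel)
qed

lemma distr_comp_eq:
  assumes "distr M N g = K" "distr K L f = Q" "g \<in> M \<rightarrow>\<^sub>M N" "f \<in> N \<rightarrow>\<^sub>M L"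
  shows "distr M L (\<lambda>x. f (g x)) = Q"
  using assms distr_distr[of f N L g M] by (simp add: o_def)

lemma lborel_shear_snd:
  "distr lborel borel (\<lambda>p::real \<times> real. (fst p, snd p + a * fst p)) = lborel"
proof -
  let ?s = "\<lambda>p::real \<times> real. (snd p, fst p)" and ?h = "\<lambda>p::real \<times> real. (fst p + a * snd p, snd p)"
  have m: "?s \<in> borel \<rightarrow>\<^sub>M borel" "?h \<in> borel \<rightarrow>\<^sub>M borel" "(\<lambda>p. ?h (?s p)) \<in> borel \<rightarrow>\<^sub>M borel"
    by (intro borel_measurable_continuous_onI continuous_intros)+
  have "distr lborel borel (\<lambda>p. ?h (?s p)) = lborel"
    using m by (intro distr_comp_eq[OF lborel_swap lborel_shear_fst]) simp_all
  from distr_comp_eq[OF this lborel_swap] m show ?thesis by simp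
qed

lemma lborel_complex: "distr lborel borel (\<lambda>p. Complex (fst p) (snd p)) = lborel"
proof (rule lborel_eqI[symmetric])
  fix l u :: complex assume le: "\<And>b. b \<in> Basis \<Longrightarrow> l \<bullet> b \<le> u \<bullet> b"
  have [measurable]: "(\<lambda>p. Complex (fst p) (snd p)) \<in> borel \<rightarrow>\<^sub>M borel"
    unfolding Complex_eq by (intro borel_measurable_continuous_onI continuous_intros)
  have eq: "(\<lambda>p. Complex (fst p) (snd p)) -` box l u = box (Re l, Im l) (Re u, Im u)"
    by (auto simp: box_def Basis_complex_def Basis_prod_def inner_complex_def)
  have 1: "Re l \<le> Re u" using le[of 1] by (simp add: Basis_complex_def)
  have 2: "Im l \<le> Im u" using le[of \<i>] by (simp add: Basis_complex_def)
  have "emeasure (distr lborel borel (\<lambda>p. Complex (fst p) (snd p))) (box l u)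
      = emeasure lborel (box (Re l, Im l) (Re u, Im u))"
    by (subst emeasure_distr) (simp_all add: eq)
  also have "\<dots> = ennreal (\<Prod>b\<in>Basis. (u - l) \<bullet> b)"
    using 1 2 by (subst emeasure_lborel_box)
       (auto simp: Basis_complex_def Basis_prod_def prod.union_disjoint)
  finally show "emeasure (distr lborel borel (\<lambda>p. Complex (fst p) (snd p))) (box l u)
      = ennreal (\<Prod>b\<in>Basis. (u - l) \<bullet> b)" .
qed simp

text \<open>A rotation by an angle other than \<open>\<pi>\<close> is a product of three shears.\<close>

lemma lborel_complex_rotation:
  fixes c :: complex
  assumes "norm c = 1" "Re c \<noteq> - 1"
  shows "distr lborel borel (\<lambda>z. c * z) = lborel"
proof -
  \<comment> \<open>For c = cis \<theta> this t is - tan (\<theta> / 2), the coefficient of the two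
    outer shears; the middle one has q = sin \<theta>. The tangent is undefined at angle \<pi>,
    whence the assumption on \<open>Re c\<close>.\<close>
  define p q t where "p = Re c" and "q = Im c" and "t = - (q / (1 + p))"
  let ?s = "\<lambda>w::real \<times> real. (fst w + t * snd w, snd w)"
    and ?h = "\<lambda>w::real \<times> real. (fst w, snd w + q * fst w)"
    and ?C = "\<lambda>w. Complex (fst w) (snd w)"
  have m: "?s \<in> borel \<rightarrow>\<^sub>M borel" "?h \<in> borel \<rightarrow>\<^sub>M borel" "?C \<in> borel \<rightarrow>\<^sub>M borel"
    "(\<lambda>z. c * z) \<in> borel \<rightarrow>\<^sub>M borel"
    by (intro borel_measurable_continuous_onI continuous_intros | simp add: Complex_eq)+
  have m2: "(\<lambda>w. ?s (?h w)) \<in> borel \<rightarrow>\<^sub>M borel" "(\<lambda>w. ?s (?h (?s w))) \<in> borel \<rightarrow>\<^sub>M borel"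
    by (rule measurable_compose[OF m(2,1)], rule measurable_compose[OF m(1) measurable_compose[OF m(2,1)]])
  have p: "1 + p \<noteq> 0" using assms by (simp add: p_def)
  have pq: "p\<^sup>2 + q\<^sup>2 = 1"
    using assms(1) by (simp add: p_def q_def cmod_def)
  have t1: "1 + q * t = p" using p pq by (simp add: t_def field_simps power2_eq_square)
  have "t * (1 + p) = - q" using p by (simp add: t_def)
  then have t2: "t + t * p = - q" by (simp add: algebra_simps)
  have eq: "?C (?s (?h (?s w))) = c * ?C w" for w
  proof (rule complex_eqI)
    have "snd (?h (?s w)) = q * fst w + p * snd w"
      unfolding t1[symmetric] by (simp add: algebra_simps)
    then show "Im (?C (?s (?h (?s w)))) = Im (c * ?C w)"
      by (simp add: p_def q_def)
    have "fst (?s (?h (?s w))) = (1 + q * t) * fst w + (t + t * (1 + q * t)) * snd w"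
      by (simp add: algebra_simps)
    then show "Re (?C (?s (?h (?s w)))) = Re (c * ?C w)"
      unfolding t1 t2 by (simp add: p_def q_def)
  qed
  have "distr lborel borel (\<lambda>w. ?s (?h w)) = lborel"
    by (rule distr_comp_eq[OF lborel_shear_snd lborel_shear_fst]) (simp_all only: measurable_lborel1 measurable_lborel2 m)
  then have "distr lborel borel (\<lambda>w. ?s (?h (?s w))) = lborel"
    by (rule distr_comp_eq[OF lborel_shear_fst]) (simp_all only: measurable_lborel1 measurable_lborel2 m m2)
  then have "distr lborel borel (\<lambda>w. ?C (?s (?h (?s w)))) = lborel"
    by (rule distr_comp_eq[OF _ lborel_complex]) (simp_all only: measurable_lborel1 measurable_lborel2 m m2)
  then have "distr lborel borel (\<lambda>w. c * ?C w) = lborel"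
    unfolding eq .
  moreover have "distr (distr lborel borel ?C) borel (\<lambda>z. c * z) = distr lborel borel (\<lambda>w. c * ?C w)"
    by (subst distr_distr) (simp_all add: m o_def)
  ultimately show ?thesis by (simp add: lborel_complex)
qed

lemma sets_gauss_measure [simp, measurable_cong]: "sets gauss_measure = sets borel"
  by (simp add: gauss_measure_def)

lemma space_gauss_measure [simp]: "space gauss_measure = UNIV"
  by (simp add: gauss_measure_def)

text \<open>The density depends on \<open>norm z\<close> only. The purpose is to make the one-point
  integral of a ring function vanish, for which one well-chosen \<open>c\<close> is enough.\<close>

lemma gauss_measure_rotation:
  fixes c :: complex
  assumes "norm c = 1" "Re c \<noteq> - 1"
  shows "distr gauss_measure borel (\<lambda>z. c * z) = gauss_measure"
proof (rule measure_eqI)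
  fix A assume "A \<in> sets (distr gauss_measure borel (\<lambda>z. c * z))"
  then have [measurable]: "A \<in> sets borel" by simp
  let ?g = "\<lambda>z::complex. ennreal (exp (- (norm z)\<^sup>2) / pi)"
  have "emeasure (distr gauss_measure borel (\<lambda>z. c * z)) A
      = (\<integral>\<^sup>+z. indicator A (c * z) \<partial>gauss_measure)"
    by (subst nn_integral_indicator[symmetric], simp, subst nn_integral_distr) auto
  also have "\<dots> = (\<integral>\<^sup>+z. ?g (c * z) * indicator A (c * z) \<partial>lborel)"
    using assms(1) by (simp add: gauss_measure_def nn_integral_density norm_mult)
  also have "\<dots> = (\<integral>\<^sup>+z. ?g z * indicator A z \<partial>distr lborel borel (\<lambda>z. c * z))"
    by (subst nn_integral_distr) auto
  also have "\<dots> = emeasure gauss_measure A"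
    by (simp add: lborel_complex_rotation[OF assms] gauss_measure_def emeasure_density)
  finally show "emeasure (distr gauss_measure borel (\<lambda>z. c * z)) A = emeasure gauss_measure A" .
qed simp

text \<open>The disc |z|^2 \<le> t has area \<pi> t, and closed half-lines generate the Borel sets.
  Under \<open>gauss_measure\<close> the variable |z|^2 is therefore exponential with rate
  1.\<close>

lemma distr_lborel_norm_square:
  "distr lborel borel (\<lambda>z::complex. (norm z)\<^sup>2) = density lborel (\<lambda>t::real. ennreal (pi * indicator {0..} t))"
proof (rule measure_eqI_generator_eq[where E = "range (atMost :: real \<Rightarrow> _)" and \<Omega> = UNIV and A = "\<lambda>n. {..real n}"])
  show "Int_stable (range atMost :: real set set)"
    by (auto simp: Int_stable_def)
  have gen: "sets (borel :: real measure) = sigma_sets UNIV (range atMost)"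
    by (subst borel_eq_atMost) simp
  show "sets (distr lborel borel (\<lambda>z::complex. (norm z)\<^sup>2)) = sigma_sets UNIV (range atMost)"
    "sets (density lborel (\<lambda>t::real. ennreal (pi * indicator {0..} t))) = sigma_sets UNIV (range atMost)"
    by (simp_all add: gen)
  have em: "emeasure (distr lborel borel (\<lambda>z::complex. (norm z)\<^sup>2)) {..t} = ennreal (pi * max 0 t)" for t
  proof -
    have "(\<lambda>z::complex. (norm z)\<^sup>2) -` {..t} = (if t < 0 then {} else cball 0 (sqrt t))"
    proof (cases "t < 0")
      case True
      then have "\<not> (norm x)\<^sup>2 \<le> t" for x :: complex
        by (simp add: not_le less_le_trans)
      with True show ?thesis by auto
    next
      case False
      then show ?thesis
        using real_sqrt_le_iff[of "(norm x)\<^sup>2" t for x :: complex] by auto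
    qed
    then show ?thesis
      by (subst emeasure_distr) (auto simp: emeasure_cball unit_ball_vol_2 powr_realpow max_def)
  qed
  show "emeasure (distr lborel borel (\<lambda>z::complex. (norm z)\<^sup>2)) X
      = emeasure (density lborel (\<lambda>t::real. ennreal (pi * indicator {0..} t))) X" if "X \<in> range atMost" for X
  proof -
    from that obtain t where X: "X = {..t}" by (rule imageE)
    have "emeasure (density lborel (\<lambda>t::real. ennreal (pi * indicator {0..} t))) X
        = (\<integral>\<^sup>+x. ennreal pi * indicator {0..t} x \<partial>lborel)"
      unfolding X by (subst emeasure_density) (auto intro!: nn_integral_cong split: split_indicator)
    also have "\<dots> = ennreal (pi * max 0 t)"
      by (subst nn_integral_cmult_indicator) (auto simp: ennreal_mult max_def)
    finally show ?thesis using em X by simp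
  qed
  show "emeasure (distr lborel borel (\<lambda>z::complex. (norm z)\<^sup>2)) {..real i} \<noteq> \<infinity>" for i
    by (simp add: em)
  show "(\<Union>i. {..real i}) = UNIV"
    by (auto simp: real_arch_simple)
qed auto

text \<open>Moments of an exponential variable. They normalise the monomials, and those of index m,
  m + 1, m + 2 together give mean and variance of |z|^2 under the weight |z|^(2m) / m!.\<close>

lemma gauss_measure_moment:
  "has_bochner_integral gauss_measure (\<lambda>z::complex. (norm z)^(2 * m)) (fact m)"
proof (rule has_bochner_integral_nn_integral)
  have "(\<integral>\<^sup>+z. ennreal ((norm z)^(2 * m)) \<partial>gauss_measure)
      = (\<integral>\<^sup>+(z::complex). ennreal (((norm z)\<^sup>2)^m * exp (- (norm z)\<^sup>2) / pi) \<partial>lborel)"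
    unfolding gauss_measure_def
    by (subst nn_integral_density)
       (auto simp: ennreal_mult[symmetric] power_mult[symmetric] mult.commute intro!: nn_integral_cong)
  also have "\<dots> = (\<integral>\<^sup>+t. ennreal (t^m * exp (- t) / pi) \<partial>distr lborel borel (\<lambda>z::complex. (norm z)\<^sup>2))"
    by (subst nn_integral_distr) auto
  also have "\<dots> = (\<integral>\<^sup>+t. ennreal (t^m * exp (- t)) * indicator {0..} t \<partial>lborel)"
    unfolding distr_lborel_norm_square
    by (subst nn_integral_density)
       (auto simp: ennreal_mult'[symmetric] intro!: nn_integral_cong split: split_indicator)
  also have "\<dots> = ennreal (fact m)"
    by (simp add: nn_intergal_power_times_exp_Ici)
  finally show "(\<integral>\<^sup>+z. ennreal ((norm z)^(2 * m)) \<partial>gauss_measure) = ennreal (fact m)" .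
qed auto

lemma prob_space_gauss_measure: "prob_space gauss_measure"
proof (rule prob_spaceI)
  have "(\<integral>\<^sup>+z. ennreal ((norm z)^(2 * 0)) \<partial>gauss_measure) = ennreal (fact 0)"
    using has_bochner_integral_iff[THEN iffD1, OF gauss_measure_moment[of 0]]
    by (subst nn_integral_eq_integral) (auto simp: gauss_measure_moment)
  then show "emeasure gauss_measure (space gauss_measure) = 1" by simp
qed

section \<open>Correlation functions of determinantal processes\<close>

lemma config_space_locally_finite: "S \<in> space config_space \<Longrightarrow> bounded B \<Longrightarrow> finite (S \<inter> B)"
  by (auto simp: config_space_def space_measure_of_conv locally_finite_config_def)

lemma measurable_card_config:
  assumes B: "B \<in> sets borel" "bounded B"
  shows "(\<lambda>S. card (S \<inter> B)) \<in> measurable config_space (count_space UNIV)"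
proof (subst measurable_count_space_eq2_countable, safe)
  show "(\<lambda>S. card (S \<inter> B)) -` {k} \<inter> space config_space \<in> sets config_space" for k
  proof -
    have "(\<lambda>S. card (S \<inter> B)) -` {k} \<inter> space config_space
        = {S. locally_finite_config S \<and> card (S \<inter> B) = k}"
      by (auto simp: config_space_def space_measure_of_conv)
    also have "\<dots> \<in> sets config_space"
      unfolding config_space_def using B by (intro in_measure_of) auto
    finally show "(\<lambda>S. card (S \<inter> B)) -` {k} \<inter> space config_space \<in> sets config_space" .
  qed
qed auto

text \<open>The bridge from sums over points to counts in cells: both the sigma-algebra of
  \<open>config_space\<close> and the correlation functions know a configuration only through such
  counts.\<close>

lemma sum_simple_function_fibres:
  fixes g :: "'b \<Rightarrow> 'c::real_algebra_1"
  assumes "finite A" "finite (range q)"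
  shows "(\<Sum>z\<in>A. g (q z)) = (\<Sum>a\<in>range q. g a * of_nat (card (A \<inter> q -` {a})))"
proof -
  have "(\<Sum>z\<in>A. g (q z)) = (\<Sum>a\<in>range q. \<Sum>z\<in>{z\<in>A. q z = a}. g (q z))"
    using assms by (intro sum.group[symmetric]) auto
  also have "\<dots> = (\<Sum>a\<in>range q. g a * of_nat (card (A \<inter> q -` {a})))"
  proof (rule sum.cong[OF refl])
    fix a
    have "{z\<in>A. q z = a} = A \<inter> q -` {a}" by auto
    moreover have "(\<Sum>z\<in>{z\<in>A. q z = a}. g (q z)) = (\<Sum>z\<in>{z\<in>A. q z = a}. g a)"
      by (rule sum.cong) auto
    ultimately show "(\<Sum>z\<in>{z\<in>A. q z = a}. g (q z)) = g a * of_nat (card (A \<inter> q -` {a}))"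
      by (simp add: mult_of_nat_commute)
  qed
  finally show ?thesis .
qed

lemma simple_function_borelD:
  assumes "simple_function borel q"
  shows "finite (range q)" "q -` {a} \<in> sets borel"
  using assms simple_functionD[OF assms] by (auto simp: simple_function_def)

text \<open>Only counts are measurable by definition. For simple functions the sum is a combination
  of counts, and the general case is a pointwise limit, since the sum is finite for each
  configuration.\<close>

lemma borel_measurable_config_sum:
  fixes f :: "complex \<Rightarrow> complex"
  assumes f: "f \<in> borel_measurable borel" and B: "B \<in> sets borel" "bounded B"
  shows "(\<lambda>S. \<Sum>z\<in>S \<inter> B. f z) \<in> borel_measurable config_space"
proof -
  from borel_measurable_implies_sequence_metric[OF f, of 0] obtain F where
    F: "\<And>i. simple_function borel (F i)" "\<And>x. (\<lambda>i. F i x) \<longlonglongrightarrow> f x" by auto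
  show ?thesis
  proof (rule borel_measurable_LIMSEQ_metric[where f = "\<lambda>i S. \<Sum>z\<in>S \<inter> B. F i z"])
    fix i
    have [measurable]: "(\<lambda>S. card (S \<inter> (B \<inter> F i -` {a}))) \<in> measurable config_space (count_space UNIV)" for a
      using B simple_function_borelD(2)[OF F(1)] by (intro measurable_card_config) (auto intro: bounded_subset)
    have "(\<lambda>S. \<Sum>a\<in>range (F i). a * of_nat (card (S \<inter> (B \<inter> F i -` {a})))) \<in> borel_measurable config_space"
      by measurable
    then show "(\<lambda>S. \<Sum>z\<in>S \<inter> B. F i z) \<in> borel_measurable config_space"
      by (rule measurable_cong[THEN iffD2, rotated])
         (simp add: sum_simple_function_fibres[where g = "\<lambda>x. x"] config_space_locally_finite B
            simple_function_borelD(1)[OF F(1)] Int_assoc)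
  qed (intro tendsto_sum F(2))
qed

lemma integral_config_measure:
  fixes f :: "complex \<Rightarrow> 'b::{banach, second_countable_topology}"
  assumes "f \<in> borel_measurable borel" "finite (S \<inter> B)" "\<And>z. z \<notin> B \<Longrightarrow> f z = 0"
  shows "(\<integral>z. f z \<partial>config_measure S) = (\<Sum>z\<in>S \<inter> B. f z)"
proof -
  have "(\<integral>z. f z \<partial>config_measure S) = (\<integral>z. f z \<partial>count_space S)"
    unfolding config_measure_def using assms(1) by (subst integral_distr) auto
  also have "\<dots> = (\<Sum>z | z \<in> S \<and> f z \<noteq> 0. f z)"
    using assms(3) by (intro lebesgue_integral_count_space_finite_support finite_subset[OF _ assms(2)]) auto
  also have "\<dots> = (\<Sum>z\<in>S \<inter> B. f z)"
    using assms by (intro sum.mono_neutral_left) auto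
  finally show ?thesis .
qed

lemma det_mat_2:
  "Determinant.det (Matrix.mat 2 2 a) = a (0, 0) * a (1, 1) - a (0, 1) * a (1, 0)"
  for a :: "nat \<times> nat \<Rightarrow> 'a::comm_ring_1"
proof -
  let ?A = "Matrix.mat 2 2 a"
  have A: "?A \<in> carrier_mat 2 2" by simp
  have d: "Determinant.det (mat_delete ?A i 0) = a (1 - i, 1)" if "i < 2" for i
    using that by (subst det_single) (auto simp: mat_delete_def less_2_cases_iff)
  have "Determinant.det ?A = (\<Sum>i<2. ?A $$ (i, 0) * cofactor ?A i 0)"
    by (rule laplace_expansion_column[OF A]) simp
  also have "\<dots> = (\<Sum>i\<in>{0, 1}. ?A $$ (i, 0) * cofactor ?A i 0)"
    by (intro sum.cong) auto
  finally show ?thesis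
    using d[of 0] d[of 1] by (simp add: cofactor_def algebra_simps)
qed

lemma distr_PiM_pair:
  assumes "sigma_finite_measure \<mu>"
  shows "distr (PiM {0, 1::nat} (\<lambda>_. \<mu>)) (\<mu> \<Otimes>\<^sub>M \<mu>) (\<lambda>\<sigma>. (\<sigma> 0, \<sigma> 1)) = \<mu> \<Otimes>\<^sub>M \<mu>"
proof (rule measure_eqI)
  interpret sigma_finite_measure \<mu> by fact
  interpret product_sigma_finite "\<lambda>_::nat. \<mu>" by standard
  fix A assume "A \<in> sets (distr (PiM {0, 1::nat} (\<lambda>_. \<mu>)) (\<mu> \<Otimes>\<^sub>M \<mu>) (\<lambda>\<sigma>. (\<sigma> 0, \<sigma> 1)))"
  then have [measurable]: "A \<in> sets (\<mu> \<Otimes>\<^sub>M \<mu>)" by simp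
  have "emeasure (distr (PiM {0, 1::nat} (\<lambda>_. \<mu>)) (\<mu> \<Otimes>\<^sub>M \<mu>) (\<lambda>\<sigma>. (\<sigma> 0, \<sigma> 1))) A
      = (\<integral>\<^sup>+\<sigma>. indicator A (\<sigma> 0, \<sigma> 1) \<partial>PiM {0, 1::nat} (\<lambda>_. \<mu>))"
    by (subst nn_integral_indicator[symmetric], simp, subst nn_integral_distr) auto
  also have "\<dots> = emeasure (\<mu> \<Otimes>\<^sub>M \<mu>) A"
    by (subst product_nn_integral_pair[where f = "\<lambda>x y. indicator A (x, y)"]) auto
  finally show "emeasure (distr (PiM {0, 1::nat} (\<lambda>_. \<mu>)) (\<mu> \<Otimes>\<^sub>M \<mu>) (\<lambda>\<sigma>. (\<sigma> 0, \<sigma> 1))) A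
    = emeasure (\<mu> \<Otimes>\<^sub>M \<mu>) A" .
qed simp

text \<open>The two-point correlation function, that is the 2 by 2 determinant, as a function on the
  binary product. It vanishes on the diagonal.\<close>

definition pair_intensity :: "(complex \<Rightarrow> complex \<Rightarrow> complex) \<Rightarrow> complex \<times> complex \<Rightarrow> complex" where
  "pair_intensity K p = K (fst p) (fst p) * K (snd p) (snd p) - K (fst p) (snd p) * K (snd p) (fst p)"

lemma determinantal_process_intensity:
  assumes X: "determinantal_process M X K \<mu>" and \<mu>: "sigma_finite_measure \<mu>" "sets \<mu> = sets borel"
    and K: "continuous_on UNIV (\<lambda>z. K z z)"
    and B: "B \<in> sets borel" "bounded B"
  shows "has_bochner_integral M (\<lambda>\<omega>. of_nat (card (X \<omega> \<inter> B))) (\<integral>z. indicator B z *\<^sub>R K z z \<partial>\<mu>)"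
proof -
  note [measurable_cong] = \<mu>(2)
  interpret sigma_finite_measure \<mu> by fact
  interpret product_sigma_finite "\<lambda>_::nat. \<mu>" by standard
  have [measurable]: "(\<lambda>z. K z z) \<in> borel_measurable borel" "B \<in> sets borel"
    using K B by (auto intro: borel_measurable_continuous_onI)
  have one: "{..<1::nat} = {0}" by auto
  have "has_bochner_integral M (\<lambda>\<omega>. \<Prod>i<1::nat. of_nat (card (X \<omega> \<inter> B)))
          (LINT z:PiE {..<1::nat} (\<lambda>_. B)|PiM {..<1} (\<lambda>_. \<mu>).
             Determinant.det (Matrix.mat 1 1 (\<lambda>(i, j). K (z i) (z j))))"
    using X B unfolding determinantal_process_def
    by (elim conjE allE[of _ 1] allE[of _ "\<lambda>_. B"]) (auto simp: disjoint_family_on_def one)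
  moreover have "(LINT z:PiE {..<1::nat} (\<lambda>_. B)|PiM {..<1} (\<lambda>_. \<mu>).
             Determinant.det (Matrix.mat 1 1 (\<lambda>(i, j). K (z i) (z j))))
      = (\<integral>z. (\<lambda>x. indicator B x *\<^sub>R K x x) (z 0) \<partial>PiM {0::nat} (\<lambda>_. \<mu>))"
    unfolding set_lebesgue_integral_def one
    by (intro Bochner_Integration.integral_cong)
       (auto simp: det_single space_PiM PiE_iff split: split_indicator)
  moreover have "\<dots> = (\<integral>z. indicator B z *\<^sub>R K z z \<partial>\<mu>)"
    by (rule product_integral_singleton) measurable
  ultimately show ?thesis by (simp add: one)
qed

text \<open>The case k = 2 of the definition, moved from functions on {0, 1} to the binary product.
  Disjointness ensures that the product of counts counts pairs of distinct points only.\<close>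

lemma determinantal_process_pair_intensity:
  assumes X: "determinantal_process M X K \<mu>" and \<mu>: "sigma_finite_measure \<mu>" "sets \<mu> = sets borel"
    and K: "continuous_on UNIV (\<lambda>p. K (fst p) (snd p))"
    and A: "A \<in> sets borel" "bounded A" and B: "B \<in> sets borel" "bounded B" and disj: "A \<inter> B = {}"
  shows "has_bochner_integral M (\<lambda>\<omega>. of_nat (card (X \<omega> \<inter> A)) * of_nat (card (X \<omega> \<inter> B)))
           (\<integral>p. indicator (A \<times> B) p *\<^sub>R pair_intensity K p \<partial>(\<mu> \<Otimes>\<^sub>M \<mu>))"
proof -
  note [measurable_cong] = \<mu>(2)
  have K': "continuous_on UNIV (\<lambda>p. K (f p) (g p))"
    if "continuous_on UNIV f" "continuous_on UNIV g" for f g :: "complex \<times> complex \<Rightarrow> complex"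
    using continuous_on_compose2[OF K continuous_on_Pair[OF that]] by simp
  have "pair_intensity K \<in> borel_measurable borel"
    unfolding pair_intensity_def by (intro borel_measurable_continuous_onI continuous_intros K')
  then have [measurable]: "pair_intensity K \<in> borel_measurable (\<mu> \<Otimes>\<^sub>M \<mu>)"
    by (subst measurable_cong_sets[OF sets_pair_measure_cong[OF \<mu>(2) \<mu>(2)] refl]) (simp add: borel_prod)
  have [measurable]: "A \<in> sets borel" "B \<in> sets borel" by fact+
  let ?B = "\<lambda>i::nat. if i = 0 then A else B"
  have two: "{..<2::nat} = {0, 1}" by auto
  have "has_bochner_integral M (\<lambda>\<omega>. \<Prod>i<2. of_nat (card (X \<omega> \<inter> ?B i)))
          (LINT z:PiE {..<2} ?B|PiM {..<2} (\<lambda>_. \<mu>).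
             Determinant.det (Matrix.mat 2 2 (\<lambda>(i, j). K (z i) (z j))))"
    using X A B disj unfolding determinantal_process_def
    by (elim conjE allE[of _ 2] allE[of _ ?B]) (auto simp: disjoint_family_on_def two)
  moreover have "(LINT z:PiE {..<2} ?B|PiM {..<2} (\<lambda>_. \<mu>).
             Determinant.det (Matrix.mat 2 2 (\<lambda>(i, j). K (z i) (z j))))
      = (\<integral>z. (\<lambda>p. indicator (A \<times> B) p *\<^sub>R pair_intensity K p) (z 0, z 1) \<partial>PiM {0, 1::nat} (\<lambda>_. \<mu>))"
    unfolding set_lebesgue_integral_def two
    by (intro Bochner_Integration.integral_cong)
       (auto simp: det_mat_2 pair_intensity_def space_PiM PiE_iff split: split_indicator)
  moreover have "\<dots> = (\<integral>p. indicator (A \<times> B) p *\<^sub>R pair_intensity K p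
        \<partial>distr (PiM {0, 1::nat} (\<lambda>_. \<mu>)) (\<mu> \<Otimes>\<^sub>M \<mu>) (\<lambda>\<sigma>. (\<sigma> 0, \<sigma> 1)))"
    by (subst integral_distr) measurable
  ultimately show ?thesis
    by (simp add: distr_PiM_pair[OF \<mu>(1), simplified] two)
qed

section \<open>Sums over single points and over pairs of distinct points\<close>

lemma continuous_bounded_on_bounded:
  fixes g :: "'a::heine_borel \<Rightarrow> 'b::real_normed_vector"
  assumes "continuous_on UNIV g" "bounded S"
  shows "\<exists>C\<ge>0. \<forall>x\<in>S. norm (g x) \<le> C"
proof -
  have "compact (closure S)" using assms(2) by (simp add: compact_closure)
  then have "bounded (g ` closure S)"
    using assms(1) by (intro compact_imp_bounded compact_continuous_image) (auto intro: continuous_on_subset)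
  then obtain C where "\<forall>x\<in>closure S. norm (g x) \<le> C" by (auto simp: bounded_iff)
  then have "norm (g x) \<le> max C 0" if "x \<in> S" for x
    using closure_subset[of S] that by (auto intro: max.coboundedI1)
  then show ?thesis by (intro exI[of _ "max C 0"]) simp
qed

text \<open>Composing g with q i makes it constant on cells. The norm bound keeps the image of a
  bounded set in one ball for all i, so that a continuous g stays uniformly bounded there.\<close>

lemma simple_function_identity_approx:
  "\<exists>q :: nat \<Rightarrow> complex \<Rightarrow> complex. (\<forall>i. simple_function borel (q i)) \<and> (\<forall>z. (\<lambda>i. q i z) \<longlonglongrightarrow> z) \<and>
     (\<forall>i z. norm (q i z) \<le> 2 * norm z)"
  using borel_measurable_implies_sequence_metric[of "\<lambda>z::complex. z" borel 0] by simp

text \<open>The factor removing the diagonal is discontinuous, so continuity of g alone does not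
  suffice. Distinct points eventually have distinct values under q i, and equal points have equal
  values for every i.\<close>

lemma tendsto_off_diagonal:
  fixes g :: "complex \<times> complex \<Rightarrow> 'b::real_normed_vector"
  assumes q: "\<And>z. (\<lambda>i. q i z) \<longlonglongrightarrow> (z::complex)" and g: "continuous_on UNIV g"
  shows "(\<lambda>i. if fst (map_prod (q i) (q i) p) = snd (map_prod (q i) (q i) p) then 0 else g (map_prod (q i) (q i) p))
      \<longlonglongrightarrow> (if fst p = snd p then 0 else g p)"
proof (cases "fst p = snd p")
  case False
  have "(\<lambda>i. q i (fst p) - q i (snd p)) \<longlonglongrightarrow> fst p - snd p"
    by (intro tendsto_diff q)
  then have "eventually (\<lambda>i. q i (fst p) - q i (snd p) \<noteq> 0) sequentially"
    using False by (intro tendsto_imp_eventually_ne) auto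
  then have ev: "eventually (\<lambda>i. g (map_prod (q i) (q i) p)
      = (if fst (map_prod (q i) (q i) p) = snd (map_prod (q i) (q i) p) then 0 else g (map_prod (q i) (q i) p))) sequentially"
    by eventually_elim simp
  have "isCont g (fst p, snd p)"
    using g continuous_on_eq_continuous_at[OF open_UNIV, of g] by blast
  then have "(\<lambda>i. g (q i (fst p), q i (snd p))) \<longlonglongrightarrow> g (fst p, snd p)"
    by (rule isCont_tendsto_compose) (intro tendsto_Pair q)
  then have "(\<lambda>i. g (map_prod (q i) (q i) p)) \<longlonglongrightarrow> g p"
    by (simp add: map_prod_def case_prod_beta')
  from Lim_transform_eventually[OF this ev] False show ?thesis by simp
qed (simp add: map_prod_def case_prod_beta')

locale continuous_determinantal_process = prob_space M + \<mu>: prob_space \<mu>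
  for M :: "'w measure" and \<mu> :: "complex measure" +
  fixes X :: "'w \<Rightarrow> complex set" and K :: "complex \<Rightarrow> complex \<Rightarrow> complex"
  assumes det: "determinantal_process M X K \<mu>" and sets_\<mu> [simp, measurable_cong]: "sets \<mu> = sets borel"
    and cont_K: "continuous_on UNIV (\<lambda>p. K (fst p) (snd p))"
begin

sublocale pair: pair_sigma_finite \<mu> \<mu> ..

sublocale pair_prob: prob_space "\<mu> \<Otimes>\<^sub>M \<mu>"
  by (intro prob_space_pair) unfold_locales

lemma measurable_X: "X \<in> measurable M config_space"
  using det by (simp add: determinantal_process_def)

lemma finite_X: "\<omega> \<in> space M \<Longrightarrow> bounded B \<Longrightarrow> finite (X \<omega> \<inter> B)"
  using measurable_space[OF measurable_X] by (rule config_space_locally_finite)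

lemma measurable_config_sum:
  fixes f :: "complex \<Rightarrow> complex"
  assumes "f \<in> borel_measurable borel" "B \<in> sets borel" "bounded B"
  shows "(\<lambda>\<omega>. \<Sum>z\<in>X \<omega> \<inter> B. f z) \<in> borel_measurable M"
  by (rule measurable_compose[OF measurable_X borel_measurable_config_sum[OF assms]])

lemma sets_pair_\<mu>: "sets (\<mu> \<Otimes>\<^sub>M \<mu>) = sets borel"
  by (simp add: borel_prod[symmetric] cong: sets_pair_measure_cong)

lemma continuous_K: "continuous_on S f \<Longrightarrow> continuous_on S g \<Longrightarrow> continuous_on S (\<lambda>x. K (f x) (g x))"
  for f :: "'a::topological_space \<Rightarrow> complex"
  using continuous_on_compose2[OF cont_K continuous_on_Pair[of S f g]] by simp

lemma continuous_K_diagonal: "continuous_on UNIV (\<lambda>z. K z z)"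
  by (intro continuous_K continuous_intros)

lemma measurable_K_diagonal: "(\<lambda>z. K z z) \<in> borel_measurable borel"
  by (rule borel_measurable_continuous_onI[OF continuous_K_diagonal])

lemma integrable_indicator_K_diagonal:
  assumes A: "A \<in> sets borel" "bounded A"
  shows "integrable \<mu> (\<lambda>z. indicator A z *\<^sub>R K z z)"
proof -
  obtain D where D: "D \<ge> 0" "\<forall>z\<in>A. norm (K z z) \<le> D"
    using continuous_bounded_on_bounded[OF continuous_K_diagonal A(2)] by blast
  have m: "(\<lambda>z. K z z) \<in> borel_measurable \<mu>" "A \<in> sets \<mu>"
    unfolding measurable_cong_sets[OF sets_\<mu> refl] using A(1) by (simp_all add: measurable_K_diagonal)
  show ?thesis
  proof (rule \<mu>.integrable_const_bound)
    show "AE z in \<mu>. norm (indicator A z *\<^sub>R K z z) \<le> D"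
      by (rule AE_I2) (use D in \<open>simp split: split_indicator\<close>)
    show "(\<lambda>z. indicator A z *\<^sub>R K z z) \<in> borel_measurable \<mu>"
      by (intro borel_measurable_scaleR borel_measurable_indicator m)
  qed
qed

lemma continuous_pair_intensity: "continuous_on UNIV (pair_intensity K)"
  unfolding pair_intensity_def by (intro continuous_intros continuous_K)

lemma measurable_pair_intensity [measurable]: "pair_intensity K \<in> borel_measurable (\<mu> \<Otimes>\<^sub>M \<mu>)"
  by (subst measurable_cong_sets[OF sets_pair_\<mu> refl])
     (rule borel_measurable_continuous_onI[OF continuous_pair_intensity])

lemma card_sum:
  assumes B: "B \<in> sets borel" "bounded B"
  shows "integrable M (\<lambda>\<omega>. real (card (X \<omega> \<inter> B)))"
    and "complex_of_real (\<integral>\<omega>. real (card (X \<omega> \<inter> B)) \<partial>M) = (\<integral>z. indicator B z *\<^sub>R K z z \<partial>\<mu>)"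
proof -
  have "has_bochner_integral M (\<lambda>\<omega>. of_nat (card (X \<omega> \<inter> B))) (\<integral>z. indicator B z *\<^sub>R K z z \<partial>\<mu>)"
    by (rule determinantal_process_intensity[OF det \<mu>.sigma_finite_measure_axioms sets_\<mu> continuous_K_diagonal B])
  then have "has_bochner_integral M (\<lambda>\<omega>. complex_of_real (real (card (X \<omega> \<inter> B)))) (\<integral>z. indicator B z *\<^sub>R K z z \<partial>\<mu>)"
    by simp
  then show "integrable M (\<lambda>\<omega>. real (card (X \<omega> \<inter> B)))"
    "complex_of_real (\<integral>\<omega>. real (card (X \<omega> \<inter> B)) \<partial>M) = (\<integral>z. indicator B z *\<^sub>R K z z \<partial>\<mu>)"
    unfolding has_bochner_integral_iff complex_of_real_integrable_eq integral_complex_of_real by auto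
qed

text \<open>Sums over points are approximated by sums over the cells of a simple function close to the
  identity.\<close>

lemma one_point_sum:
  fixes g :: "complex \<Rightarrow> complex"
  assumes B: "B \<in> sets borel" "bounded B" and g: "continuous_on UNIV g"
  shows "has_bochner_integral M (\<lambda>\<omega>. \<Sum>z\<in>X \<omega> \<inter> B. g z) (\<integral>z. indicator B z *\<^sub>R (g z * K z z) \<partial>\<mu>)"
proof -
  obtain q where q: "\<And>i. simple_function borel (q i)" "\<And>z. (\<lambda>i. q i z) \<longlonglongrightarrow> z"
    "\<And>i z. norm (q i z) \<le> 2 * norm (z::complex)"
    using simple_function_identity_approx by blast
  note fin = simple_function_borelD(1)[OF q(1)]
  have [measurable]: "q i -` {a} \<in> sets borel" for i a using simple_function_borelD(2)[OF q(1)] .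
  have [measurable]: "B \<in> sets borel" "g \<in> borel_measurable borel" "q i \<in> borel_measurable borel" for i
    using B g q(1)[of i] by (auto intro: borel_measurable_continuous_onI borel_measurable_simple_function)
  obtain R where R: "\<And>z. z \<in> B \<Longrightarrow> norm z \<le> R" using B(2) by (auto simp: bounded_iff)
  obtain C where C: "C \<ge> 0" "\<And>z. z \<in> cball 0 (2 * R) \<Longrightarrow> norm (g z) \<le> C"
    using continuous_bounded_on_bounded[OF g bounded_cball[of 0 "2 * R"]] by blast
  obtain D where D: "D \<ge> 0" "\<And>z. z \<in> B \<Longrightarrow> norm (K z z) \<le> D"
    using continuous_bounded_on_bounded[OF continuous_K_diagonal B(2)] by blast
  have gq: "norm (g (q i z)) \<le> C" if "z \<in> B" for i z
    using R[OF that] q(3)[of i z] by (intro C(2)) auto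
  let ?c = "\<lambda>i \<omega>. \<Sum>z\<in>X \<omega> \<inter> B. g (q i z)"
  let ?C = "\<lambda>i z. indicator B z *\<^sub>R (g (q i z) * K z z)"
  have E: "B \<inter> q i -` {a} \<in> sets borel" "bounded (B \<inter> q i -` {a})" for i a
    by (simp, rule bounded_subset[OF B(2)], rule Int_lower1)
  note cell_intensity = determinantal_process_intensity[OF det \<mu>.sigma_finite_measure_axioms sets_\<mu> continuous_K_diagonal E]
  have c: "has_bochner_integral M (?c i) (integral\<^sup>L \<mu> (?C i))" for i
  proof -
    have "has_bochner_integral M (\<lambda>\<omega>. \<Sum>a\<in>range (q i). g a * of_nat (card (X \<omega> \<inter> (B \<inter> q i -` {a}))))
       (\<Sum>a\<in>range (q i). g a * (\<integral>z. indicator (B \<inter> q i -` {a}) z *\<^sub>R K z z \<partial>\<mu>))"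
      by (intro has_bochner_integral_sum has_bochner_integral_mult_right cell_intensity)
    also have "(\<Sum>a\<in>range (q i). g a * (\<integral>z. indicator (B \<inter> q i -` {a}) z *\<^sub>R K z z \<partial>\<mu>))
       = (\<integral>z. (\<Sum>a\<in>range (q i). g a * (indicator (B \<inter> q i -` {a}) z *\<^sub>R K z z)) \<partial>\<mu>)"
    proof -
      have "integrable \<mu> (\<lambda>z. indicator (B \<inter> q i -` {a}) z *\<^sub>R K z z)" for a
        by (rule integrable_indicator_K_diagonal[OF E])
      then have "integrable \<mu> (\<lambda>z. g a * (indicator (B \<inter> q i -` {a}) z *\<^sub>R K z z))" for a
        by (rule integrable_mult_right)
      then show ?thesis
        unfolding integral_mult_right_zero[symmetric] by (intro Bochner_Integration.integral_sum[symmetric])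
    qed
    also have "\<dots> = integral\<^sup>L \<mu> (?C i)"
    proof (intro Bochner_Integration.integral_cong refl)
      fix z
      have "(\<Sum>a\<in>range (q i). g a * (indicator (B \<inter> q i -` {a}) z *\<^sub>R K z z))
          = (\<Sum>a\<in>{q i z}. g a * (indicator (B \<inter> q i -` {a}) z *\<^sub>R K z z))"
        using fin[of i] by (intro sum.mono_neutral_right) (auto split: split_indicator)
      also have "\<dots> = ?C i z" by (cases "z \<in> B") simp_all
      finally show "(\<Sum>a\<in>range (q i). g a * (indicator (B \<inter> q i -` {a}) z *\<^sub>R K z z)) = ?C i z" .
    qed
    finally show ?thesis
    proof (rule has_bochner_integral_cong[THEN iffD1, rotated 3])
      fix \<omega> assume "\<omega> \<in> space M"
      from sum_simple_function_fibres[OF finite_X[OF this B(2)] fin[of i], of g]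
      show "(\<Sum>a\<in>range (q i). g a * of_nat (card (X \<omega> \<inter> (B \<inter> q i -` {a})))) = ?c i \<omega>"
        by (simp only: Int_assoc)
    qed (rule refl)+
  qed
  have gm: "isCont g z" for z
    using g by (simp add: continuous_on_eq_continuous_at)
  have lim: "(\<lambda>i. g (q i z)) \<longlonglongrightarrow> g z" for z
    using gm by (rule isCont_tendsto_compose) (rule q)
  have meas: "(\<lambda>\<omega>. \<Sum>z\<in>X \<omega> \<inter> B. g z) \<in> borel_measurable M"
    by (rule measurable_config_sum[OF _ B]) measurable
  \<comment> \<open>Domination by a multiple of the number of points in \<open>B\<close>, which is
    integrable by the first correlation function.\<close>
  have bnd: "norm (?c i \<omega>) \<le> C * real (card (X \<omega> \<inter> B))" for i \<omega>
    using sum_norm_bound[of "X \<omega> \<inter> B" "\<lambda>z. g (q i z)" C] gq by (simp add: mult.commute)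
  have intb: "integrable M (\<lambda>\<omega>. C * real (card (X \<omega> \<inter> B)))"
    using card_sum(1)[OF B] by simp
  have cm: "?c i \<in> borel_measurable M" for i using c by (rule borel_measurable_has_bochner_integral)
  note dom = meas cm intb AE_I2[OF tendsto_sum[OF lim]] AE_I2[OF bnd]
  have 1: "(\<lambda>i. \<integral>\<omega>. ?c i \<omega> \<partial>M) \<longlonglongrightarrow> (\<integral>\<omega>. (\<Sum>z\<in>X \<omega> \<inter> B. g z) \<partial>M)"
    by (rule integral_dominated_convergence[OF dom])
  have int: "integrable M (\<lambda>\<omega>. \<Sum>z\<in>X \<omega> \<inter> B. g z)"
    by (rule integrable_dominated_convergence[OF dom])
  have CD: "norm (?C i z) \<le> C * D" for i z
  proof (cases "z \<in> B")
    case True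
    have "norm (g (q i z)) * norm (K z z) \<le> C * D"
      by (rule mult_mono) (simp_all add: gq[OF True] D(2)[OF True] C(1))
    then show ?thesis using True by (simp add: norm_mult)
  next
    case False
    then show ?thesis using C(1) D(1) by simp
  qed
  have 2: "(\<lambda>i. integral\<^sup>L \<mu> (?C i)) \<longlonglongrightarrow> (\<integral>z. indicator B z *\<^sub>R (g z * K z z) \<partial>\<mu>)"
  proof (rule integral_dominated_convergence[where w = "\<lambda>_. C * D"])
    show "AE z in \<mu>. norm (?C i z) \<le> C * D" for i by (rule AE_I2) (rule CD)
    show "AE z in \<mu>. (\<lambda>i. ?C i z) \<longlonglongrightarrow> indicator B z *\<^sub>R (g z * K z z)"
      by (rule AE_I2) (rule tendsto_scaleR[OF tendsto_const tendsto_mult[OF lim tendsto_const]])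
    have m: "g \<in> borel_measurable \<mu>" "(\<lambda>z. K z z) \<in> borel_measurable \<mu>" "q i \<in> borel_measurable \<mu>"
      "B \<in> sets \<mu>" for i
      unfolding measurable_cong_sets[OF sets_\<mu> refl] sets_\<mu>
      by (rule borel_measurable_continuous_onI[OF g], rule measurable_K_diagonal,
          rule borel_measurable_simple_function[OF q(1)], rule B(1))
    have gqm: "(\<lambda>z. g (q i z)) \<in> borel_measurable \<mu>" for i
      by (rule measurable_compose[OF m(3) borel_measurable_continuous_onI[OF g]])
    show "?C i \<in> borel_measurable \<mu>" for i
      by (intro borel_measurable_scaleR borel_measurable_times borel_measurable_indicator m gqm)
    show "(\<lambda>z. indicator B z *\<^sub>R (g z * K z z)) \<in> borel_measurable \<mu>"
      by (intro borel_measurable_scaleR borel_measurable_times borel_measurable_indicator m)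
  qed (rule \<mu>.integrable_const)
  have eq: "(\<integral>\<omega>. ?c i \<omega> \<partial>M) = integral\<^sup>L \<mu> (?C i)" for i
    by (rule has_bochner_integral_integral_eq[OF c])
  have "(\<lambda>i. \<integral>\<omega>. ?c i \<omega> \<partial>M) \<longlonglongrightarrow> (\<integral>z. indicator B z *\<^sub>R (g z * K z z) \<partial>\<mu>)"
    using 2 by (simp only: eq)
  from LIMSEQ_unique[OF 1 this] int show ?thesis
    by (simp only: has_bochner_integral_iff)
qed

text \<open>Expanding over pairs of cells produces products of counts in two cells. The correlation
  data cover two disjoint cells; the assumption on g removes the terms where both cells are the
  same.\<close>

lemma cell_pair_sum:
  fixes g :: "complex \<times> complex \<Rightarrow> complex"
  assumes B: "B \<in> sets borel" "bounded B" and q: "simple_function borel q"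
    and g: "\<And>a. g (a, a) = 0"
  shows "has_bochner_integral M (\<lambda>\<omega>. \<Sum>p\<in>(X \<omega> \<inter> B) \<times> (X \<omega> \<inter> B). g (map_prod q q p))
    (\<integral>p. indicator (B \<times> B) p *\<^sub>R (g (map_prod q q p) * pair_intensity K p) \<partial>(\<mu> \<Otimes>\<^sub>M \<mu>))"
proof -
  note fin = simple_function_borelD(1)[OF q]
  have [measurable]: "q -` {a} \<in> sets borel" for a using simple_function_borelD(2)[OF q] .
  have [measurable]: "B \<in> sets borel" using B by simp
  let ?R = "range (map_prod q q)"
  have finR: "finite ?R" by (rule finite_subset[OF _ finite_cartesian_product[OF fin fin]]) auto
  define E where "E a = B \<inter> q -` {a}" for a
  have E: "E a \<in> sets borel" "bounded (E a)" for a
    unfolding E_def by (simp, rule bounded_subset[OF B(2)], rule Int_lower1)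
  note [measurable] = E(1)
  obtain D where D: "D \<ge> 0" "\<forall>p\<in>B \<times> B. norm (pair_intensity K p) \<le> D"
    using continuous_bounded_on_bounded[OF continuous_pair_intensity bounded_Times[OF B(2) B(2)]] by blast
  let ?I = "\<lambda>v p. indicator (E (fst v) \<times> E (snd v)) p *\<^sub>R pair_intensity K p"
  have int: "integrable (\<mu> \<Otimes>\<^sub>M \<mu>) (?I v)" for v
    using D by (intro pair_prob.integrable_const_bound[where B = D]) (auto simp: E_def split: split_indicator)
  have "has_bochner_integral M (\<lambda>\<omega>. \<Sum>v\<in>?R. g v * (of_nat (card (X \<omega> \<inter> E (fst v))) * of_nat (card (X \<omega> \<inter> E (snd v)))))
      (\<Sum>v\<in>?R. g v * integral\<^sup>L (\<mu> \<Otimes>\<^sub>M \<mu>) (?I v))"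
  proof (intro has_bochner_integral_sum)
    fix v
    show "has_bochner_integral M (\<lambda>\<omega>. g v * (of_nat (card (X \<omega> \<inter> E (fst v))) * of_nat (card (X \<omega> \<inter> E (snd v)))))
      (g v * integral\<^sup>L (\<mu> \<Otimes>\<^sub>M \<mu>) (?I v))"
    proof (cases "fst v = snd v")
      case True
      then have "g v = 0" using g[of "fst v"] by (cases v) auto
      then show ?thesis by (simp add: has_bochner_integral_iff)
    next
      case False
      then have "E (fst v) \<inter> E (snd v) = {}" by (auto simp: E_def)
      then show ?thesis
        by (intro has_bochner_integral_mult_right determinantal_process_pair_intensity[OF det \<mu>.sigma_finite_measure_axioms sets_\<mu> cont_K] E)
    qed
  qed
  also have "(\<Sum>v\<in>?R. g v * integral\<^sup>L (\<mu> \<Otimes>\<^sub>M \<mu>) (?I v)) = (\<integral>p. (\<Sum>v\<in>?R. g v * ?I v p) \<partial>(\<mu> \<Otimes>\<^sub>M \<mu>))"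
    using int unfolding integral_mult_right_zero[symmetric]
    by (intro Bochner_Integration.integral_sum[symmetric] integrable_mult_right)
  also have "\<dots> = (\<integral>p. indicator (B \<times> B) p *\<^sub>R (g (map_prod q q p) * pair_intensity K p) \<partial>(\<mu> \<Otimes>\<^sub>M \<mu>))"
  proof (intro Bochner_Integration.integral_cong refl)
    fix p
    have "(\<Sum>v\<in>?R. g v * ?I v p) = (\<Sum>v\<in>{map_prod q q p}. g v * ?I v p)"
      using finR by (intro sum.mono_neutral_right) (auto simp: E_def split: split_indicator)
    also have "\<dots> = indicator (B \<times> B) p *\<^sub>R (g (map_prod q q p) * pair_intensity K p)"
      by (cases p; cases "p \<in> B \<times> B") (simp_all add: E_def)
    finally show "(\<Sum>v\<in>?R. g v * ?I v p) = indicator (B \<times> B) p *\<^sub>R (g (map_prod q q p) * pair_intensity K p)" .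
  qed
  finally show ?thesis
  proof (rule has_bochner_integral_cong[THEN iffD1, rotated 3])
    fix \<omega> assume "\<omega> \<in> space M"
    then have "finite ((X \<omega> \<inter> B) \<times> (X \<omega> \<inter> B))" using finite_X[OF _ B(2)] by simp
    moreover have "(X \<omega> \<inter> B) \<times> (X \<omega> \<inter> B) \<inter> map_prod q q -` {v} = (X \<omega> \<inter> E (fst v)) \<times> (X \<omega> \<inter> E (snd v))" for v
      by (auto simp: E_def)
    ultimately show "(\<Sum>v\<in>?R. g v * (of_nat (card (X \<omega> \<inter> E (fst v))) * of_nat (card (X \<omega> \<inter> E (snd v)))))
        = (\<Sum>p\<in>(X \<omega> \<inter> B) \<times> (X \<omega> \<inter> B). g (map_prod q q p))"
      using sum_simple_function_fibres[OF _ finR, of "(X \<omega> \<inter> B) \<times> (X \<omega> \<inter> B)" g]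
      by (simp only: card_cartesian_product of_nat_mult)
  qed (rule refl)+
qed

text \<open>Provides the dominating function for sums over pairs. Counting only pairs in different
  cells gives expectation at most D, a bound of the pair intensity on B \<times> B, because the
  product measure has mass 1. Refining the cells exhausts all pairs of distinct points, and Fatou's
  lemma carries the bound over.\<close>

lemma integrable_card_pairs:
  assumes B: "B \<in> sets borel" "bounded B"
  shows "integrable M (\<lambda>\<omega>. \<Sum>p\<in>(X \<omega> \<inter> B) \<times> (X \<omega> \<inter> B). if fst p = snd p then 0 else 1::real)"
    (is "integrable M ?N")
proof -
  obtain q where q: "\<And>i. simple_function borel (q i)" "\<And>z. (\<lambda>i. q i z) \<longlonglongrightarrow> z"
    "\<And>i z. norm (q i z) \<le> 2 * norm (z::complex)"
    using simple_function_identity_approx by blast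
  obtain D where D: "D \<ge> 0" "\<forall>p\<in>B \<times> B. norm (pair_intensity K p) \<le> D"
    using continuous_bounded_on_bounded[OF continuous_pair_intensity bounded_Times[OF B(2) B(2)]] by blast
  let ?e = "\<lambda>p. if fst p = snd p then 0 else 1::real"
  let ?n = "\<lambda>i \<omega>. \<Sum>p\<in>(X \<omega> \<inter> B) \<times> (X \<omega> \<inter> B). ?e (map_prod (q i) (q i) p)"
  have hb: "has_bochner_integral M (\<lambda>\<omega>. complex_of_real (?n i \<omega>))
      (\<integral>p. indicator (B \<times> B) p *\<^sub>R (complex_of_real (?e (map_prod (q i) (q i) p)) * pair_intensity K p) \<partial>(\<mu> \<Otimes>\<^sub>M \<mu>))"
    for i
    using cell_pair_sum[OF B q(1)[of i], of "\<lambda>p. complex_of_real (?e p)"] by simp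
  have int: "integrable M (?n i)" for i
    using hb[of i] by (simp only: has_bochner_integral_iff complex_of_real_integrable_eq)
  have lim: "(\<lambda>i. ?n i \<omega>) \<longlonglongrightarrow> ?N \<omega>" for \<omega>
    by (intro tendsto_sum tendsto_off_diagonal[OF q(2)] continuous_intros)
  have [measurable]: "?N \<in> borel_measurable M"
    by (rule borel_measurable_LIMSEQ_metric[OF borel_measurable_integrable[OF int] lim])
  have nn: "0 \<le> ?n i \<omega>" for i \<omega> by (intro sum_nonneg) auto
  have "integral\<^sup>L M (?n i) \<le> D" for i
  proof -
    have "norm (complex_of_real (integral\<^sup>L M (?n i))) \<le> D"
      unfolding integral_complex_of_real[symmetric] has_bochner_integral_integral_eq[OF hb]
    proof (rule order_trans[OF integral_norm_bound pair_prob.integral_le_const])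
      show "AE p in \<mu> \<Otimes>\<^sub>M \<mu>. norm (indicator (B \<times> B) p *\<^sub>R (complex_of_real (?e (map_prod (q i) (q i) p)) * pair_intensity K p)) \<le> D"
        using D by (auto split: split_indicator)
      show "integrable (\<mu> \<Otimes>\<^sub>M \<mu>) (\<lambda>p. norm (indicator (B \<times> B) p *\<^sub>R (complex_of_real (?e (map_prod (q i) (q i) p)) * pair_intensity K p)))"
      proof (intro integrable_norm pair_prob.integrable_const_bound[where B = D])
        have [measurable]: "q i \<in> borel_measurable borel" "B \<in> sets borel"
          using borel_measurable_simple_function[OF q(1)] B by auto
        have "map_prod (q i) (q i) \<in> \<mu> \<Otimes>\<^sub>M \<mu> \<rightarrow>\<^sub>M \<mu> \<Otimes>\<^sub>M \<mu>"
          unfolding map_prod_def by measurable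
        moreover have "(\<lambda>p. complex_of_real (?e p)) \<in> borel_measurable (\<mu> \<Otimes>\<^sub>M \<mu>)"
          by measurable
        ultimately have [measurable]: "(\<lambda>p. complex_of_real (?e (map_prod (q i) (q i) p))) \<in> borel_measurable (\<mu> \<Otimes>\<^sub>M \<mu>)"
          by (rule measurable_compose)
        show "(\<lambda>p. indicator (B \<times> B) p *\<^sub>R (complex_of_real (?e (map_prod (q i) (q i) p)) * pair_intensity K p)) \<in> borel_measurable (\<mu> \<Otimes>\<^sub>M \<mu>)"
          by (intro borel_measurable_scaleR borel_measurable_times borel_measurable_indicator) measurable
      qed (use D in \<open>auto split: split_indicator\<close>)
    qed
    then show ?thesis by simp
  qed
  then have "(\<integral>\<^sup>+\<omega>. ennreal (?n i \<omega>) \<partial>M) \<le> ennreal D" for i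
    using nn int by (subst nn_integral_eq_integral) (auto intro!: ennreal_leI)
  then have "liminf (\<lambda>i. \<integral>\<^sup>+\<omega>. ennreal (?n i \<omega>) \<partial>M) \<le> ennreal D"
    by (intro Liminf_le) auto
  moreover have "(\<integral>\<^sup>+\<omega>. ennreal (?N \<omega>) \<partial>M) = (\<integral>\<^sup>+\<omega>. liminf (\<lambda>i. ennreal (?n i \<omega>)) \<partial>M)"
    using lim by (intro nn_integral_cong lim_imp_Liminf[symmetric] tendsto_ennrealI) auto
  moreover have "\<dots> \<le> liminf (\<lambda>i. \<integral>\<^sup>+\<omega>. ennreal (?n i \<omega>) \<partial>M)"
    using int by (intro nn_integral_liminf) auto
  ultimately have "(\<integral>\<^sup>+\<omega>. ennreal (?N \<omega>) \<partial>M) \<le> ennreal D"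
    by simp
  then show ?thesis
    by (intro integrableI_bounded) (auto simp: sum_nonneg abs_of_nonneg intro: le_less_trans)
qed

text \<open>Dominated convergence on both sides of \<open>cell_pair_sum\<close>. The diagonal is
  excluded explicitly on the left only, as the intensity excludes it on the right.\<close>

lemma two_point_sum:
  fixes g :: "complex \<times> complex \<Rightarrow> complex"
  assumes B: "B \<in> sets borel" "bounded B" and g: "continuous_on UNIV g"
  shows "has_bochner_integral M
      (\<lambda>\<omega>. \<Sum>p\<in>(X \<omega> \<inter> B) \<times> (X \<omega> \<inter> B). if fst p = snd p then 0 else g p)
      (\<integral>p. indicator (B \<times> B) p *\<^sub>R (g p * pair_intensity K p) \<partial>(\<mu> \<Otimes>\<^sub>M \<mu>))"
    (is "has_bochner_integral M ?S ?J")
proof -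
  obtain q where q: "\<And>i. simple_function borel (q i)" "\<And>z. (\<lambda>i. q i z) \<longlonglongrightarrow> z"
    "\<And>i z. norm (q i z) \<le> 2 * norm (z::complex)"
    using simple_function_identity_approx by blast
  obtain D where D: "D \<ge> 0" "\<forall>p\<in>B \<times> B. norm (pair_intensity K p) \<le> D"
    using continuous_bounded_on_bounded[OF continuous_pair_intensity bounded_Times[OF B(2) B(2)]] by blast
  obtain R where R: "\<And>z. z \<in> B \<Longrightarrow> norm z \<le> R" using B(2) by (auto simp: bounded_iff)
  obtain C where C: "C \<ge> 0" "\<forall>p\<in>cball 0 (2 * R) \<times> cball 0 (2 * R). norm (g p) \<le> C"
    using continuous_bounded_on_bounded[OF g bounded_Times[OF bounded_cball[of 0 "2 * R"] bounded_cball[of 0 "2 * R"]]] by blast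
  define g0 where "g0 p = (if fst p = snd p then 0 else g p)" for p
  \<comment> \<open>Keeping the value 0 on the diagonal makes these bounds add up to C times the
    number of pairs of distinct points, which is integrable by
    \<open>integrable_card_pairs\<close>.\<close>
  have g0q: "norm (g0 (map_prod (q i) (q i) p)) \<le> (if fst p = snd p then 0 else C)" if "p \<in> B \<times> B" for i p
  proof -
    have "norm (q i z) \<le> 2 * R" if "z \<in> B" for z
      using R[OF that] q(3)[of i z] by simp
    then have "map_prod (q i) (q i) p \<in> cball 0 (2 * R) \<times> cball 0 (2 * R)"
      using that by (cases p) simp
    with C(2) have "norm (g (map_prod (q i) (q i) p)) \<le> C" by (rule bspec)
    then show ?thesis using C(1) by (cases p) (simp add: g0_def)
  qed
  have [measurable]: "q i \<in> borel_measurable borel" for i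
    by (rule borel_measurable_simple_function[OF q(1)])
  have [measurable]: "B \<in> sets borel" by (rule B)
  have g_borel: "g \<in> borel_measurable borel" by (rule borel_measurable_continuous_onI[OF g])
  have gm: "g \<in> borel_measurable (\<mu> \<Otimes>\<^sub>M \<mu>)"
    by (subst measurable_cong_sets[OF sets_pair_\<mu> refl]) (rule g_borel)
  have g0m: "g0 \<in> borel_measurable (\<mu> \<Otimes>\<^sub>M \<mu>)"
    unfolding g0_def using gm by measurable
  have "map_prod (q i) (q i) \<in> \<mu> \<Otimes>\<^sub>M \<mu> \<rightarrow>\<^sub>M \<mu> \<Otimes>\<^sub>M \<mu>" for i
    unfolding map_prod_def by measurable
  note g0qm = measurable_compose[OF this g0m]
  let ?c = "\<lambda>i \<omega>. \<Sum>p\<in>(X \<omega> \<inter> B) \<times> (X \<omega> \<inter> B). g0 (map_prod (q i) (q i) p)"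
  let ?C = "\<lambda>i p. indicator (B \<times> B) p *\<^sub>R (g0 (map_prod (q i) (q i) p) * pair_intensity K p)"
  have c: "has_bochner_integral M (?c i) (integral\<^sup>L (\<mu> \<Otimes>\<^sub>M \<mu>) (?C i))" for i
    by (rule cell_pair_sum[OF B q(1)]) (simp add: g0_def)
  have lim: "(\<lambda>i. g0 (map_prod (q i) (q i) p)) \<longlonglongrightarrow> g0 p" for p
    unfolding g0_def by (rule tendsto_off_diagonal[OF q(2) g])
  have cm: "?c i \<in> borel_measurable M" for i using c by (rule borel_measurable_has_bochner_integral)
  have limS: "(\<lambda>i. ?c i \<omega>) \<longlonglongrightarrow> ?S \<omega>" for \<omega>
    unfolding g0_def by (intro tendsto_sum tendsto_off_diagonal[OF q(2) g])
  have bnd: "norm (?c i \<omega>) \<le> C * (\<Sum>p\<in>(X \<omega> \<inter> B) \<times> (X \<omega> \<inter> B). if fst p = snd p then 0 else 1)" for i \<omega>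
    unfolding sum_distrib_left by (intro order_trans[OF norm_sum sum_mono] order_trans[OF g0q]) auto
  note dom = borel_measurable_LIMSEQ_metric[OF cm limS] cm
    integrable_mult_right[OF integrable_card_pairs[OF B], of C] AE_I2[OF limS] AE_I2[OF bnd]
  have 1: "(\<lambda>i. \<integral>\<omega>. ?c i \<omega> \<partial>M) \<longlonglongrightarrow> integral\<^sup>L M ?S"
    by (rule integral_dominated_convergence[OF dom])
  have int: "integrable M ?S"
    by (rule integrable_dominated_convergence[OF dom])
  have 2: "(\<lambda>i. integral\<^sup>L (\<mu> \<Otimes>\<^sub>M \<mu>) (?C i)) \<longlonglongrightarrow> ?J"
  proof (rule integral_dominated_convergence[where w = "\<lambda>_. C * D"])
    have "norm (?C i p) \<le> C * D" for i p
    proof (cases "p \<in> B \<times> B")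
      case True
      then have "norm (g0 (map_prod (q i) (q i) p)) \<le> C"
        using g0q[OF True, of i] C(1) by (auto split: if_splits)
      then show ?thesis using True D C(1) by (auto simp: norm_mult intro!: mult_mono)
    qed (use C(1) D(1) in auto)
    then show "AE p in \<mu> \<Otimes>\<^sub>M \<mu>. norm (?C i p) \<le> C * D" for i by (rule AE_I2)
    \<comment> \<open>the pair intensity vanishes on the diagonal\<close>
    have diag: "g0 p * pair_intensity K p = g p * pair_intensity K p" for p
      by (auto simp: g0_def pair_intensity_def)
    have "(\<lambda>i. ?C i p) \<longlonglongrightarrow> indicator (B \<times> B) p *\<^sub>R (g0 p * pair_intensity K p)" for p
      by (rule tendsto_scaleR[OF tendsto_const tendsto_mult[OF lim tendsto_const]])
    then have "(\<lambda>i. ?C i p) \<longlonglongrightarrow> indicator (B \<times> B) p *\<^sub>R (g p * pair_intensity K p)" for p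
      unfolding diag .
    then show "AE p in \<mu> \<Otimes>\<^sub>M \<mu>. (\<lambda>i. ?C i p) \<longlonglongrightarrow> indicator (B \<times> B) p *\<^sub>R (g p * pair_intensity K p)"
      by (rule AE_I2)
    show "(\<lambda>p. indicator (B \<times> B) p *\<^sub>R (g p * pair_intensity K p)) \<in> borel_measurable (\<mu> \<Otimes>\<^sub>M \<mu>)"
      using gm by measurable
    show "?C i \<in> borel_measurable (\<mu> \<Otimes>\<^sub>M \<mu>)" for i
      using g0qm[of i] by measurable
  qed (rule pair_prob.integrable_const)
  have eq: "(\<integral>\<omega>. ?c i \<omega> \<partial>M) = integral\<^sup>L (\<mu> \<Otimes>\<^sub>M \<mu>) (?C i)" for i
    by (rule has_bochner_integral_integral_eq[OF c])
  have "(\<lambda>i. \<integral>\<omega>. ?c i \<omega> \<partial>M) \<longlonglongrightarrow> ?J"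
    using 2 by (simp only: eq)
  from LIMSEQ_unique[OF 1 this] int show ?thesis
    by (simp only: has_bochner_integral_iff)
qed

end

section \<open>Variance bounds for the Ginibre ensembles\<close>

context continuous_determinantal_process begin

text \<open>The squared modulus of a sum splits into the diagonal, governed by the intensity, and
  the pairs of distinct points, governed by the pair intensity.\<close>

lemma second_moment:
  fixes f :: "complex \<Rightarrow> complex"
  assumes B: "B \<in> sets borel" "bounded B" and f: "continuous_on UNIV f" "\<And>z. z \<notin> B \<Longrightarrow> f z = 0"
  shows "has_bochner_integral M (\<lambda>\<omega>. complex_of_real ((norm (\<Sum>z\<in>X \<omega> \<inter> B. f z))\<^sup>2))
    ((\<integral>z. f z * cnj (f z) * K z z \<partial>\<mu>) +
     (\<integral>p. f (fst p) * cnj (f (snd p)) * pair_intensity K p \<partial>(\<mu> \<Otimes>\<^sub>M \<mu>)))"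
proof -
  have f': "continuous_on S (\<lambda>x. f (g x))" if "continuous_on S g" for S and g :: "'a::topological_space \<Rightarrow> complex"
    using continuous_on_compose2[OF f(1) that] by simp
  let ?g = "\<lambda>p. f (fst p) * cnj (f (snd p))"
  have "has_bochner_integral M (\<lambda>\<omega>. (\<Sum>z\<in>X \<omega> \<inter> B. f z * cnj (f z)) +
      (\<Sum>p\<in>(X \<omega> \<inter> B) \<times> (X \<omega> \<inter> B). if fst p = snd p then 0 else ?g p))
    ((\<integral>z. indicator B z *\<^sub>R (f z * cnj (f z) * K z z) \<partial>\<mu>) +
     (\<integral>p. indicator (B \<times> B) p *\<^sub>R (?g p * pair_intensity K p) \<partial>(\<mu> \<Otimes>\<^sub>M \<mu>)))"
    by (intro has_bochner_integral_add one_point_sum two_point_sum B continuous_intros f')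
  also have "(\<lambda>z. indicator B z *\<^sub>R (f z * cnj (f z) * K z z)) = (\<lambda>z. f z * cnj (f z) * K z z)"
    using f(2) by (auto simp: indicator_def fun_eq_iff)
  also have "(\<lambda>p. indicator (B \<times> B) p *\<^sub>R (?g p * pair_intensity K p)) = (\<lambda>p. ?g p * pair_intensity K p)"
    using f(2) by (auto simp: indicator_def fun_eq_iff)
  finally show ?thesis
  proof (rule has_bochner_integral_cong[THEN iffD1, rotated 3])
    fix \<omega> assume "\<omega> \<in> space M"
    then have fin: "finite (X \<omega> \<inter> B)" by (rule finite_X[OF _ B(2)])
    let ?A = "X \<omega> \<inter> B"
    have "complex_of_real ((norm (\<Sum>z\<in>?A. f z))\<^sup>2) = (\<Sum>z\<in>?A. f z) * (\<Sum>z\<in>?A. cnj (f z))"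
      by (simp only: complex_norm_square cnj_sum)
    also have "\<dots> = (\<Sum>z\<in>?A. \<Sum>w\<in>?A. f z * cnj (f w))"
      by (rule sum_product)
    also have "\<dots> = (\<Sum>z\<in>?A. \<Sum>w\<in>?A. (if z = w then f z * cnj (f z) else 0) + (if z = w then 0 else f z * cnj (f w)))"
      by (intro sum.cong) auto
    also have "\<dots> = (\<Sum>z\<in>?A. f z * cnj (f z)) + (\<Sum>p\<in>?A \<times> ?A. if fst p = snd p then 0 else ?g p)"
      using fin by (simp add: sum.distrib sum.cartesian_product case_prod_beta')
    finally show "(\<Sum>z\<in>?A. f z * cnj (f z)) + (\<Sum>p\<in>?A \<times> ?A. if fst p = snd p then 0 else ?g p)
      = complex_of_real ((norm (\<Sum>z\<in>?A. f z))\<^sup>2)" ..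
  qed (rule refl)+
qed

end

section \<open>Second moments for the finite ensembles, in terms of monomials\<close>

lemma (in pair_sigma_finite) has_bochner_integral_product:
  fixes a b :: "_ \<Rightarrow> complex"
  assumes a: "integrable M1 a" and b: "integrable M2 b"
  shows "has_bochner_integral (M1 \<Otimes>\<^sub>M M2) (\<lambda>p. a (fst p) * b (snd p)) (integral\<^sup>L M1 a * integral\<^sup>L M2 b)"
proof -
  have [measurable]: "a \<in> borel_measurable M1" "b \<in> borel_measurable M2" using a b by auto
  have int: "integrable (M1 \<Otimes>\<^sub>M M2) (\<lambda>p. a (fst p) * b (snd p))"
  proof (rule Fubini_integrable)
    show "integrable M1 (\<lambda>x. \<integral>y. norm (a (fst (x, y)) * b (snd (x, y))) \<partial>M2)"
      using a by (simp add: norm_mult)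
    show "AE x in M1. integrable M2 (\<lambda>y. a (fst (x, y)) * b (snd (x, y)))"
      using b by simp
  qed measurable
  have "(\<integral>p. a (fst p) * b (snd p) \<partial>(M1 \<Otimes>\<^sub>M M2)) = (\<integral>x. \<integral>y. a x * b y \<partial>M2 \<partial>M1)"
    using integral_fst'[OF int] by simp
  also have "\<dots> = integral\<^sup>L M1 a * integral\<^sup>L M2 b" by simp
  finally show ?thesis using int by (simp add: has_bochner_integral_iff)
qed

definition ginibre_kernel :: "nat \<Rightarrow> complex \<Rightarrow> complex \<Rightarrow> complex" where
  "ginibre_kernel n z w = (\<Sum>k<n. (z * cnj w) ^ k / fact k)"

lemma finite_ginibre_locale:
  assumes "prob_space M" "finite_ginibre M n X"
  shows "continuous_determinantal_process M gauss_measure X (ginibre_kernel n)"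
proof -
  interpret prob_space M by fact
  interpret g: prob_space gauss_measure by (rule prob_space_gauss_measure)
  show ?thesis
  proof
    have "ginibre_kernel n = (\<lambda>z w. \<Sum>k<n. (z * cnj w) ^ k / fact k)"
      by (simp add: ginibre_kernel_def fun_eq_iff)
    with assms(2) show "determinantal_process M X (ginibre_kernel n) gauss_measure"
      by (simp add: finite_ginibre_def)
    show "continuous_on UNIV (\<lambda>p. ginibre_kernel n (fst p) (snd p))"
      unfolding ginibre_kernel_def by (intro continuous_intros) auto
  qed simp
qed

lemma integrable_gauss_continuous:
  fixes u :: "complex \<Rightarrow> 'b::{banach, second_countable_topology, real_normed_field}"
  assumes "continuous_on UNIV u" "bounded {z. u z \<noteq> 0}"
  shows "integrable gauss_measure u"
proof -
  interpret g: prob_space gauss_measure by (rule prob_space_gauss_measure)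
  obtain C where C: "C \<ge> 0" "\<forall>z\<in>{z. u z \<noteq> 0}. norm (u z) \<le> C"
    using continuous_bounded_on_bounded[OF assms] by blast
  have "norm (u z) \<le> C" for z using C by (cases "u z = 0") auto
  then show ?thesis
    using borel_measurable_continuous_onI[OF assms(1)] by (intro g.integrable_const_bound[where B = C]) auto
qed

text \<open>Expanding the kernel and dropping all but one diagonal of matrix entries of \<open>f\<close>; what remains
  is the exact variance when \<open>f (z) = h (z) / z ^ l\<close> with \<open>h\<close> radial.\<close>

lemma ginibre_second_moment:
  fixes f :: "complex \<Rightarrow> complex"
  assumes M: "prob_space M" "finite_ginibre M n X"
    and B: "B \<in> sets borel" "bounded B" and f: "continuous_on UNIV f" "\<And>z. z \<notin> B \<Longrightarrow> f z = 0"
    and c: "norm c = 1" "Re c \<noteq> - 1" "d \<noteq> 1" "\<And>z. f (c * z) = d * f z"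
  shows "integrable M (\<lambda>\<omega>. (norm (\<Sum>z\<in>X \<omega> \<inter> B. f z))\<^sup>2)"
    and "(\<integral>\<omega>. (norm (\<Sum>z\<in>X \<omega> \<inter> B. f z))\<^sup>2 \<partial>M) \<le>
      (\<Sum>k<n. (\<integral>z. (norm (f z))\<^sup>2 * (norm z)^(2 * k) \<partial>gauss_measure) / fact k -
         (if l \<le> k then (norm (\<integral>z. f z * z^k * cnj z^(k - l) \<partial>gauss_measure))\<^sup>2 / (fact k * fact (k - l)) else 0))"
proof -
  interpret continuous_determinantal_process M gauss_measure X "ginibre_kernel n"
    by (rule finite_ginibre_locale[OF M])
  let ?g = gauss_measure and ?K = "ginibre_kernel n"
  define T where "T \<omega> = (norm (\<Sum>z\<in>X \<omega> \<inter> B. f z))\<^sup>2" for \<omega>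
  \<comment> \<open>Matrix entries of multiplication by f between the monomials z^j and z^k. These
    are not normalised; division of the squared modulus by j! k! does that.\<close>
  define A where "A j k = (\<integral>z. f z * z^j * cnj z^k \<partial>?g)" for j k
  have supp: "bounded {z. f z * u z \<noteq> 0}" for u
    by (rule bounded_subset[OF B(2)]) (use f(2) in auto)
  have int: "integrable ?g (\<lambda>z. f z * u z)" if "continuous_on UNIV u" for u
    using that f(1) by (intro integrable_gauss_continuous supp continuous_intros)
  have intA: "integrable ?g (\<lambda>z. f z * z^j * cnj z^k)" for j k
    using int[of "\<lambda>z. z^j * cnj z^k"] by (simp add: mult.assoc continuous_intros)
  have intK: "integrable ?g (\<lambda>z. f z * ?K z z)"
    by (rule int[OF continuous_K_diagonal])
  \<comment> \<open>The rotation z \<mapsto> c z preserves the measure and K z z but multiplies f by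
    d \<noteq> 1, so this integral, the mean of the sum, must be 0.\<close>
  have "(\<integral>z. f z * ?K z z \<partial>?g) = (\<integral>z. f z * ?K z z \<partial>distr ?g borel (\<lambda>z. c * z))"
    by (simp add: gauss_measure_rotation[OF c(1,2)])
  also have "\<dots> = (\<integral>z. f (c * z) * ?K (c * z) (c * z) \<partial>?g)"
    using intK by (subst integral_distr) auto
  also have "\<dots> = (\<integral>z. d * (f z * ?K z z) \<partial>?g)"
  proof -
    have "(c * z) * cnj (c * z) = z * cnj z" for z
      using c(1) by (simp only: complex_norm_square[symmetric] norm_mult mult_1)
    then have "?K (c * z) (c * z) = ?K z z" for z by (simp only: ginibre_kernel_def)
    then show ?thesis by (simp add: c(4) mult.assoc)
  qed
  also have "\<dots> = d * (\<integral>z. f z * ?K z z \<partial>?g)" by simp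
  finally have zero: "(\<integral>z. f z * ?K z z \<partial>?g) = 0" using c(3) by simp
  have cnjK: "cnj (?K z z) = ?K z z" for z
    by (simp add: ginibre_kernel_def mult.commute)
  have one: "(\<integral>z. f z * cnj (f z) * ?K z z \<partial>?g)
      = complex_of_real (\<Sum>k<n. (\<integral>z. (norm (f z))\<^sup>2 * (norm z)^(2 * k) \<partial>?g) / fact k)"
  proof -
    have i: "integrable ?g (\<lambda>z. (norm (f z))\<^sup>2 * (norm z)^(2 * k) / fact k)" for k
      using f(1) by (intro integrable_gauss_continuous continuous_intros bounded_subset[OF B(2)]) (use f(2) in auto)
    have "f z * cnj (f z) * ?K z z = complex_of_real (\<Sum>k<n. (norm (f z))\<^sup>2 * (norm z)^(2 * k) / fact k)" for z
      unfolding complex_norm_square[symmetric] ginibre_kernel_def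
      by (simp add: sum_distrib_left power_mult)
    then have "(\<integral>z. f z * cnj (f z) * ?K z z \<partial>?g)
        = complex_of_real (\<integral>z. (\<Sum>k<n. (norm (f z))\<^sup>2 * (norm z)^(2 * k) / fact k) \<partial>?g)"
      by (simp only: integral_complex_of_real)
    also have "(\<integral>z. (\<Sum>k<n. (norm (f z))\<^sup>2 * (norm z)^(2 * k) / fact k) \<partial>?g)
        = (\<Sum>k<n. \<integral>z. (norm (f z))\<^sup>2 * (norm z)^(2 * k) / fact k \<partial>?g)"
      by (rule Bochner_Integration.integral_sum[OF i])
    finally show ?thesis by simp
  qed
  have two: "(\<integral>p. f (fst p) * cnj (f (snd p)) * pair_intensity ?K p \<partial>(?g \<Otimes>\<^sub>M ?g))
      = - complex_of_real (\<Sum>j<n. \<Sum>k<n. (norm (A j k))\<^sup>2 / (fact j * fact k))"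
  proof -
    have P: "has_bochner_integral (?g \<Otimes>\<^sub>M ?g) (\<lambda>p. a (fst p) * cnj (a (snd p))) (complex_of_real ((norm (integral\<^sup>L ?g a))\<^sup>2))"
      if "integrable ?g a" for a
      using pair.has_bochner_integral_product[OF that integrable_cnj[OF that]]
      unfolding complex_norm_square by simp
    \<comment> \<open>The first product integrates to the squared modulus of the mean, which is 0.
      The double sum is K z w * K w z expanded in monomials; each of its terms is a function of z
      times the conjugate of the same function of w.\<close>
    have "has_bochner_integral (?g \<Otimes>\<^sub>M ?g)
      (\<lambda>p. f (fst p) * ?K (fst p) (fst p) * cnj (f (snd p) * ?K (snd p) (snd p))
         - (\<Sum>j<n. \<Sum>k<n. (f (fst p) * fst p^j * cnj (fst p)^k * cnj (f (snd p) * snd p^j * cnj (snd p)^k)) / (fact j * fact k)))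
      (complex_of_real ((norm (\<integral>z. f z * ?K z z \<partial>?g))\<^sup>2)
         - (\<Sum>j<n. \<Sum>k<n. complex_of_real ((norm (A j k))\<^sup>2) / (fact j * fact k)))"
      unfolding A_def
      by (intro has_bochner_integral_diff has_bochner_integral_sum has_bochner_integral_divide_zero P intK intA)
    also have "(\<lambda>p. f (fst p) * ?K (fst p) (fst p) * cnj (f (snd p) * ?K (snd p) (snd p))
         - (\<Sum>j<n. \<Sum>k<n. (f (fst p) * fst p^j * cnj (fst p)^k * cnj (f (snd p) * snd p^j * cnj (snd p)^k)) / (fact j * fact k)))
       = (\<lambda>p. f (fst p) * cnj (f (snd p)) * pair_intensity ?K p)"
    proof
      fix p :: "complex \<times> complex"
      obtain z w where p: "p = (z, w)" by (cases p)
      have "?K z w * ?K w z = (\<Sum>j<n. \<Sum>k<n. ((z * cnj w)^j / fact j) * ((w * cnj z)^k / fact k))"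
        unfolding ginibre_kernel_def by (rule sum_product)
      then have "f z * cnj (f w) * (?K z w * ?K w z)
          = (\<Sum>j<n. \<Sum>k<n. (f z * z^j * cnj z^k * cnj (f w * w^j * cnj w^k)) / (fact j * fact k))"
        by (simp add: sum_distrib_left power_mult_distrib mult_ac)
      then show "f (fst p) * ?K (fst p) (fst p) * cnj (f (snd p) * ?K (snd p) (snd p))
         - (\<Sum>j<n. \<Sum>k<n. (f (fst p) * fst p^j * cnj (fst p)^k * cnj (f (snd p) * snd p^j * cnj (snd p)^k)) / (fact j * fact k))
         = f (fst p) * cnj (f (snd p)) * pair_intensity ?K p"
        by (simp add: p pair_intensity_def cnjK algebra_simps)
    qed
    finally show ?thesis
      by (simp add: zero has_bochner_integral_integral_eq)
  qed
  have hb: "has_bochner_integral M (\<lambda>\<omega>. complex_of_real (T \<omega>))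
    (complex_of_real ((\<Sum>k<n. (\<integral>z. (norm (f z))\<^sup>2 * (norm z)^(2 * k) \<partial>?g) / fact k)
       - (\<Sum>j<n. \<Sum>k<n. (norm (A j k))\<^sup>2 / (fact j * fact k))))"
    unfolding T_def of_real_diff
    using second_moment[OF B f(1)] f(2) unfolding one two by simp
  then show "integrable M (\<lambda>\<omega>. (norm (\<Sum>z\<in>X \<omega> \<inter> B. f z))\<^sup>2)"
    unfolding has_bochner_integral_iff complex_of_real_integrable_eq T_def by simp
  from hb have "integral\<^sup>L M T = (\<Sum>k<n. (\<integral>z. (norm (f z))\<^sup>2 * (norm z)^(2 * k) \<partial>?g) / fact k)
       - (\<Sum>j<n. \<Sum>k<n. (norm (A j k))\<^sup>2 / (fact j * fact k))"
    unfolding has_bochner_integral_iff integral_complex_of_real of_real_eq_iff by simp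
  \<comment> \<open>Division by z^l lowers the degree by l, so k = j - l is the entry of row j worth
    keeping. The other entries enter the second moment with a negative sign and may be dropped. For
    j < l row j has no such entry.\<close>
  moreover have "(if l \<le> j then (norm (A j (j - l)))\<^sup>2 / (fact j * fact (j - l)) else 0)
      \<le> (\<Sum>k<n. (norm (A j k))\<^sup>2 / (fact j * fact k))" if "j < n" for j
    using that member_le_sum[of "j - l" "{..<n}" "\<lambda>k. (norm (A j k))\<^sup>2 / (fact j * fact k)"]
    by (auto intro!: sum_nonneg)
  then have "(\<Sum>j<n. if l \<le> j then (norm (A j (j - l)))\<^sup>2 / (fact j * fact (j - l)) else 0)
      \<le> (\<Sum>j<n. \<Sum>k<n. (norm (A j k))\<^sup>2 / (fact j * fact k))"
    by (intro sum_mono) auto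
  ultimately show "(\<integral>\<omega>. (norm (\<Sum>z\<in>X \<omega> \<inter> B. f z))\<^sup>2 \<partial>M) \<le>
      (\<Sum>k<n. (\<integral>z. (norm (f z))\<^sup>2 * (norm z)^(2 * k) \<partial>?g) / fact k -
         (if l \<le> k then (norm (\<integral>z. f z * z^k * cnj z^(k - l) \<partial>?g))\<^sup>2 / (fact k * fact (k - l)) else 0))"
    unfolding sum_subtractf A_def T_def by simp
qed

text \<open>Near 0 the quotient is identically 0, and away from 0 the denominator does not vanish;
  these two open sets cover the plane.\<close>

lemma continuous_on_divide_power:
  fixes h :: "complex \<Rightarrow> real"
  assumes h: "continuous_on UNIV h" "\<rho> > 0" "\<And>z. norm z < \<rho> \<Longrightarrow> h z = 0"
  shows "continuous_on UNIV (\<lambda>z. complex_of_real (h z) / z ^ l)"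
proof -
  have "continuous_on (ball 0 \<rho>) (\<lambda>z. complex_of_real (h z) / z ^ l)"
    using h(3) by (subst continuous_on_cong[OF refl, where g = "\<lambda>_. 0"]) auto
  moreover have "continuous_on (- {0}) (\<lambda>z. complex_of_real (h z) / z ^ l)"
    by (intro continuous_intros continuous_on_subset[OF h(1)]) auto
  ultimately have "continuous_on (ball 0 \<rho> \<union> - {0}) (\<lambda>z. complex_of_real (h z) / z ^ l)"
    by (intro continuous_on_open_Un) auto
  moreover have "ball 0 \<rho> \<union> - {0} = (UNIV :: complex set)" using h(2) by auto
  ultimately show ?thesis by simp
qed

lemma has_bochner_integral_le:
  fixes f g :: "'a \<Rightarrow> real"
  assumes "has_bochner_integral M f x" "has_bochner_integral M g y" "\<And>z. f z \<le> g z"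
  shows "x \<le> y"
  using assms integral_mono[of M f g] by (simp add: has_bochner_integral_iff)

text \<open>The index k of a mode becomes m = k - l; the modes k < l have no compensating matrix
  entry and are charged a each.\<close>

lemma sum_lessThan_shift_le:
  fixes D :: "nat \<Rightarrow> real"
  assumes "a \<ge> 0" "\<And>m. D m \<ge> 0"
  shows "(\<Sum>k<n. if k < l then a else D (k - l)) \<le> real l * a + (\<Sum>m<n. D m)"
proof -
  have "(\<Sum>k<l + r. if k < l then a else D (k - l)) = real l * a + (\<Sum>m<r. D m)" for r
    by (induction r) auto
  moreover have "(\<Sum>k<n. if k < l then a else D (k - l)) \<le> (\<Sum>k<l + n. if k < l then a else D (k - l))"
    using assms by (intro sum_mono2) auto
  ultimately show ?thesis by simp
qed

text \<open>With \<open>m = k - l\<close>, the \<open>k\<close>-th term is \<open>m! / k!\<close> times the variance of \<open>h\<close> under the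
  probability density \<open>|z|\<^sup>2\<^sup>m / m!\<close>, under which \<open>|z|\<^sup>2\<close> has mean and variance \<open>m + 1\<close>.\<close>

lemma gauss_variance_term:
  fixes h :: "complex \<Rightarrow> real"
  assumes h: "continuous_on UNIV h" "bounded {z. h z \<noteq> 0}" and l: "l \<ge> 1" and D: "D \<ge> 0"
    and dev: "\<And>z. (h z - c)\<^sup>2 \<le> D * ((norm z)\<^sup>2 - real (m + 1))\<^sup>2"
  shows "(\<integral>z. (h z)\<^sup>2 * (norm z)^(2 * m) \<partial>gauss_measure) / fact (m + l)
      - (\<integral>z. h z * (norm z)^(2 * m) \<partial>gauss_measure)\<^sup>2 / (fact (m + l) * fact m) \<le> D"
proof -
  let ?g = gauss_measure
  define I1 I2 where "I1 = (\<integral>z. h z * (norm z)^(2 * m) \<partial>?g)" and "I2 = (\<integral>z. (h z)\<^sup>2 * (norm z)^(2 * m) \<partial>?g)"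
  have int1: "integrable ?g (\<lambda>z. h z * (norm z)^(2 * m))"
    by (intro integrable_gauss_continuous continuous_intros h(1) bounded_subset[OF h(2)]) auto
  have int2: "integrable ?g (\<lambda>z. (h z)\<^sup>2 * (norm z)^(2 * m))"
    by (intro integrable_gauss_continuous continuous_intros h(1) bounded_subset[OF h(2)]) auto
  have mom: "has_bochner_integral ?g (\<lambda>z. (norm z)^(2 * k)) (fact k)" for k
    by (rule gauss_measure_moment)
  have "has_bochner_integral ?g (\<lambda>z. (h z)\<^sup>2 * (norm z)^(2 * m) - 2 * c * (h z * (norm z)^(2 * m)) + c\<^sup>2 * (norm z)^(2 * m))
      (I2 - 2 * c * I1 + c\<^sup>2 * fact m)"
    unfolding I1_def I2_def using int1 int2
    by (intro has_bochner_integral_add has_bochner_integral_diff has_bochner_integral_mult_right mom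
        has_bochner_integral_integrable)
  \<comment> \<open>Integral of D (|z|^2 - (m + 1))^2 |z|^(2m) by three moments. The value collapses
    to D (m + 1) m!, variance m + 1 times total mass m!.\<close>
  moreover have "has_bochner_integral ?g
      (\<lambda>z. D * ((norm z)^(2 * (m + 2)) - 2 * real (m + 1) * (norm z)^(2 * (m + 1)) + (real (m + 1))\<^sup>2 * (norm z)^(2 * m)))
      (D * (fact (m + 2) - 2 * real (m + 1) * fact (m + 1) + (real (m + 1))\<^sup>2 * fact m))"
    by (intro has_bochner_integral_add has_bochner_integral_diff has_bochner_integral_mult_right mom)
  moreover have "(h z)\<^sup>2 * (norm z)^(2 * m) - 2 * c * (h z * (norm z)^(2 * m)) + c\<^sup>2 * (norm z)^(2 * m)
      \<le> D * ((norm z)^(2 * (m + 2)) - 2 * real (m + 1) * (norm z)^(2 * (m + 1)) + (real (m + 1))\<^sup>2 * (norm z)^(2 * m))" for z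
  proof -
    have "(h z - c)\<^sup>2 * (norm z)^(2 * m) \<le> D * ((norm z)\<^sup>2 - real (m + 1))\<^sup>2 * (norm z)^(2 * m)"
      by (intro mult_right_mono dev) simp
    then show ?thesis
      by (simp add: power2_eq_square algebra_simps power_add power_mult)
  qed
  ultimately have "I2 - 2 * c * I1 + c\<^sup>2 * fact m
      \<le> D * (fact (m + 2) - 2 * real (m + 1) * fact (m + 1) + (real (m + 1))\<^sup>2 * fact m)"
    by (rule has_bochner_integral_le)
  also have "\<dots> = D * (real (m + 1) * fact m)"
    by (simp add: power2_eq_square algebra_simps)
  finally have 1: "I2 - 2 * c * I1 + c\<^sup>2 * fact m \<le> D * (real (m + 1) * fact m)" .
  \<comment> \<open>The true mean I1 / m! minimises the mean square deviation, so the deviation from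
    any constant c bounds the variance.\<close>
  have "0 \<le> (I1 - c * fact m)\<^sup>2 / fact m" by simp
  also have "\<dots> = I1\<^sup>2 / fact m - 2 * c * I1 + c\<^sup>2 * fact m"
    by (simp add: power2_eq_square field_simps)
  finally have "I2 - I1\<^sup>2 / fact m \<le> D * (real (m + 1) * fact m)" using 1 by simp
  \<comment> \<open>The variance m + 1 is absorbed by the quotient m! / (m + l)!, which needs l
    \<ge> 1.\<close>
  also have "\<dots> \<le> D * fact (m + l)"
  proof (intro mult_left_mono D)
    have "real (m + 1) * fact m = fact (m + 1)" by simp
    also have "\<dots> \<le> (fact (m + l) :: real)" using l by (intro fact_mono) simp
    finally show "real (m + 1) * fact m \<le> (fact (m + l) :: real)" .
  qed
  finally have "(I2 - I1\<^sup>2 / fact m) / fact (m + l) \<le> D"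
    by (simp add: pos_divide_le_eq)
  then show ?thesis
    by (simp add: I1_def I2_def diff_divide_distrib mult.commute)
qed

text \<open>The modes k \<ge> l contribute variances, controlled by \<open>D\<close> through the
  deviation of h from constants \<open>c m\<close>. The l modes below have no variance structure and
  are bounded by the size of z^-l outside radius \<rho>. Once \<open>D\<close> is summable, the
  bound is uniform in n.\<close>

lemma ginibre_radial_sum_bound:
  fixes h :: "complex \<Rightarrow> real"
  assumes M: "prob_space M" "finite_ginibre M n X" and l: "l \<ge> 1"
    and h: "continuous_on UNIV h" "\<And>z w. norm z = norm w \<Longrightarrow> h z = h w" "\<And>z. \<bar>h z\<bar> \<le> 1"
    and \<rho>: "\<rho> > 0" "\<And>z. norm z < \<rho> \<Longrightarrow> h z = 0" and R: "\<And>z. norm z > R \<Longrightarrow> h z = 0"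
    and D: "\<And>m. D m \<ge> 0" "\<And>m z. (h z - c m)\<^sup>2 \<le> D m * ((norm z)\<^sup>2 - real (m + 1))\<^sup>2"
  shows "integrable M (\<lambda>\<omega>. (norm (\<Sum>z\<in>X \<omega> \<inter> cball 0 R. complex_of_real (h z) / z ^ l))\<^sup>2)"
    and "integral\<^sup>L M (\<lambda>\<omega>. (norm (\<Sum>z\<in>X \<omega> \<inter> cball 0 R. complex_of_real (h z) / z ^ l))\<^sup>2)
      \<le> real l * (1 / \<rho>^(2 * l)) + (\<Sum>m<n. D m)"
proof -
  let ?g = gauss_measure
  let ?T = "\<lambda>\<omega>. (norm (\<Sum>z\<in>X \<omega> \<inter> cball 0 R. complex_of_real (h z) / z ^ l))\<^sup>2"
  define f where "f z = complex_of_real (h z) / z ^ l" for z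
  \<comment> \<open>The angle is chosen so that u^l = \<i>, which gives the factor - \<i> \<noteq> 1
    for f. It is at most \<pi> / 2, so \<open>Re u\<close> \<ge> 0; the angle \<pi> / l would give
    the excluded value -1 for l = 1.\<close>
  define u where "u = cis (pi / (2 * real l))"
  have u: "norm u = 1" by (simp add: u_def)
  have "pi / (2 * real l) \<le> pi / 2" using l by (simp add: field_simps)
  then have "cos (pi / (2 * real l)) \<ge> 0"
    by (intro cos_ge_zero) (auto intro: order_trans[of _ 0])
  then have Re_u: "Re u \<noteq> - 1" by (simp add: u_def)
  have u_l: "u ^ l = \<i>"
  proof -
    have "real l * (pi / (2 * real l)) = pi / 2" using l by simp
    then show ?thesis by (simp only: u_def Complex.DeMoivre cis_pi_half)
  qed
  have rot: "f (u * z) = - \<i> * f z" for z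
    using h(2)[of "u * z" z] by (simp add: f_def power_mult_distrib u_l norm_mult u divide_simps)
  have f: "continuous_on UNIV f"
    unfolding f_def by (rule continuous_on_divide_power[OF h(1) \<rho>])
  have f0: "f z = 0" if "z \<notin> cball 0 R" for z
    using R[of z] that by (simp add: f_def)
  have h_bdd: "bounded {z. h z \<noteq> 0}"
    by (rule bounded_subset[of "cball 0 R"]) (use R in \<open>auto simp: not_less[symmetric]\<close>)
  have bound: "(\<integral>z. (norm (f z))\<^sup>2 * (norm z)^(2 * k) \<partial>?g) / fact k -
         (if l \<le> k then (norm (\<integral>z. f z * z^k * cnj z^(k - l) \<partial>?g))\<^sup>2 / (fact k * fact (k - l)) else 0)
      \<le> (if k < l then 1 / \<rho>^(2 * l) else D (k - l))" for k
  proof (cases "k < l")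
    case True
    have le: "(norm (f z))\<^sup>2 * (norm z)^(2 * k) \<le> (1 / \<rho>^(2 * l)) * (norm z)^(2 * k)" for z
    proof (intro mult_right_mono)
      show "(norm (f z))\<^sup>2 \<le> 1 / \<rho>^(2 * l)"
      proof (cases "norm z < \<rho>")
        case False
        have "(norm (f z))\<^sup>2 = \<bar>h z\<bar>\<^sup>2 / (norm z)^(2 * l)"
          by (simp add: f_def norm_divide norm_power power_divide power_mult mult.commute)
        also have "\<dots> \<le> 1 / \<rho>^(2 * l)"
          using False \<rho>(1) h(3)[of z] by (intro frac_le power_le_one power_mono) auto
        finally show ?thesis .
      qed (use \<rho> in \<open>simp add: f_def\<close>)
    qed simp
    have "(\<integral>z. (norm (f z))\<^sup>2 * (norm z)^(2 * k) \<partial>?g) \<le> (1 / \<rho>^(2 * l)) * fact k"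
    proof -
      have "has_bochner_integral ?g (\<lambda>z. (1 / \<rho>^(2 * l)) * (norm z)^(2 * k)) ((1 / \<rho>^(2 * l)) * fact k)"
        by (intro has_bochner_integral_mult_right gauss_measure_moment)
      moreover have "integrable ?g (\<lambda>z. (norm (f z))\<^sup>2 * (norm z)^(2 * k))"
        by (intro integrable_gauss_continuous continuous_intros f bounded_subset[OF bounded_cball[of 0 R]])
           (use f0 in \<open>auto intro: ccontr\<close>)
      ultimately show ?thesis using le
        by (intro has_bochner_integral_le[OF has_bochner_integral_integrable])
    qed
    then have "(\<integral>z. (norm (f z))\<^sup>2 * (norm z)^(2 * k) \<partial>?g) / fact k \<le> 1 / \<rho>^(2 * l)"
      by (simp add: pos_divide_le_eq)
    then show ?thesis using True by simp
  next
    case False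
    define m where "m = k - l"
    have k: "k = m + l" using False by (simp add: m_def)
    \<comment> \<open>For m = 0 and z = 0 the power of the norm is 1 while f z is 0 by the
      convention for division by 0; h 0 = 0 makes the next two identities hold there too.\<close>
    have h0: "h 0 = 0" using \<rho> by simp
    have e1: "(norm (f z))\<^sup>2 * (norm z)^(2 * k) = (h z)\<^sup>2 * (norm z)^(2 * m)" for z
      by (cases "z = 0") (simp_all add: f_def k h0 norm_divide norm_power power_divide power_mult[symmetric] mult.commute
          distrib_left power_add)
    have e2: "f z * z^k * cnj z^m = complex_of_real (h z * (norm z)^(2 * m))" for z
    proof (cases "z = 0")
      case False
      then have "f z * z^k * cnj z^m = complex_of_real (h z) * (z * cnj z)^m"
        by (simp add: f_def k power_add power_mult_distrib)
      also have "\<dots> = complex_of_real (h z * (norm z)^(2 * m))"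
        by (simp only: complex_norm_square[symmetric] of_real_power[symmetric] of_real_mult power_mult)
      finally show ?thesis .
    qed (simp add: f_def h0)
    have "(\<integral>z. (norm (f z))\<^sup>2 * (norm z)^(2 * k) \<partial>?g) / fact k -
         (norm (\<integral>z. f z * z^k * cnj z^m \<partial>?g))\<^sup>2 / (fact k * fact m) \<le> D m"
      unfolding e1 e2 integral_complex_of_real norm_of_real power2_abs
      unfolding k by (rule gauss_variance_term[OF h(1) h_bdd l D(1,2)])
    then show ?thesis using False by (simp add: m_def)
  qed
  have i: "- \<i> \<noteq> 1" by (simp add: complex_eq_iff)
  note sm = ginibre_second_moment[OF M _ _ f f0 u Re_u i rot, of "cball 0 R"]
  show "integrable M ?T"
    using sm(1) unfolding f_def by simp
  have "integral\<^sup>L M ?T \<le> (\<Sum>k<n. (\<integral>z. (norm (f z))\<^sup>2 * (norm z)^(2 * k) \<partial>?g) / fact k -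
         (if l \<le> k then (norm (\<integral>z. f z * z^k * cnj z^(k - l) \<partial>?g))\<^sup>2 / (fact k * fact (k - l)) else 0))"
    using sm(2)[of l] unfolding f_def by simp
  also have "\<dots> \<le> (\<Sum>k<n. if k < l then 1 / \<rho>^(2 * l) else D (k - l))"
    by (intro sum_mono bound)
  also have "\<dots> \<le> real l * (1 / \<rho>^(2 * l)) + (\<Sum>m<n. D m)"
    using \<rho>(1) D(1) by (intro sum_lessThan_shift_le) auto
  finally show "integral\<^sup>L M ?T \<le> real l * (1 / \<rho>^(2 * l)) + (\<Sum>m<n. D m)" .
qed

section \<open>The radial cutoff\<close>

lemma cutoff_continuous: "cutoff r0 \<phi> \<Longrightarrow> continuous_on UNIV \<phi>"
  unfolding cutoff_def smooth_function_def using Ck_function.simps(1) by blast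

lemma cutoff_radial: "cutoff r0 \<phi> \<Longrightarrow> norm z = norm w \<Longrightarrow> \<phi> z = \<phi> w"
  unfolding cutoff_def radial_def by blast

lemma cutoff_norm: "cutoff r0 \<phi> \<Longrightarrow> \<phi> z = \<phi> (complex_of_real (norm z))"
  by (rule cutoff_radial) auto

lemma cutoff_outside:
  assumes "cutoff r0 \<phi>" "norm z < r0 \<or> norm z > 3 * r0"
  shows "\<phi> z = 0"
proof (rule ccontr)
  assume "\<phi> z \<noteq> 0"
  then have "z \<in> closure {z. \<phi> z \<noteq> 0}" by (intro subsetD[OF closure_subset]) simp
  then show False using assms unfolding cutoff_def by auto
qed

text \<open>The gluing condition with t = r0 + r. In this multiplicative form it says that
  consecutive dyadic dilates add up to 1 where they overlap.\<close>

lemma cutoff_doubling: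
  assumes "cutoff r0 \<phi>" "r0 \<le> t" "t \<le> 3 * r0 / 2"
  shows "\<phi> (complex_of_real t) + \<phi> (complex_of_real (2 * t)) = 1"
proof -
  have "\<forall>r\<in>{0 .. r0 / 2}. \<phi> (complex_of_real (r0 + r)) = 1 - \<phi> (complex_of_real (2 * r0 + 2 * r))"
    using assms(1) by (simp add: cutoff_def)
  then have "\<phi> (complex_of_real (r0 + (t - r0))) = 1 - \<phi> (complex_of_real (2 * r0 + 2 * (t - r0)))"
    by (rule bspec) (use assms in auto)
  then show ?thesis by (simp add: algebra_simps)
qed

lemma cutoff_one: "cutoff r0 \<phi> \<Longrightarrow> 3 * r0 / 2 \<le> t \<Longrightarrow> t \<le> 2 * r0 \<Longrightarrow> \<phi> (complex_of_real t) = 1"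
  by (simp add: cutoff_def)

lemma cutoff_nonneg: "cutoff r0 \<phi> \<Longrightarrow> \<phi> z \<ge> 0"
  by (simp add: cutoff_def)

text \<open>The support condition leaves the circle of radius 3 * r0 open; the doubling identity at
  t = 3 * r0 / 2, on the plateau, settles it.\<close>

lemma cutoff_outer_radius: "cutoff r0 \<phi> \<Longrightarrow> r0 > 0 \<Longrightarrow> \<phi> (complex_of_real (3 * r0)) = 0"
  using cutoff_doubling[of r0 \<phi> "3 * r0 / 2"] cutoff_one[of r0 \<phi> "3 * r0 / 2"] by simp

text \<open>An upper bound is not part of the definition. On each transition zone it follows from
  doubling, since the partner value at 2t or t / 2 is nonnegative.\<close>

lemma cutoff_le_1:
  assumes c: "cutoff r0 \<phi>" and r0: "r0 > 0"
  shows "\<phi> z \<le> 1"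
proof -
  let ?t = "norm z"
  have "\<phi> (complex_of_real ?t) \<le> 1"
  proof -
    consider "?t < r0 \<or> ?t > 3 * r0" | "r0 \<le> ?t" "?t \<le> 3 * r0 / 2" | "3 * r0 / 2 \<le> ?t" "?t \<le> 2 * r0"
      | "2 * r0 \<le> ?t" "?t \<le> 3 * r0" by linarith
    then show ?thesis
    proof cases
      case 1
      then show ?thesis using cutoff_outside[OF c, of z] cutoff_norm[OF c, of z] by simp
    next
      case 2
      then show ?thesis
        using cutoff_doubling[OF c, of ?t] cutoff_nonneg[OF c, of "complex_of_real (2 * ?t)"] by simp
    next
      case 3
      then show ?thesis using cutoff_one[OF c] by simp
    next
      case 4
      then show ?thesis
        using cutoff_doubling[OF c, of "?t / 2"] cutoff_nonneg[OF c, of "complex_of_real (?t / 2)"] by simp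
    qed
  qed
  with cutoff_norm[OF c, of z] show ?thesis by simp
qed

text \<open>For a radial function the restriction to the real axis suffices. Its derivative is the
  continuous partial derivative in direction 1, bounded on the ball of radius 3 * r0, and beyond
  that radius \<phi> vanishes.\<close>

lemma cutoff_lipschitz:
  assumes c: "cutoff r0 \<phi>" and r0: "r0 > 0"
  shows "\<exists>K\<ge>0. \<forall>s\<ge>0. \<forall>t\<ge>0. \<bar>\<phi> (complex_of_real s) - \<phi> (complex_of_real t)\<bar> \<le> K * \<bar>s - t\<bar>"
proof -
  have "Ck_function (Suc 0) \<phi>" using c by (simp add: cutoff_def smooth_function_def del: Ck_function.simps)
  then have diff: "\<phi> differentiable (at x)" and "continuous_on UNIV (\<lambda>x. frechet_derivative \<phi> (at x) 1)" for x
    by (auto simp: Basis_complex_def)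
  then obtain K where K: "K \<ge> 0" "\<forall>x\<in>cball 0 (3 * r0). norm (frechet_derivative \<phi> (at x) 1) \<le> K"
    using continuous_bounded_on_bounded bounded_cball by blast
  let ?\<Phi> = "\<lambda>t. \<phi> (complex_of_real t)"
  have deriv: "(?\<Phi> has_field_derivative frechet_derivative \<phi> (at (complex_of_real t)) 1) (at t)" for t
  proof -
    have "(\<phi> has_derivative frechet_derivative \<phi> (at (complex_of_real t))) (at (complex_of_real t))"
      using diff frechet_derivative_works by blast
    then have "(?\<Phi> has_derivative (\<lambda>h. frechet_derivative \<phi> (at (complex_of_real t)) (complex_of_real h))) (at t)"
      by (rule has_derivative_compose[rotated]) (auto intro!: derivative_eq_intros)
    moreover have "frechet_derivative \<phi> (at (complex_of_real t)) (complex_of_real h)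
        = frechet_derivative \<phi> (at (complex_of_real t)) 1 * h" for h
      using linear_scale[OF linear_frechet_derivative[OF diff], of "complex_of_real t" h 1]
      by (simp add: scaleR_conv_of_real mult.commute)
    ultimately show ?thesis by (simp add: has_field_derivative_def)
  qed
  have inner: "\<bar>?\<Phi> s - ?\<Phi> t\<bar> \<le> K * \<bar>s - t\<bar>" if "s \<in> {0..3 * r0}" "t \<in> {0..3 * r0}" for s t
    using field_differentiable_bound[of "{0..3 * r0}" ?\<Phi>
        "\<lambda>t. frechet_derivative \<phi> (at (complex_of_real t)) 1" K s t] that K(2)
    by (auto intro: has_field_derivative_at_within[OF deriv])
  have outer: "?\<Phi> t = 0" if "t \<ge> 3 * r0" for t
    using that r0 cutoff_outer_radius[OF c r0] cutoff_outside[OF c, of "complex_of_real t"]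
    by (cases "t = 3 * r0") auto
  have "\<bar>?\<Phi> s - ?\<Phi> t\<bar> \<le> K * \<bar>s - t\<bar>" if st: "s \<ge> 0" "t \<ge> 0" for s t
  proof -
    \<comment> \<open>Truncating both arguments at 3 * r0 changes no value and does not increase
      their distance.\<close>
    have "?\<Phi> x = ?\<Phi> (min x (3 * r0))" for x
      using outer[of x] outer[of "3 * r0"] by (auto simp: min_def)
    then have "\<bar>?\<Phi> s - ?\<Phi> t\<bar> = \<bar>?\<Phi> (min s (3 * r0)) - ?\<Phi> (min t (3 * r0))\<bar>" by simp
    also have "\<dots> \<le> K * \<bar>min s (3 * r0) - min t (3 * r0)\<bar>"
      using st r0 by (intro inner) auto
    also have "\<dots> \<le> K * \<bar>s - t\<bar>"
      using K(1) by (intro mult_left_mono) auto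
    finally show ?thesis .
  qed
  then show ?thesis using K(1) by blast
qed

text \<open>The function \<open>t \<mapsto> \<phi> (\<surd>t)\<close> has difference quotients of size \<open>min 1 (1 / t)\<close>; the weight
  \<open>y\<^sup>3 = t\<^sup>3\<^sup>/\<^sup>2\<close> is chosen between \<open>t\<^sup>1\<close> and \<open>t\<^sup>2\<close>.\<close>

lemma cutoff_square_increment:
  assumes c: "cutoff r0 \<phi>" and r0: "r0 > 0"
  shows "\<exists>C\<ge>0. \<forall>x\<ge>0. \<forall>y>0. y^3 * (\<phi> (complex_of_real x) - \<phi> (complex_of_real y))\<^sup>2 \<le> C * (x\<^sup>2 - y\<^sup>2)\<^sup>2"
proof -
  let ?\<Phi> = "\<lambda>t. \<phi> (complex_of_real t)"
  obtain K where K: "K \<ge> 0" "\<And>s t. s \<ge> 0 \<Longrightarrow> t \<ge> 0 \<Longrightarrow> \<bar>?\<Phi> s - ?\<Phi> t\<bar> \<le> K * \<bar>s - t\<bar>"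
    using cutoff_lipschitz[OF c r0] by blast
  \<comment> \<open>One summand for each estimate below: K / r0 from the Lipschitz bound, 36 * K *
    r0 = (K / r0) * (6 * r0)^2 for y \<le> 6 * r0, and 2 for larger y.\<close>
  define C where "C = K / r0 + 36 * K * r0 + 2"
  have C: "C \<ge> 0" "K / r0 \<le> C" "36 * K * r0 \<le> C" "2 \<le> C" using K(1) r0 by (auto simp: C_def)
  have "y^3 * (?\<Phi> x - ?\<Phi> y)\<^sup>2 \<le> C\<^sup>2 * (x\<^sup>2 - y\<^sup>2)\<^sup>2" if x: "x \<ge> 0" and y: "y > 0" for x y
  proof -
    define \<Delta> \<delta> where "\<Delta> = \<bar>?\<Phi> x - ?\<Phi> y\<bar>" and "\<delta> = \<bar>x\<^sup>2 - y\<^sup>2\<bar>"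
    have \<delta>: "\<delta> = \<bar>x - y\<bar> * (x + y)" "\<delta> \<ge> 0"
      using x y by (auto simp: \<delta>_def power2_eq_square abs_mult square_diff_square_factored mult.commute)
    have \<Delta>: "\<Delta> \<ge> 0" by (simp add: \<Delta>_def)
    have 0: "\<Delta> \<le> (K / r0) * \<delta>"
    \<comment> \<open>Since x^2 - y^2 = (x - y) (x + y), a lower bound for x + y is needed. If x + y
      < r0, both radii lie in the hole where \<phi> is 0.\<close>
    proof (cases "x + y \<ge> r0")
      case True
      have "\<Delta> \<le> K * \<bar>x - y\<bar>" unfolding \<Delta>_def using x y by (intro K(2)) auto
      also have "\<bar>x - y\<bar> \<le> \<delta> / r0"
        using True r0 mult_left_mono[OF True, of "\<bar>x - y\<bar>"] by (simp add: \<delta>(1) pos_le_divide_eq)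
      finally show ?thesis using K(1) by (simp add: mult_left_mono)
    next
      case False
      then have "?\<Phi> x = 0" "?\<Phi> y = 0" using x y by (auto intro!: cutoff_outside[OF c])
      then show ?thesis using K(1) r0 \<delta>(2) by (simp add: \<Delta>_def)
    qed
    have 1: "\<Delta> \<le> C * \<delta>"
      using 0 mult_right_mono[OF C(2) \<delta>(2)] by simp
    have 2: "\<Delta> * y\<^sup>2 \<le> C * \<delta>"
    proof (cases "y \<le> 6 * r0")
      case True
      then have "y\<^sup>2 \<le> (6 * r0)\<^sup>2" using y by (intro power_mono) auto
      then have "\<Delta> * y\<^sup>2 \<le> ((K / r0) * \<delta>) * (6 * r0)\<^sup>2"
        using 0 \<Delta> by (intro mult_mono) auto
      also have "\<dots> = (36 * K * r0) * \<delta>" using r0 by (simp add: power2_eq_square)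
      also have "\<dots> \<le> C * \<delta>" by (intro mult_right_mono C \<delta>)
      finally show ?thesis .
    next
      case False
      \<comment> \<open>Only x \<le> 3 * r0 can give a nonzero increment now; then x \<le> y / 2, so
        \<delta> is comparable to y^2 and the trivial bound \<Delta> \<le> 1 suffices.\<close>
      then have \<Phi>y: "?\<Phi> y = 0" using r0 y by (intro cutoff_outside[OF c]) auto
      show ?thesis
      proof (cases "x > 3 * r0")
        case True
        then have "?\<Phi> x = 0" using x by (intro cutoff_outside[OF c]) auto
        then show ?thesis using C(1) \<delta>(2) by (simp add: \<Delta>_def \<Phi>y)
      next
        case False
        then have "x\<^sup>2 \<le> (y / 2)\<^sup>2" using x \<open>\<not> y \<le> 6 * r0\<close> by (intro power_mono) auto
        then have "x\<^sup>2 \<le> y\<^sup>2 / 4" by (simp add: power_divide)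
        moreover have "y\<^sup>2 - x\<^sup>2 \<le> \<delta>" by (simp add: \<delta>_def)
        ultimately have "y\<^sup>2 \<le> 2 * \<delta>" using zero_le_power2[of y] by linarith
        moreover have "\<Delta> \<le> 1"
          using cutoff_le_1[OF c r0, of "complex_of_real x"] cutoff_nonneg[OF c, of "complex_of_real x"]
          by (simp add: \<Delta>_def \<Phi>y)
        ultimately have "\<Delta> * y\<^sup>2 \<le> 1 * (2 * \<delta>)" using \<Delta> by (intro mult_mono) auto
        also have "\<dots> \<le> C * \<delta>" using C(4) \<delta>(2) by (simp add: mult_right_mono)
        finally show ?thesis .
      qed
    qed
    \<comment> \<open>This combines the estimates 1 and 2, which bound \<Delta> times 1 and times
      y^2; their squares carry the weights 1 and y^4, and y^3 lies below the larger.\<close>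
    have "y^3 \<le> (max 1 (y\<^sup>2))\<^sup>2"
    proof (cases "y \<le> 1")
      case True
      then have "y^3 \<le> 1" using y by (intro power_le_one) auto
      also have "1 \<le> (max 1 (y\<^sup>2))\<^sup>2" by (intro one_le_power) simp
      finally show ?thesis .
    next
      case False
      then have "y^3 \<le> y^4" by (intro power_increasing) auto
      also have "y^4 = (y\<^sup>2)\<^sup>2" by simp
      also have "\<dots> \<le> (max 1 (y\<^sup>2))\<^sup>2" by (intro power_mono) auto
      finally show ?thesis .
    qed
    then have "y^3 * \<Delta>\<^sup>2 \<le> (max 1 (y\<^sup>2))\<^sup>2 * \<Delta>\<^sup>2" by (intro mult_right_mono) auto
    also have "\<dots> = (max 1 (y\<^sup>2) * \<Delta>)\<^sup>2" by (simp add: power_mult_distrib)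
    also have "\<dots> \<le> (C * \<delta>)\<^sup>2"
      using 1 2 \<Delta> by (intro power_mono) (auto simp: max_def mult.commute)
    finally show ?thesis by (simp add: \<Delta>_def \<delta>_def power_mult_distrib)
  qed
  then show ?thesis by (intro exI[of _ "C\<^sup>2"]) auto
qed

lemma summable_inverse_sqrt_cubed: "summable (\<lambda>m. 1 / sqrt (real (m + 1)) ^ 3)"
proof -
  have "summable (\<lambda>m. real m powr (- 3 / 2))"
    by (subst summable_real_powr_iff) simp
  then have "summable (\<lambda>m. real (m + 1) powr (- 3 / 2))"
    by (rule summable_ignore_initial_segment)
  moreover have "real (m + 1) powr (- 3 / 2) = 1 / sqrt (real (m + 1)) ^ 3" for m
    by (simp add: powr_half_sqrt[symmetric] powr_realpow[symmetric] powr_powr powr_minus_divide)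
  ultimately show ?thesis by simp
qed

text \<open>The exponent of \<open>L\<close> is not optimal, but any power makes the sum over \<open>L = 2 ^ j\<close> converge.\<close>

lemma ginibre_scale_bound:
  assumes c: "cutoff r0 \<phi>" and r0: "r0 > 0" and l: "l \<ge> 1"
  shows "\<exists>C\<ge>0. \<forall>(M :: 'w measure) n X L. prob_space M \<longrightarrow> finite_ginibre M n X \<longrightarrow> L \<ge> 1 \<longrightarrow>
     integrable M (\<lambda>\<omega>. (norm (\<Sum>z\<in>X \<omega> \<inter> cball 0 (3 * r0 * L). complex_of_real (dilate L \<phi> z) / z ^ l))\<^sup>2) \<and>
     (\<integral>\<omega>. (norm (\<Sum>z\<in>X \<omega> \<inter> cball 0 (3 * r0 * L). complex_of_real (dilate L \<phi> z) / z ^ l))\<^sup>2 \<partial>M) \<le> C / L"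
proof -
  obtain C where C: "C \<ge> 0" "\<And>x y. x \<ge> 0 \<Longrightarrow> y > 0 \<Longrightarrow>
      y^3 * (\<phi> (complex_of_real x) - \<phi> (complex_of_real y))\<^sup>2 \<le> C * (x\<^sup>2 - y\<^sup>2)\<^sup>2"
    using cutoff_square_increment[OF c r0] by blast
  define Z where "Z = (\<Sum>m. 1 / sqrt (real (m + 1)) ^ 3)"
  \<comment> \<open>The first summand comes from the l low modes, the second from the series of the
    deviations over m.\<close>
  define A where "A = real l * (1 / r0^(2 * l)) + C * Z"
  have Z: "Z \<ge> 0" unfolding Z_def by (intro suminf_nonneg summable_inverse_sqrt_cubed) simp
  have A: "A \<ge> 0" using Z C(1) r0 by (simp add: A_def)
  have main: "integrable M (\<lambda>\<omega>. (norm (\<Sum>z\<in>X \<omega> \<inter> cball 0 (3 * r0 * L). complex_of_real (dilate L \<phi> z) / z ^ l))\<^sup>2)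
     \<and> (\<integral>\<omega>. (norm (\<Sum>z\<in>X \<omega> \<inter> cball 0 (3 * r0 * L). complex_of_real (dilate L \<phi> z) / z ^ l))\<^sup>2 \<partial>M) \<le> A / L"
    if M: "prob_space M" "finite_ginibre M n X" and L: "L \<ge> 1" for M :: "'w measure" and n X L
  proof -
    define D where "D m = C / (L * sqrt (real (m + 1)) ^ 3)" for m
    \<comment> \<open>The comparison constant is the value of the cutoff at radius sqrt (m + 1),
      where |z| concentrates under the weight |z|^(2m).\<close>
    define d where "d m = \<phi> (complex_of_real (sqrt (real (m + 1)) / L))" for m
    have cont: "continuous_on UNIV (dilate L \<phi>)"
      unfolding dilate_def
      using L by (intro continuous_on_compose2[OF cutoff_continuous[OF c]] continuous_intros) auto
    have rad: "dilate L \<phi> z = dilate L \<phi> w" if "norm z = norm w" for z w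
      unfolding dilate_def using that by (intro cutoff_radial[OF c]) (simp add: norm_divide)
    have le1: "\<bar>dilate L \<phi> z\<bar> \<le> 1" for z
      using cutoff_le_1[OF c r0] cutoff_nonneg[OF c] by (simp add: dilate_def)
    have in0: "dilate L \<phi> z = 0" if "norm z < L * r0" for z
      unfolding dilate_def using that L by (intro cutoff_outside[OF c]) (simp add: norm_divide field_simps)
    have out0: "dilate L \<phi> z = 0" if "norm z > 3 * r0 * L" for z
      unfolding dilate_def using that L by (intro cutoff_outside[OF c]) (simp add: norm_divide field_simps)
    have D0: "D m \<ge> 0" for m using C(1) L by (simp add: D_def)
    have dev: "(dilate L \<phi> z - d m)\<^sup>2 \<le> D m * ((norm z)\<^sup>2 - real (m + 1))\<^sup>2" for m z
    proof -
      let ?s = "sqrt (real (m + 1))"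
      have "\<phi> (z / complex_of_real L) = \<phi> (complex_of_real (norm z / L))"
        using L by (intro cutoff_radial[OF c]) (simp add: norm_divide)
      \<comment> \<open>The increment bound at the radii |z| / L and sqrt (m + 1) / L. The
        difference of squares gives L^-4, the cubic weight gives back L^3, and 1 / L
        remains.\<close>
      then have "(?s / L)^3 * (dilate L \<phi> z - d m)\<^sup>2 \<le> C * ((norm z / L)\<^sup>2 - (?s / L)\<^sup>2)\<^sup>2"
        unfolding dilate_def d_def using L by (simp only:) (intro C(2), auto)
      also have "\<dots> = C * ((norm z)\<^sup>2 - real (m + 1))\<^sup>2 / L^4"
        by (simp add: power_divide diff_divide_distrib[symmetric])
      finally have "(dilate L \<phi> z - d m)\<^sup>2 \<le> (C * ((norm z)\<^sup>2 - real (m + 1))\<^sup>2 / L^4) / (?s / L)^3"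
        using L by (subst pos_le_divide_eq) (auto simp: mult.commute)
      also have "\<dots> = D m * ((norm z)\<^sup>2 - real (m + 1))\<^sup>2"
      proof -
        have scaling: "(C * E / L^4) / (s / L)^3 = C / (L * s^3) * E" if "s > 0" for E s
          using L that by (simp add: field_simps eval_nat_numeral)
        show ?thesis unfolding D_def by (rule scaling) simp
      qed
      finally show ?thesis .
    qed
    have \<rho>: "L * r0 > 0" using L r0 by simp
    note b = ginibre_radial_sum_bound[OF M l cont rad le1 \<rho> in0 out0 D0 dev]
    have "(\<Sum>m<n. D m) = (C / L) * (\<Sum>m<n. 1 / sqrt (real (m + 1)) ^ 3)"
      by (simp add: D_def sum_distrib_left)
    also have "\<dots> \<le> (C / L) * Z"
      unfolding Z_def using C(1) L
      by (intro mult_left_mono sum_le_suminf summable_inverse_sqrt_cubed) auto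
    finally have D_sum: "(\<Sum>m<n. D m) \<le> C * Z / L" by simp
    have "L \<le> L^(2 * l)" using L l power_increasing[of 1 "2 * l" L] by simp
    then have "1 / (L * r0)^(2 * l) \<le> (1 / r0^(2 * l)) / L"
      using L r0 by (simp add: power_mult_distrib field_simps)
    then have "real l * (1 / (L * r0)^(2 * l)) \<le> real l * ((1 / r0^(2 * l)) / L)"
      by (intro mult_left_mono) auto
    with D_sum have "real l * (1 / (L * r0)^(2 * l)) + (\<Sum>m<n. D m) \<le> A / L"
      by (simp add: A_def add_divide_distrib)
    then show ?thesis using b by (auto intro: order_trans)
  qed
  show ?thesis using main A by blast
qed

section \<open>Decomposition into dyadic scales\<close>

text \<open>The ball contains the support of the dilated cutoff. Intersecting with it makes the
  index set finite for a locally finite configuration; a sum over an infinite set would be 0 by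
  convention.\<close>

definition ring_sum :: "real \<Rightarrow> (complex \<Rightarrow> real) \<Rightarrow> nat \<Rightarrow> nat \<Rightarrow> complex set \<Rightarrow> complex" where
  "ring_sum r0 \<phi> l j S = (\<Sum>z\<in>S \<inter> cball 0 (3 * r0 * 2^j). complex_of_real (dilate (2^j) \<phi> z) / z^l)"

text \<open>The part within radius 3 * r0, for which eventual equality of the configurations is used
  instead of a moment bound.\<close>

definition core_sum :: "real \<Rightarrow> (complex \<Rightarrow> real) \<Rightarrow> nat \<Rightarrow> complex set \<Rightarrow> complex" where
  "core_sum r0 \<phi> l S = S_in r0 l S + (\<Sum>z\<in>S \<inter> cball 0 (3 * r0). complex_of_real (cutoff_tilde r0 \<phi> z) / z^l)"

lemma dilate_eq_0:
  assumes c: "cutoff r0 \<phi>" and L: "L > 0" and z: "norm z < r0 * L \<or> norm z > 3 * r0 * L"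
  shows "dilate L \<phi> z = 0"
  unfolding dilate_def using z L by (intro cutoff_outside[OF c]) (auto simp: norm_divide field_simps)

lemma cutoff_tilde_eq_0:
  assumes c: "cutoff r0 \<phi>" and r0: "r0 > 0" and z: "norm z < r0 \<or> norm z > 3 * r0"
  shows "cutoff_tilde r0 \<phi> z = 0"
  using cutoff_outside[OF c z] z r0 by (auto simp: cutoff_tilde_def)

text \<open>The partial sums of the partition of unity telescope.\<close>

lemma cutoff_partial_sum:
  assumes c: "cutoff r0 \<phi>" and r0: "r0 > 0" and z: "norm z \<ge> r0"
  shows "cutoff_tilde r0 \<phi> z + (\<Sum>j<J. dilate (2^Suc j) \<phi> z)
    = (if norm z \<le> 3 * r0 / 2 * 2^J then 1 else dilate (2^J) \<phi> z)"
proof (induction J)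
  case 0
  then show ?case using z by (simp add: cutoff_tilde_def dilate_def)
next
  case (Suc J)
  \<comment> \<open>The radius in units of the newest scale; the previous dilate then sees the
    radius 2 * s.\<close>
  define s where "s = norm z / 2^Suc J"
  have zs: "norm z = s * 2^Suc J" by (simp add: s_def)
  have d1: "dilate (2^Suc J) \<phi> z = \<phi> (complex_of_real s)"
    unfolding dilate_def s_def by (intro cutoff_radial[OF c]) (simp add: norm_divide norm_power norm_mult)
  have d0: "dilate (2^J) \<phi> z = \<phi> (complex_of_real (2 * s))"
    unfolding dilate_def s_def by (intro cutoff_radial[OF c]) (simp add: norm_divide norm_power norm_mult)
  have "norm z > 0" using z r0 by linarith
  then have s: "s > 0" unfolding s_def by (rule divide_pos_pos) simp
  have c1: "norm z \<le> 3 * r0 / 2 * 2^J \<longleftrightarrow> s \<le> 3 * r0 / 4" by (simp add: zs field_simps)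
  have c2: "norm z \<le> 3 * r0 / 2 * 2^Suc J \<longleftrightarrow> s \<le> 3 * r0 / 2" by (simp add: zs field_simps)
  have "(if s \<le> 3 * r0 / 4 then 1 else \<phi> (complex_of_real (2 * s))) + \<phi> (complex_of_real s)
      = (if s \<le> 3 * r0 / 2 then 1 else \<phi> (complex_of_real s))"
  proof -
    \<comment> \<open>In order: below the newest ring, with the partial sum already 1; 2 * s on the
      plateau of the previous dilate; the overlap, settled by doubling; 2 * s beyond the support of
      the previous dilate.\<close>
    consider "s \<le> 3 * r0 / 4" | "3 * r0 / 4 < s" "s < r0" | "r0 \<le> s" "s \<le> 3 * r0 / 2" | "3 * r0 / 2 < s" by linarith
    then show ?thesis
    proof cases
      case 1
      then have "\<phi> (complex_of_real s) = 0" using s r0 by (intro cutoff_outside[OF c]) auto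
      then show ?thesis using 1 r0 by simp
    next
      case 2
      then have "\<phi> (complex_of_real s) = 0" using s r0 by (intro cutoff_outside[OF c]) auto
      moreover have "\<phi> (complex_of_real (2 * s)) = 1" using 2 by (intro cutoff_one[OF c]) auto
      ultimately show ?thesis using 2 r0 by simp
    next
      case 3
      then show ?thesis using cutoff_doubling[OF c, of s] r0 by simp
    next
      case 4
      then have "\<phi> (complex_of_real (2 * s)) = 0" using s r0 by (intro cutoff_outside[OF c]) auto
      then show ?thesis using 4 r0 by simp
    qed
  qed
  then show ?case
    unfolding sum.lessThan_Suc add.assoc[symmetric] Suc.IH c1 c2 d0 d1 .
qed

lemma borel_measurable_cutoff_quotients:
  assumes c: "cutoff r0 \<phi>"
  shows "(\<lambda>z. complex_of_real (dilate L \<phi> z) / z^l) \<in> borel_measurable borel"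
    and "(\<lambda>z. complex_of_real (cutoff_tilde r0 \<phi> z) / z^l) \<in> borel_measurable borel"
proof -
  have [measurable]: "\<phi> \<in> borel_measurable borel"
    by (rule borel_measurable_continuous_onI[OF cutoff_continuous[OF c]])
  show "(\<lambda>z. complex_of_real (dilate L \<phi> z) / z^l) \<in> borel_measurable borel"
    unfolding dilate_def by measurable
  show "(\<lambda>z. complex_of_real (cutoff_tilde r0 \<phi> z) / z^l) \<in> borel_measurable borel"
    unfolding cutoff_tilde_def by measurable
qed

text \<open>Each integrand has bounded support, so its integral is a finite sum. Convergence of the
  series is not asked for: both sides contain the same \<open>suminf\<close>.\<close>

lemma alpha_inf_eq:
  assumes c: "cutoff r0 \<phi>" and r0: "r0 > 0" and S: "\<And>B. bounded B \<Longrightarrow> finite (S \<inter> B)"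
  shows "alpha_inf r0 \<phi> l S = core_sum r0 \<phi> l S + (\<Sum>j. ring_sum r0 \<phi> l (Suc j) S)"
proof -
  have "(\<integral>z. complex_of_real (cutoff_tilde r0 \<phi> z) / z^l \<partial>config_measure S)
      = (\<Sum>z\<in>S \<inter> cball 0 (3 * r0). complex_of_real (cutoff_tilde r0 \<phi> z) / z^l)"
    using cutoff_tilde_eq_0[OF c r0]
    by (intro integral_config_measure borel_measurable_cutoff_quotients[OF c] S) auto
  moreover have "(\<integral>z. complex_of_real (dilate (2^Suc j) \<phi> z) / z^l \<partial>config_measure S) = ring_sum r0 \<phi> l (Suc j) S" for j
    unfolding ring_sum_def using dilate_eq_0[OF c, of "2^Suc j"]
    by (intro integral_config_measure borel_measurable_cutoff_quotients[OF c] S) auto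
  ultimately show ?thesis
    by (simp add: alpha_inf_def S_out_def core_sum_def)
qed

lemma ring_sum_finite:
  assumes c: "cutoff r0 \<phi>" and S: "finite S"
  shows "ring_sum r0 \<phi> l j S = (\<Sum>z\<in>S. complex_of_real (dilate (2^j) \<phi> z) / z^l)"
  unfolding ring_sum_def using S dilate_eq_0[OF c, of "2^j"]
  by (intro sum.mono_neutral_left) auto

lemma ring_sum_eventually_0:
  assumes c: "cutoff r0 \<phi>" and r0: "r0 > 0" and S: "finite S"
  shows "\<exists>N. \<forall>j\<ge>N. ring_sum r0 \<phi> l j S = 0"
proof -
  obtain R where R: "\<And>z. z \<in> S \<Longrightarrow> norm z \<le> R"
    using finite_imp_bounded[OF S] by (auto simp: bounded_iff)
  obtain N where N: "R / r0 < 2^N" using real_arch_pow[of 2 "R / r0"] by auto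
  have "ring_sum r0 \<phi> l j S = 0" if "j \<ge> N" for j
  proof -
    have "dilate (2^j) \<phi> z = 0" if z: "z \<in> S" for z
    proof (rule dilate_eq_0[OF c])
      have "norm z / r0 \<le> R / r0" using R[OF z] r0 by (simp add: divide_right_mono)
      also note N
      also have "(2::real)^N \<le> 2^j" using \<open>j \<ge> N\<close> by (intro power_increasing) auto
      finally show "norm z < r0 * 2^j \<or> norm z > 3 * r0 * 2^j" using r0 by (simp add: field_simps)
    qed simp
    then show ?thesis by (simp add: ring_sum_finite[OF c S])
  qed
  then show ?thesis by blast
qed

lemma summable_ring_sum_finite:
  assumes "cutoff r0 \<phi>" "r0 > 0" "finite S"
  shows "summable (\<lambda>j. ring_sum r0 \<phi> l (Suc j) S)"
proof -
  obtain N where "\<forall>j\<ge>N. ring_sum r0 \<phi> l j S = 0" using ring_sum_eventually_0[OF assms] by blast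
  then show ?thesis by (intro summable_finite[of "{..<N}"]) (auto simp: not_less)
qed

text \<open>A finite set meets only finitely many rings, and the partition of unity adds up to 1
  outside the disc and to 0 inside. The sums for the finite ensembles are thus cut by the same rings
  as those for the limit.\<close>

lemma alpha_fin_eq_alpha_inf:
  assumes c: "cutoff r0 \<phi>" and r0: "r0 > 0" and S: "finite S"
  shows "alpha_fin r0 l S = alpha_inf r0 \<phi> l S"
proof -
  obtain N where N: "\<forall>j\<ge>N. ring_sum r0 \<phi> l j S = 0" using ring_sum_eventually_0[OF c r0 S] by blast
  obtain R where R: "\<And>z. z \<in> S \<Longrightarrow> norm z \<le> R"
    using finite_imp_bounded[OF S] by (auto simp: bounded_iff)
  obtain N' where N': "R / r0 < 2^N'" using real_arch_pow[of 2 "R / r0"] by auto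
  \<comment> \<open>N discards all later rings; N' makes every point of S lie where the partial sum
    of the partition of unity equals 1.\<close>
  define J where "J = max N N'"
  note N'
  also have "(2::real)^N' \<le> 2^J" unfolding J_def by (intro power_increasing) auto
  finally have "R < r0 * 2^J" using r0 by (simp add: field_simps)
  moreover have "r0 * 2^J \<le> 3 * r0 / 2 * 2^J" using r0 by simp
  ultimately have RJ: "R \<le> 3 * r0 / 2 * 2^J" by linarith
  have unity: "complex_of_real (cutoff_tilde r0 \<phi> z) / z^l + (\<Sum>j<J. complex_of_real (dilate (2^Suc j) \<phi> z) / z^l)
      = (if z \<in> ball 0 r0 then 0 else 1 / z^l)" if z: "z \<in> S" for z
  proof (cases "norm z < r0")
    case True
    have "dilate (2^Suc j) \<phi> z = 0" for j
    proof (rule dilate_eq_0[OF c])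
      have "r0 * 1 \<le> r0 * 2^Suc j" using r0 by (intro mult_left_mono one_le_power) auto
      then show "norm z < r0 * 2^Suc j \<or> norm z > 3 * r0 * 2^Suc j" using True by simp
    qed simp
    then show ?thesis using True cutoff_tilde_eq_0[OF c r0, of z] by simp
  next
    case False
    have "cutoff_tilde r0 \<phi> z + (\<Sum>j<J. dilate (2^Suc j) \<phi> z) = 1"
      using cutoff_partial_sum[OF c r0, of z J] False R[OF z] RJ by simp
    then have "complex_of_real (cutoff_tilde r0 \<phi> z) + (\<Sum>j<J. complex_of_real (dilate (2^Suc j) \<phi> z)) = 1"
      by (metis of_real_1 of_real_add of_real_sum)
    then have "(complex_of_real (cutoff_tilde r0 \<phi> z) + (\<Sum>j<J. complex_of_real (dilate (2^Suc j) \<phi> z))) / z^l = 1 / z^l"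
      by simp
    then show ?thesis using False by (simp add: add_divide_distrib sum_divide_distrib)
  qed
  have core: "core_sum r0 \<phi> l S = S_in r0 l S + (\<Sum>z\<in>S. complex_of_real (cutoff_tilde r0 \<phi> z) / z^l)"
    unfolding core_sum_def using S cutoff_tilde_eq_0[OF c r0]
    by (intro arg_cong2[of _ _ _ _ "(+)"] refl sum.mono_neutral_left) auto
  have "(\<Sum>j. ring_sum r0 \<phi> l (Suc j) S) = (\<Sum>j<J. ring_sum r0 \<phi> l (Suc j) S)"
    using N by (intro suminf_finite) (auto simp: not_less J_def)
  also have "\<dots> = (\<Sum>z\<in>S. \<Sum>j<J. complex_of_real (dilate (2^Suc j) \<phi> z) / z^l)"
    unfolding ring_sum_finite[OF c S] by (rule sum.swap)
  finally have "alpha_inf r0 \<phi> l S = S_in r0 l S + (\<Sum>z\<in>S. complex_of_real (cutoff_tilde r0 \<phi> z) / z^l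
      + (\<Sum>j<J. complex_of_real (dilate (2^Suc j) \<phi> z) / z^l))"
    using S by (subst alpha_inf_eq[OF c r0]) (simp_all add: core sum.distrib)
  also have "(\<Sum>z\<in>S. complex_of_real (cutoff_tilde r0 \<phi> z) / z^l + (\<Sum>j<J. complex_of_real (dilate (2^Suc j) \<phi> z) / z^l))
      = (\<Sum>z\<in>S. if z \<in> ball 0 r0 then 0 else 1 / z^l)"
    by (rule sum.cong[OF refl unity])
  also have "\<dots> = S_out_fin r0 l S"
    unfolding S_out_fin_def using S by (intro sum.mono_neutral_cong_right) auto
  finally show ?thesis by (simp add: alpha_fin_def)
qed

text \<open>Expresses finiteness by countably many counts, which makes it a measurable event and
  reduces it to a bound on expected counts.\<close>

lemma finite_iff_card_ball_bounded:
  fixes S :: "complex set"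
  shows "finite S \<longleftrightarrow> (\<exists>N. \<forall>m::nat. finite (S \<inter> ball 0 m) \<and> card (S \<inter> ball 0 m) \<le> N)"
proof
  assume "finite S"
  then show "\<exists>N. \<forall>m::nat. finite (S \<inter> ball 0 m) \<and> card (S \<inter> ball 0 m) \<le> N"
    by (intro exI[of _ "card S"]) (auto intro: card_mono)
next
  assume "\<exists>N. \<forall>m::nat. finite (S \<inter> ball 0 m) \<and> card (S \<inter> ball 0 m) \<le> N"
  then obtain N where N: "\<And>m::nat. finite (S \<inter> ball 0 m) \<and> card (S \<inter> ball 0 m) \<le> N" by blast
  show "finite S"
  proof (rule ccontr)
    assume "infinite S"
    then obtain F where F: "F \<subseteq> S" "finite F" "card F = Suc N" using infinite_arbitrarily_large by blast
    obtain R where R: "\<forall>z\<in>F. norm z \<le> R" using finite_imp_bounded[OF F(2)] by (auto simp: bounded_iff)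
    obtain m :: nat where m: "R < real m" using reals_Archimedean2 by blast
    have "F \<subseteq> S \<inter> ball 0 m" using F(1) R m by force
    then have "card F \<le> N" using N[of m] card_mono[of "S \<inter> ball 0 m" F] by linarith
    then show False using F(3) by simp
  qed
qed

lemma borel_measurable_config_functionals:
  assumes c: "cutoff r0 \<phi>" and r0: "r0 > 0"
  shows "ring_sum r0 \<phi> l j \<in> borel_measurable config_space"
    and "core_sum r0 \<phi> l \<in> borel_measurable config_space"
    and "alpha_inf r0 \<phi> l \<in> borel_measurable config_space"
    and "alpha_fin r0 l \<in> borel_measurable config_space"
proof -
  have ring [measurable]: "ring_sum r0 \<phi> l j \<in> borel_measurable config_space" for j
    unfolding ring_sum_def by (intro borel_measurable_config_sum borel_measurable_cutoff_quotients[OF c]) auto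
  have inner [measurable]: "S_in r0 l \<in> borel_measurable config_space"
    unfolding S_in_def by (intro borel_measurable_config_sum) auto
  have core [measurable]: "core_sum r0 \<phi> l \<in> borel_measurable config_space"
    unfolding core_sum_def
    by (intro borel_measurable_add inner borel_measurable_config_sum borel_measurable_cutoff_quotients[OF c]) auto
  have "(\<lambda>S. core_sum r0 \<phi> l S + (\<Sum>j. ring_sum r0 \<phi> l (Suc j) S)) \<in> borel_measurable config_space"
    by measurable
  then have inf [measurable]: "alpha_inf r0 \<phi> l \<in> borel_measurable config_space"
    by (rule measurable_cong[THEN iffD1, rotated])
       (intro alpha_inf_eq[OF c r0, symmetric] config_space_locally_finite)
  have [measurable]: "(\<lambda>S. card (S \<inter> ball 0 (real m))) \<in> measurable config_space (count_space UNIV)" for m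
    by (intro measurable_card_config) auto
  \<comment> \<open>The condition says that S is finite, where \<open>alpha_fin\<close> equals
    \<open>alpha_inf\<close>. For infinite S the sum in \<open>S_out_fin\<close> takes its default
    value 0, leaving \<open>S_in\<close>.\<close>
  have "(\<lambda>S. if \<exists>N. \<forall>m::nat. card (S \<inter> ball 0 (real m)) \<le> N then alpha_inf r0 \<phi> l S else S_in r0 l S) \<in> borel_measurable config_space"
    by measurable
  then have "alpha_fin r0 l \<in> borel_measurable config_space"
  proof (rule measurable_cong[THEN iffD1, rotated])
    fix S assume S: "S \<in> space config_space"
    have "finite S \<longleftrightarrow> (\<exists>N. \<forall>m::nat. card (S \<inter> ball 0 (real m)) \<le> N)"
      using finite_iff_card_ball_bounded[of S] config_space_locally_finite[OF S bounded_ball] by simp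
    moreover have "alpha_fin r0 l S = S_in r0 l S" if "infinite S"
    proof -
      have "infinite (S - ball 0 r0)"
        using that config_space_locally_finite[OF S bounded_ball, of 0 r0]
        by (metis Int_Diff_Un finite_UnI)
      then show ?thesis by (simp add: alpha_fin_def S_out_fin_def)
    qed
    ultimately show "(if \<exists>N. \<forall>m::nat. card (S \<inter> ball 0 (real m)) \<le> N then alpha_inf r0 \<phi> l S else S_in r0 l S) = alpha_fin r0 l S"
      using alpha_fin_eq_alpha_inf[OF c r0, of S l] by auto
  qed
  with ring core inf show "ring_sum r0 \<phi> l j \<in> borel_measurable config_space"
    "core_sum r0 \<phi> l \<in> borel_measurable config_space" "alpha_inf r0 \<phi> l \<in> borel_measurable config_space"
    "alpha_fin r0 l \<in> borel_measurable config_space" by simp_all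
qed

text \<open>The kernel has trace n: each of its n diagonal terms integrates to 1. Hence the expected
  count in every ball is at most n, and monotone convergence bounds the total count.\<close>

lemma AE_finite_ginibre:
  assumes M: "prob_space M" "finite_ginibre M n X"
  shows "AE \<omega> in M. finite (X \<omega>)"
proof -
  interpret continuous_determinantal_process M gauss_measure X "ginibre_kernel n"
    by (rule finite_ginibre_locale[OF M])
  let ?N = "\<lambda>m \<omega>. card (X \<omega> \<inter> ball 0 (real m))"
  have [measurable]: "?N m \<in> measurable M (count_space UNIV)" for m
    by (rule measurable_compose[OF measurable_X measurable_card_config]) auto
  have E: "(\<integral>\<omega>. real (?N m \<omega>) \<partial>M) \<le> real n" for m
  proof -
    let ?u = "\<lambda>z::complex. indicator (ball 0 (real m)) z * (\<Sum>k<n. (norm z)^(2 * k) / fact k) :: real"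
    have "complex_of_real (\<integral>\<omega>. real (?N m \<omega>) \<partial>M) = (\<integral>z. indicator (ball 0 (real m)) z *\<^sub>R ginibre_kernel n z z \<partial>gauss_measure)"
      by (rule card_sum(2)) auto
    also have "ginibre_kernel n z z = complex_of_real (\<Sum>k<n. (norm z)^(2 * k) / fact k)" for z
      by (simp add: ginibre_kernel_def complex_norm_square[symmetric] power_mult)
    then have "(\<integral>z. indicator (ball 0 (real m)) z *\<^sub>R ginibre_kernel n z z \<partial>gauss_measure)
        = (\<integral>z. complex_of_real (?u z) \<partial>gauss_measure)"
      by (simp add: scaleR_conv_of_real)
    finally have "(\<integral>\<omega>. real (?N m \<omega>) \<partial>M) = integral\<^sup>L gauss_measure ?u"
      by (simp only: integral_complex_of_real of_real_eq_iff)
    also have "\<dots> \<le> (\<Sum>k<n. fact k / fact k)"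
    proof -
      have hb: "has_bochner_integral gauss_measure (\<lambda>z. \<Sum>k<n. (norm z)^(2 * k) / fact k) (\<Sum>k<n. fact k / fact k)"
        by (intro has_bochner_integral_sum has_bochner_integral_divide_zero gauss_measure_moment)
      show ?thesis
      proof (rule has_bochner_integral_le[OF has_bochner_integral_integrable hb])
        show "integrable gauss_measure ?u"
        proof (rule Bochner_Integration.integrable_bound[OF integrable.intros[OF hb]])
          show "?u \<in> borel_measurable gauss_measure"
            by (intro borel_measurable_times borel_measurable_indicator
                borel_measurable_integrable[OF integrable.intros[OF hb]]) simp
          show "AE z in gauss_measure. norm (?u z) \<le> norm (\<Sum>k<n. (norm z)^(2 * k) / fact k :: real)"
            by (auto simp: sum_nonneg split: split_indicator)
        qed
        show "?u z \<le> (\<Sum>k<n. (norm z)^(2 * k) / fact k)" for z :: complex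
          by (cases "z \<in> ball 0 (real m)") (simp_all add: sum_nonneg)
      qed
    qed
    finally show ?thesis by simp
  qed
  have "(\<integral>\<^sup>+\<omega>. (SUP m. ennreal (real (?N m \<omega>))) \<partial>M) = (SUP m. \<integral>\<^sup>+\<omega>. ennreal (real (?N m \<omega>)) \<partial>M)"
  proof (intro nn_integral_monotone_convergence_SUP_AE AE_I2)
    fix \<omega> m assume "\<omega> \<in> space M"
    then show "ennreal (real (?N m \<omega>)) \<le> ennreal (real (?N (Suc m) \<omega>))"
      by (intro ennreal_leI of_nat_mono card_mono finite_X) auto
  qed measurable
  also have "\<dots> \<le> ennreal (real n)"
  proof (rule SUP_least)
    fix m
    have "(\<integral>\<^sup>+\<omega>. ennreal (real (?N m \<omega>)) \<partial>M) = ennreal (\<integral>\<omega>. real (?N m \<omega>) \<partial>M)"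
      by (intro nn_integral_eq_integral card_sum(1)) auto
    then show "(\<integral>\<^sup>+\<omega>. ennreal (real (?N m \<omega>)) \<partial>M) \<le> ennreal (real n)"
      using E[of m] by (simp add: ennreal_leI)
  qed
  finally have "AE \<omega> in M. (SUP m. ennreal (real (?N m \<omega>))) \<noteq> \<infinity>"
    by (intro nn_integral_PInf_AE) (auto simp: top_unique)
  then show ?thesis
  proof (rule AE_mp[OF _ AE_I2], intro impI)
    fix \<omega> assume \<omega>: "\<omega> \<in> space M" and "(SUP m. ennreal (real (?N m \<omega>))) \<noteq> \<infinity>"
    then obtain N :: nat where "(SUP m. ennreal (real (?N m \<omega>))) < of_nat N"
      using ennreal_Ex_less_of_nat by (metis infinity_ennreal_def less_top)
    then have "ennreal (real (?N m \<omega>)) \<le> of_nat N" for m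
      by (meson SUP_upper UNIV_I le_less_trans less_imp_le)
    then have "?N m \<omega> \<le> N" for m by (simp add: ennreal_of_nat_eq_real_of_nat)
    then show "finite (X \<omega>)"
      using finite_iff_card_ball_bounded[of "X \<omega>"] finite_X[OF \<omega> bounded_ball] by blast
  qed
qed

section \<open>Convergence in probability\<close>

text \<open>Convergence forces each point of T to appear at some time, and monotonicity keeps it. A
  bounded set contains finitely many points of T, so the latest arrival is finite.\<close>

lemma config_tendsto_eventually_eq:
  assumes lim: "config_tendsto S T" and sub: "\<And>n. n \<ge> 1 \<Longrightarrow> S n \<subseteq> S (Suc n) \<and> S (Suc n) \<subseteq> T"
    and fin: "\<And>B. bounded B \<Longrightarrow> finite (T \<inter> B)" and B: "bounded B"
  shows "eventually (\<lambda>n. S n \<inter> B = T \<inter> B) sequentially"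
proof -
  have subT: "S n \<subseteq> T" if "n \<ge> 1" for n using sub[OF that] by blast
  have mono: "S m \<subseteq> S n" if "1 \<le> m" "m \<le> n" for m n
    using that(2,1)
  proof (induction n rule: dec_induct)
    case (step k)
    then have "k \<ge> 1" "S m \<subseteq> S k" by simp_all
    then show ?case using sub[of k] by blast
  qed simp
  have ex: "\<exists>n\<ge>1. z \<in> S n" if z: "z \<in> T" for z
  proof (rule ccontr)
    assume no: "\<not> (\<exists>n\<ge>1. z \<in> S n)"
    \<comment> \<open>A tent of height 1 at z. If z never appeared, every S n with n \<ge> 1 would
      miss the mass 1 that z contributes to T.\<close>
    let ?f = "\<lambda>w. max 0 (1 - dist w z)"
    have f0: "?f w = 0" if "w \<notin> ball z 1" for w using that by (simp add: dist_commute)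
    have "continuous_on UNIV ?f" by (intro continuous_intros)
    moreover have "{w. ?f w \<noteq> 0} \<subseteq> ball z 1" using f0 by blast
    then have "compact (closure {w. ?f w \<noteq> 0})"
      by (meson bounded_ball bounded_subset compact_closure)
    ultimately have l: "(\<lambda>n. \<integral>w. ?f w \<partial>config_measure (S n)) \<longlonglongrightarrow> (\<integral>w. ?f w \<partial>config_measure T)"
      using lim unfolding config_tendsto_def by blast
    have m: "?f \<in> borel_measurable borel" by measurable
    have int: "(\<integral>w. ?f w \<partial>config_measure A) = (\<Sum>w\<in>A \<inter> ball z 1. ?f w)" if "A \<subseteq> T" for A
      using that by (intro integral_config_measure m f0 finite_subset[OF _ fin[OF bounded_ball, of z 1]]) auto
    have "(\<integral>w. ?f w \<partial>config_measure (S n)) \<le> (\<integral>w. ?f w \<partial>config_measure T) - 1" if n: "n \<ge> 1" for n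
    proof -
      have zS: "z \<notin> S n" using no n by blast
      have "(\<Sum>w\<in>S n \<inter> ball z 1. ?f w) \<le> (\<Sum>w\<in>T \<inter> ball z 1 - {z}. ?f w)"
        using subT[OF n] zS fin[OF bounded_ball, of z 1] by (intro sum_mono2) auto
      also have "\<dots> = (\<Sum>w\<in>T \<inter> ball z 1. ?f w) - ?f z"
        using z fin[OF bounded_ball, of z 1] by (subst sum_diff1) auto
      finally show ?thesis by (simp add: int subT[OF n])
    qed
    then have "eventually (\<lambda>n. (\<integral>w. ?f w \<partial>config_measure (S n)) \<le> (\<integral>w. ?f w \<partial>config_measure T) - 1) sequentially"
      unfolding eventually_sequentially by blast
    with l have "(\<integral>w. ?f w \<partial>config_measure T) \<le> (\<integral>w. ?f w \<partial>config_measure T) - 1"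
      by (intro tendsto_upperbound[OF l]) auto
    then show False by simp
  qed
  then obtain N where N: "\<And>z. z \<in> T \<Longrightarrow> N z \<ge> 1 \<and> z \<in> S (N z)" by metis
  \<comment> \<open>\<open>insert 1\<close> covers the case of no points and forces K \<ge> 1, since
    the inclusions are assumed only from n = 1 on.\<close>
  define K where "K = Max (insert 1 (N ` (T \<inter> B)))"
  have fK: "finite (insert 1 (N ` (T \<inter> B)))" using fin[OF B] by simp
  have "S n \<inter> B = T \<inter> B" if n: "n \<ge> K" for n
  proof -
    have "K \<ge> 1" unfolding K_def using fK by (intro Max_ge) auto
    then have "S n \<subseteq> T" using n subT by simp
    moreover have "z \<in> S n" if z: "z \<in> T \<inter> B" for z
    proof -
      have "N z \<le> K" unfolding K_def using fK z by (intro Max_ge) auto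
      then show ?thesis using mono[of "N z" n] N[of z] z n by auto
    qed
    ultimately show ?thesis by blast
  qed
  then show ?thesis unfolding eventually_sequentially by blast
qed

text \<open>Truncation at 1 is subadditive even over a possibly divergent series: if some term
  exceeds 1 the right side is at least 1, otherwise nothing on the right is truncated.\<close>

lemma ennreal_min_suminf_le:
  fixes d x :: real and y :: "nat \<Rightarrow> real"
  assumes nn: "x \<ge> 0" "\<And>j. y j \<ge> 0" and d: "ennreal d \<le> ennreal x + (\<Sum>j. ennreal (y j))"
  shows "ennreal (min 1 d) \<le> ennreal (min 1 x) + (\<Sum>j. ennreal (min 1 (y j)))"
proof (cases "x > 1 \<or> (\<exists>j. y j > 1)")
  case True
  have "1 \<le> ennreal (min 1 x) + (\<Sum>j. ennreal (min 1 (y j)))"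
  proof (cases "x > 1")
    case False
    then obtain j where "y j > 1" using True by blast
    then have "1 = (\<Sum>j\<in>{j}. ennreal (min 1 (y j)))" by (simp add: min_def)
    also have "\<dots> \<le> (\<Sum>j. ennreal (min 1 (y j)))" by (intro sum_le_suminf) auto
    finally show ?thesis by (simp add: add_increasing)
  qed (simp add: min_def add_increasing2)
  moreover have "ennreal (min 1 d) \<le> 1" by (metis ennreal_1 ennreal_leI min.cobounded1)
  ultimately show ?thesis by (rule order_trans[rotated])
next
  case False
  then have "min 1 x = x" "\<And>j. min 1 (y j) = y j" by (auto simp: not_less min_def intro: antisym)
  then show ?thesis using order_trans[OF ennreal_leI d, of "min 1 d"] by simp
qed

text \<open>In \<open>ennreal\<close> the bound is trivial when the differences are not absolutely
  summable, so no such assumption is needed.\<close>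

lemma ennreal_norm_suminf_diff_le:
  fixes a b :: "nat \<Rightarrow> complex"
  assumes "summable a" "summable b"
  shows "ennreal (norm ((u + (\<Sum>j. a j)) - (v + (\<Sum>j. b j)))) \<le> ennreal (norm (u - v)) + (\<Sum>j. ennreal (norm (a j - b j)))"
proof -
  have "ennreal (norm (\<Sum>j. a j - b j)) \<le> (\<Sum>j. ennreal (norm (a j - b j)))"
  proof (cases "(\<Sum>j. ennreal (norm (a j - b j))) = \<infinity>")
    case False
    then have s: "summable (\<lambda>j. norm (a j - b j))"
      by (intro summable_suminf_not_top) auto
    then have "(\<Sum>j. ennreal (norm (a j - b j))) = ennreal (\<Sum>j. norm (a j - b j))"
      by (intro suminf_ennreal2) auto
    then show ?thesis using summable_norm[OF s] by (simp add: ennreal_leI)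
  qed simp
  then have "ennreal (norm (u - v) + norm (\<Sum>j. a j - b j)) \<le> ennreal (norm (u - v)) + (\<Sum>j. ennreal (norm (a j - b j)))"
    by (simp add: add_left_mono)
  moreover have "(u + (\<Sum>j. a j)) - (v + (\<Sum>j. b j)) = (u - v) + (\<Sum>j. a j - b j)"
    using suminf_diff[OF assms] by simp
  then have "norm ((u + (\<Sum>j. a j)) - (v + (\<Sum>j. b j))) \<le> norm (u - v) + norm (\<Sum>j. a j - b j)"
    by (simp only: norm_triangle_ineq)
  ultimately show ?thesis by (meson ennreal_leI order_trans)
qed

text \<open>Dominated convergence for the counting measure on the scales.\<close>

lemma suminf_ennreal_tendsto_0:
  fixes E :: "nat \<Rightarrow> nat \<Rightarrow> ennreal" and b :: "nat \<Rightarrow> ennreal"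
  assumes lim: "\<And>j. (\<lambda>n. E n j) \<longlonglongrightarrow> 0" and bound: "\<And>n j. E n j \<le> b j" and b: "(\<Sum>j. b j) < \<infinity>"
  shows "(\<lambda>n. \<Sum>j. E n j) \<longlonglongrightarrow> 0"
proof -
  have "(\<lambda>n. \<integral>\<^sup>+j. E n j \<partial>count_space UNIV) \<longlonglongrightarrow> (\<integral>\<^sup>+j. 0 \<partial>count_space (UNIV :: nat set))"
    using b lim bound by (intro nn_integral_dominated_convergence[where w = b]) (auto simp: nn_integral_count_space_nat)
  then show ?thesis by (simp add: nn_integral_count_space_nat)
qed

section \<open>From the truncated distance to convergence in probability and to a
  subsequence\<close>

lemma strict_mono_choice:
  assumes "\<And>i. eventually (P i) sequentially"
  shows "\<exists>s :: nat \<Rightarrow> nat. strict_mono s \<and> (\<forall>i. P i (s i))"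
proof -
  have "\<exists>s. \<forall>i. P i (s i) \<and> s i < s (Suc i)"
  proof (rule dependent_nat_choice)
    show "\<exists>x. P 0 x" using assms[of 0] by (auto simp: eventually_sequentially)
    show "\<exists>y. P (Suc i) y \<and> x < y" for x i
    proof -
      obtain N where "\<forall>n\<ge>N. P (Suc i) n" using assms[of "Suc i"] by (auto simp: eventually_sequentially)
      then show ?thesis by (intro exI[of _ "max N (Suc x)"]) simp
    qed
  qed
  then show ?thesis by (auto simp: strict_mono_Suc_iff)
qed

lemma (in prob_space) tendsto_in_probI:
  fixes X :: "nat \<Rightarrow> 'a \<Rightarrow> complex" and Y :: "'a \<Rightarrow> complex"
  assumes meas: "\<And>n. n \<ge> 1 \<Longrightarrow> X n \<in> borel_measurable M" "Y \<in> borel_measurable M"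
    and lim: "(\<lambda>n. \<integral>\<^sup>+\<omega>. ennreal (min 1 (norm (X n \<omega> - Y \<omega>))) \<partial>M) \<longlonglongrightarrow> 0"
  shows "tendsto_in_prob M X Y"
  unfolding tendsto_in_prob_def
proof (intro conjI allI impI)
  show "\<forall>\<^sub>F n in sequentially. X n \<in> borel_measurable M"
    using meas(1) by (auto simp: eventually_sequentially)
  show "Y \<in> borel_measurable M" by (rule meas)
  fix \<epsilon> :: real assume \<epsilon>: "\<epsilon> > 0"
  \<comment> \<open>The truncated distance never exceeds 1, so Markov's inequality is applied at
    level min 1 \<epsilon>.\<close>
  define \<delta> where "\<delta> = min 1 \<epsilon>"
  have \<delta>: "\<delta> > 0" using \<epsilon> by (simp add: \<delta>_def)
  let ?e = "\<lambda>n. \<integral>\<^sup>+\<omega>. ennreal (min 1 (norm (X n \<omega> - Y \<omega>))) \<partial>M"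
  let ?A = "\<lambda>n. {\<omega> \<in> space M. dist (X n \<omega>) (Y \<omega>) > \<epsilon>}"
  have bound: "emeasure M (?A n) \<le> ennreal (1 / \<delta>) * ?e n" if n: "n \<ge> 1" for n
  proof -
    note [measurable] = meas(1)[OF n] meas(2)
    have "emeasure M (?A n) = (\<integral>\<^sup>+\<omega>. indicator (?A n) \<omega> \<partial>M)" by simp
    also have "\<dots> \<le> (\<integral>\<^sup>+\<omega>. ennreal (1 / \<delta>) * ennreal (min 1 (norm (X n \<omega> - Y \<omega>))) \<partial>M)"
    proof (rule nn_integral_mono)
      fix \<omega>
      show "indicator (?A n) \<omega> \<le> ennreal (1 / \<delta>) * ennreal (min 1 (norm (X n \<omega> - Y \<omega>)))"
      proof (cases "\<omega> \<in> ?A n")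
        case True
        then have "\<delta> \<le> min 1 (norm (X n \<omega> - Y \<omega>))" by (auto simp: \<delta>_def dist_norm)
        then have "1 \<le> 1 / \<delta> * min 1 (norm (X n \<omega> - Y \<omega>))" using \<delta> by (simp add: pos_le_divide_eq)
        then show ?thesis using True \<delta> by (simp add: ennreal_mult[symmetric] ennreal_1[symmetric] del: ennreal_1)
      qed simp
    qed
    also have "\<dots> = ennreal (1 / \<delta>) * ?e n" by (rule nn_integral_cmult) measurable
    finally show ?thesis .
  qed
  have "(\<lambda>n. emeasure M (?A n)) \<longlonglongrightarrow> 0"
  proof (rule tendsto_sandwich[OF _ _ tendsto_const])
    show "(\<lambda>n. ennreal (1 / \<delta>) * ?e n) \<longlonglongrightarrow> 0"
      using ennreal_tendsto_cmult[OF _ lim, of "ennreal (1 / \<delta>)"] by simp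
    show "eventually (\<lambda>n. emeasure M (?A n) \<le> ennreal (1 / \<delta>) * ?e n) sequentially"
      unfolding eventually_sequentially using bound by blast
  qed simp
  then have "(\<lambda>n. ennreal (prob (?A n))) \<longlonglongrightarrow> ennreal 0" by (simp add: emeasure_eq_measure)
  then show "(\<lambda>n. prob (?A n)) \<longlonglongrightarrow> 0" by (subst (asm) tendsto_ennreal_iff) auto
qed

text \<open>A diagonal choice: the i-th index makes the distances for l = 1, ..., i all smaller than
  2^-i. For fixed l all but finitely many stages are controlled, so the distances have a finite sum
  almost surely; countably many l cost only a null set.\<close>

lemma (in prob_space) AE_common_subsequence:
  fixes X :: "nat \<Rightarrow> nat \<Rightarrow> 'a \<Rightarrow> complex" and Y :: "nat \<Rightarrow> 'a \<Rightarrow> complex"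
  assumes meas: "\<And>l n. l \<ge> 1 \<Longrightarrow> n \<ge> 1 \<Longrightarrow> X l n \<in> borel_measurable M" "\<And>l. l \<ge> 1 \<Longrightarrow> Y l \<in> borel_measurable M"
    and lim: "\<And>l. l \<ge> 1 \<Longrightarrow> (\<lambda>n. \<integral>\<^sup>+\<omega>. ennreal (min 1 (norm (X l n \<omega> - Y l \<omega>))) \<partial>M) \<longlonglongrightarrow> 0"
  shows "\<exists>s :: nat \<Rightarrow> nat. strict_mono s \<and> (AE \<omega> in M. \<forall>l\<ge>1. (\<lambda>i. X l (s i) \<omega>) \<longlonglongrightarrow> Y l \<omega>)"
proof -
  let ?e = "\<lambda>l n. \<integral>\<^sup>+\<omega>. ennreal (min 1 (norm (X l n \<omega> - Y l \<omega>))) \<partial>M"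
  let ?P = "\<lambda>i n. n \<ge> 1 \<and> (\<forall>l\<in>{1..i}. ?e l n < ennreal ((1/2)^i))"
  have "eventually (?P i) sequentially" for i
  proof (intro eventually_conj eventually_ball_finite ballI)
    show "eventually (\<lambda>n. ?e l n < ennreal ((1/2)^i)) sequentially" if "l \<in> {1..i}" for l
      using that by (intro order_tendstoD(2)[OF lim]) auto
  qed (auto simp: eventually_ge_at_top)
  then obtain s where s: "strict_mono s" "\<And>i. ?P i (s i)"
    using strict_mono_choice[of ?P] by blast
  have "AE \<omega> in M. (\<lambda>i. X l (s i) \<omega>) \<longlonglongrightarrow> Y l \<omega>" if l: "l \<ge> 1" for l
  proof -
    \<comment> \<open>The shift by l discards the stages at which this l is not yet
      controlled.\<close>
    let ?d = "\<lambda>i \<omega>. min 1 (norm (X l (s (i + l)) \<omega> - Y l \<omega>))"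
    have [measurable]: "X l (s (i + l)) \<in> borel_measurable M" "Y l \<in> borel_measurable M" for i
      using s(2)[of "i + l"] l meas by simp_all
    have "(\<integral>\<^sup>+\<omega>. (\<Sum>i. ennreal (?d i \<omega>)) \<partial>M) = (\<Sum>i. \<integral>\<^sup>+\<omega>. ennreal (?d i \<omega>) \<partial>M)"
      by (rule nn_integral_suminf) measurable
    also have "\<dots> \<le> (\<Sum>i. ennreal ((1/2)^(i + l)))"
    proof (rule suminf_le)
      show "(\<integral>\<^sup>+\<omega>. ennreal (?d i \<omega>) \<partial>M) \<le> ennreal ((1/2)^(i + l))" for i
        using s(2)[of "i + l"] l by (intro less_imp_le) simp
    qed (rule summableI)+
    also have "\<dots> < \<infinity>"
    proof -
      have "summable (\<lambda>i. (1/2::real)^(i + l))"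
        by (intro summable_ignore_initial_segment summable_geometric) simp
      then show ?thesis by (subst suminf_ennreal2) auto
    qed
    finally have "(\<integral>\<^sup>+\<omega>. (\<Sum>i. ennreal (?d i \<omega>)) \<partial>M) \<noteq> \<infinity>"
      by (rule less_imp_neq)
    then have "AE \<omega> in M. (\<Sum>i. ennreal (?d i \<omega>)) \<noteq> \<infinity>"
      by (intro nn_integral_PInf_AE) measurable
    then show ?thesis
    proof (rule AE_mp[OF _ AE_I2], intro impI)
      fix \<omega> assume "(\<Sum>i. ennreal (?d i \<omega>)) \<noteq> \<infinity>"
      then have "summable (\<lambda>i. ?d i \<omega>)" by (intro summable_suminf_not_top) auto
      then have d: "(\<lambda>i. ?d i \<omega>) \<longlonglongrightarrow> 0" by (rule summable_LIMSEQ_zero)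
      then have "eventually (\<lambda>i. ?d i \<omega> < 1) sequentially" by (rule order_tendstoD) simp
      then have "eventually (\<lambda>i. ?d i \<omega> = norm (X l (s (i + l)) \<omega> - Y l \<omega>)) sequentially"
        by eventually_elim (simp add: min_def split: if_splits)
      then have "(\<lambda>i. norm (X l (s (i + l)) \<omega> - Y l \<omega>)) \<longlonglongrightarrow> 0"
        by (rule Lim_transform_eventually[OF d])
      then have "(\<lambda>i. X l (s (i + l)) \<omega>) \<longlonglongrightarrow> Y l \<omega>"
        by (rule LIM_zero_cancel[OF tendsto_norm_zero_cancel])
      then show "(\<lambda>i. X l (s i) \<omega>) \<longlonglongrightarrow> Y l \<omega>" by (rule LIMSEQ_offset)
    qed
  qed
  then have "AE \<omega> in M. 1 \<le> l \<longrightarrow> (\<lambda>i. X l (s i) \<omega>) \<longlonglongrightarrow> Y l \<omega>" for l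
    by (cases "1 \<le> l") simp_all
  then have "AE \<omega> in M. \<forall>l\<ge>1. (\<lambda>i. X l (s i) \<omega>) \<longlonglongrightarrow> Y l \<omega>"
    unfolding AE_all_countable by blast
  with s(1) show ?thesis by blast
qed

text \<open>Uses 2 a |T| \<le> a^2 + |T|^2 with free a in place of Cauchy-Schwarz; the choice of a
  as the square root of V gives the same strength.\<close>

lemma nn_integral_norm_le_second_moment:
  fixes T :: "'a \<Rightarrow> complex"
  assumes M: "prob_space M" and int: "integrable M (\<lambda>\<omega>. (norm (T \<omega>))\<^sup>2)" and a: "a > 0"
    and V: "(\<integral>\<omega>. (norm (T \<omega>))\<^sup>2 \<partial>M) \<le> V"
  shows "(\<integral>\<^sup>+\<omega>. ennreal (norm (T \<omega>)) \<partial>M) \<le> ennreal ((a + V / a) / 2)"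
proof -
  interpret prob_space M by fact
  have i: "integrable M (\<lambda>\<omega>. (a + (norm (T \<omega>))\<^sup>2 / a) / 2)"
    using int by simp
  have "norm (T \<omega>) \<le> (a + (norm (T \<omega>))\<^sup>2 / a) / 2" for \<omega>
  proof -
    have "0 \<le> (norm (T \<omega>) - a)\<^sup>2 / a" using a by simp
    also have "\<dots> = a + (norm (T \<omega>))\<^sup>2 / a - 2 * norm (T \<omega>)"
      using a by (simp add: power2_eq_square field_simps)
    finally show ?thesis by simp
  qed
  then have "(\<integral>\<^sup>+\<omega>. ennreal (norm (T \<omega>)) \<partial>M) \<le> (\<integral>\<^sup>+\<omega>. ennreal ((a + (norm (T \<omega>))\<^sup>2 / a) / 2) \<partial>M)"
    by (intro nn_integral_mono ennreal_leI)
  also have "\<dots> = ennreal (\<integral>\<omega>. (a + (norm (T \<omega>))\<^sup>2 / a) / 2 \<partial>M)"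
    using a by (intro nn_integral_eq_integral[OF i] AE_I2) simp
  also have "(\<integral>\<omega>. (a + (norm (T \<omega>))\<^sup>2 / a) / 2 \<partial>M) = (a + (\<integral>\<omega>. (norm (T \<omega>))\<^sup>2 \<partial>M) / a) / 2"
    using int by (simp add: prob_space)
  also have "ennreal ((a + (\<integral>\<omega>. (norm (T \<omega>))\<^sup>2 \<partial>M) / a) / 2) \<le> ennreal ((a + V / a) / 2)"
    using a V by (intro ennreal_leI divide_right_mono add_left_mono) auto
  finally show ?thesis .
qed

text \<open>The sequence \<open>b\<close> is chosen before the probability space and n, so one
  summable majorant serves all finite ensembles and, through Fatou's lemma, their limit.\<close>

lemma ginibre_ring_sum_bound:
  assumes c: "cutoff r0 \<phi>" and r0: "r0 > 0" and l: "l \<ge> 1"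
  shows "\<exists>b :: nat \<Rightarrow> ennreal. (\<Sum>j. b j) < \<infinity> \<and>
    (\<forall>(M :: 'w measure) n X j. prob_space M \<longrightarrow> finite_ginibre M n X \<longrightarrow>
       (\<integral>\<^sup>+\<omega>. ennreal (norm (ring_sum r0 \<phi> l (Suc j) (X \<omega>))) \<partial>M) \<le> b j)"
proof -
  obtain C where C: "C \<ge> 0" "\<forall>(M :: 'w measure) n X L. prob_space M \<longrightarrow> finite_ginibre M n X \<longrightarrow> L \<ge> 1 \<longrightarrow>
     integrable M (\<lambda>\<omega>. (norm (\<Sum>z\<in>X \<omega> \<inter> cball 0 (3 * r0 * L). complex_of_real (dilate L \<phi> z) / z ^ l))\<^sup>2) \<and>
     (\<integral>\<omega>. (norm (\<Sum>z\<in>X \<omega> \<inter> cball 0 (3 * r0 * L). complex_of_real (dilate L \<phi> z) / z ^ l))\<^sup>2 \<partial>M) \<le> C / L"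
    using ginibre_scale_bound[OF c r0 l] by blast
  \<comment> \<open>Since q^2 = 1 / 2, the parameter a = q^(j + 1) is L^(-1/2) for L = 2^(j + 1) and
    balances the second moment C / L.\<close>
  define q where "q = 1 / sqrt (2::real)"
  have q: "0 < q" "q < 1" by (simp_all add: q_def)
  define b where "b j = ennreal ((1 + C) / 2 * q^Suc j)" for j
  have "summable (\<lambda>j. (1 + C) / 2 * (q * q^j))" using q by (intro summable_mult summable_geometric) simp
  then have "(\<Sum>j. b j) < \<infinity>"
    unfolding b_def using C(1) q by (subst suminf_ennreal2) auto
  moreover have "(\<integral>\<^sup>+\<omega>. ennreal (norm (ring_sum r0 \<phi> l (Suc j) (X \<omega>))) \<partial>M) \<le> b j"
    if M: "prob_space M" "finite_ginibre M n X" for M :: "'w measure" and n X j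
  proof -
    have L: "(2::real)^Suc j \<ge> 1" by (intro one_le_power) simp
    have "integrable M (\<lambda>\<omega>. (norm (ring_sum r0 \<phi> l (Suc j) (X \<omega>)))\<^sup>2)"
      "(\<integral>\<omega>. (norm (ring_sum r0 \<phi> l (Suc j) (X \<omega>)))\<^sup>2 \<partial>M) \<le> C / 2^Suc j"
      using C(2)[rule_format, OF M L] unfolding ring_sum_def by blast+
    from nn_integral_norm_le_second_moment[OF M(1) this(1) _ this(2), of "q^Suc j"]
    have "(\<integral>\<^sup>+\<omega>. ennreal (norm (ring_sum r0 \<phi> l (Suc j) (X \<omega>))) \<partial>M) \<le> ennreal ((q^Suc j + C / 2^Suc j / q^Suc j) / 2)"
      using q by simp
    also have "C / 2^Suc j / q^Suc j = C * q^Suc j"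
    proof -
      have "q^k * q^k = 1 / 2^k" for k
        by (simp add: q_def power_mult_distrib[symmetric] power_one_over)
      from this[of "Suc j"] show ?thesis using q by (simp add: field_simps)
    qed
    finally show ?thesis by (simp add: b_def algebra_simps add_divide_distrib)
  qed
  ultimately show ?thesis by blast
qed

text \<open>The core and each single ring converge almost surely because the configurations
  eventually agree on bounded sets; the majorant \<open>b\<close> permits summation over the rings.
  Limits are taken along \<open>Suc n\<close>, as the ensembles are specified only from n = 1
  on.\<close>

lemma ginibre_alpha_L0_limit:
  assumes M: "prob_space M" and r0: "r0 > 0" and c: "cutoff r0 \<phi>" and l: "l \<ge> 1"
    and Gn: "\<And>n. n \<ge> 1 \<Longrightarrow> finite_ginibre M n (Gn n)" and G: "G \<in> measurable M config_space"
    and sub: "AE \<omega> in M. \<forall>n\<ge>1. Gn n \<omega> \<subseteq> Gn (Suc n) \<omega> \<and> Gn (Suc n) \<omega> \<subseteq> G \<omega>"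
    and lim: "AE \<omega> in M. config_tendsto (\<lambda>n. Gn n \<omega>) (G \<omega>)"
  shows "(\<lambda>n. \<integral>\<^sup>+\<omega>. ennreal (min 1 (norm (alpha_fin r0 l (Gn n \<omega>) - alpha_inf r0 \<phi> l (G \<omega>)))) \<partial>M) \<longlonglongrightarrow> 0"
proof -
  interpret prob_space M by fact
  obtain b where b: "(\<Sum>j. b j) < \<infinity>"
    "\<And>n X j. finite_ginibre M n X \<Longrightarrow> (\<integral>\<^sup>+\<omega>. ennreal (norm (ring_sum r0 \<phi> l (Suc j) (X \<omega>))) \<partial>M) \<le> b j"
    using ginibre_ring_sum_bound[OF c r0 l, where 'w = 'a] M by blast
  note meas = borel_measurable_config_functionals[OF c r0]
  have mG: "Gn n \<in> measurable M config_space" if "n \<ge> 1" for n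
    using Gn[OF that] by (simp add: finite_ginibre_def determinantal_process_def)
  have m_ring: "(\<lambda>\<omega>. ring_sum r0 \<phi> l j (Gn n \<omega>)) \<in> borel_measurable M"
    and m_core: "(\<lambda>\<omega>. core_sum r0 \<phi> l (Gn n \<omega>)) \<in> borel_measurable M" if "n \<ge> 1" for n j
    by (rule measurable_compose[OF mG[OF that]], rule meas)+
  have mG_ring: "(\<lambda>\<omega>. ring_sum r0 \<phi> l j (G \<omega>)) \<in> borel_measurable M"
    and mG_core: "(\<lambda>\<omega>. core_sum r0 \<phi> l (G \<omega>)) \<in> borel_measurable M" for j
    by (rule measurable_compose[OF G], rule meas)+
  have lf: "finite (G \<omega> \<inter> B)" if "\<omega> \<in> space M" "bounded B" for \<omega> B
    using config_space_locally_finite[OF measurable_space[OF G that(1)] that(2)] .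
  have ev: "AE \<omega> in M. \<forall>B. bounded B \<longrightarrow> eventually (\<lambda>n. Gn n \<omega> \<inter> B = G \<omega> \<inter> B) sequentially"
    using sub lim
  proof (rule AE_mp[OF AE_conjI AE_I2], intro impI allI)
    fix \<omega> and B :: "complex set"
    assume "\<omega> \<in> space M" and "(\<forall>n\<ge>1. Gn n \<omega> \<subseteq> Gn (Suc n) \<omega> \<and> Gn (Suc n) \<omega> \<subseteq> G \<omega>) \<and> config_tendsto (\<lambda>n. Gn n \<omega>) (G \<omega>)"
      and "bounded B"
    then show "eventually (\<lambda>n. Gn n \<omega> \<inter> B = G \<omega> \<inter> B) sequentially"
      by (intro config_tendsto_eventually_eq[of "\<lambda>n. Gn n \<omega>"] lf) auto
  qed
  have ring_lim: "AE \<omega> in M. (\<lambda>n. ring_sum r0 \<phi> l j (Gn n \<omega>)) \<longlonglongrightarrow> ring_sum r0 \<phi> l j (G \<omega>)" for j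
    using ev
  proof (rule AE_mp[OF _ AE_I2], intro impI)
    fix \<omega> assume "\<forall>B. bounded B \<longrightarrow> eventually (\<lambda>n. Gn n \<omega> \<inter> B = G \<omega> \<inter> B) sequentially"
    then have "eventually (\<lambda>n. Gn n \<omega> \<inter> cball 0 (3 * r0 * 2^j) = G \<omega> \<inter> cball 0 (3 * r0 * 2^j)) sequentially"
      by simp
    then have "eventually (\<lambda>n. ring_sum r0 \<phi> l j (Gn n \<omega>) = ring_sum r0 \<phi> l j (G \<omega>)) sequentially"
      by eventually_elim (simp add: ring_sum_def)
    then show "(\<lambda>n. ring_sum r0 \<phi> l j (Gn n \<omega>)) \<longlonglongrightarrow> ring_sum r0 \<phi> l j (G \<omega>)"
      by (rule tendsto_eventually)
  qed
  have core_lim: "AE \<omega> in M. (\<lambda>n. core_sum r0 \<phi> l (Gn n \<omega>)) \<longlonglongrightarrow> core_sum r0 \<phi> l (G \<omega>)"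
    using ev
  proof (rule AE_mp[OF _ AE_I2], intro impI)
    fix \<omega> assume e: "\<forall>B. bounded B \<longrightarrow> eventually (\<lambda>n. Gn n \<omega> \<inter> B = G \<omega> \<inter> B) sequentially"
    have "eventually (\<lambda>n. Gn n \<omega> \<inter> ball 0 r0 = G \<omega> \<inter> ball 0 r0) sequentially"
      "eventually (\<lambda>n. Gn n \<omega> \<inter> cball 0 (3 * r0) = G \<omega> \<inter> cball 0 (3 * r0)) sequentially"
      using e by simp_all
    then have "eventually (\<lambda>n. core_sum r0 \<phi> l (Gn n \<omega>) = core_sum r0 \<phi> l (G \<omega>)) sequentially"
      by eventually_elim (simp add: core_sum_def S_in_def)
    then show "(\<lambda>n. core_sum r0 \<phi> l (Gn n \<omega>)) \<longlonglongrightarrow> core_sum r0 \<phi> l (G \<omega>)"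
      by (rule tendsto_eventually)
  qed
  have G_bound: "(\<integral>\<^sup>+\<omega>. ennreal (norm (ring_sum r0 \<phi> l (Suc j) (G \<omega>))) \<partial>M) \<le> b j" for j
  proof -
    have "(\<integral>\<^sup>+\<omega>. ennreal (norm (ring_sum r0 \<phi> l (Suc j) (G \<omega>))) \<partial>M)
        = (\<integral>\<^sup>+\<omega>. liminf (\<lambda>n. ennreal (norm (ring_sum r0 \<phi> l (Suc j) (Gn (Suc n) \<omega>)))) \<partial>M)"
    proof (rule nn_integral_cong_AE, rule AE_mp[OF ring_lim[of "Suc j"] AE_I2], intro impI)
      fix \<omega> assume "(\<lambda>n. ring_sum r0 \<phi> l (Suc j) (Gn n \<omega>)) \<longlonglongrightarrow> ring_sum r0 \<phi> l (Suc j) (G \<omega>)"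
      then have "(\<lambda>n. ennreal (norm (ring_sum r0 \<phi> l (Suc j) (Gn (Suc n) \<omega>)))) \<longlonglongrightarrow> ennreal (norm (ring_sum r0 \<phi> l (Suc j) (G \<omega>)))"
        by (intro tendsto_ennrealI tendsto_norm LIMSEQ_Suc)
      then show "ennreal (norm (ring_sum r0 \<phi> l (Suc j) (G \<omega>))) = liminf (\<lambda>n. ennreal (norm (ring_sum r0 \<phi> l (Suc j) (Gn (Suc n) \<omega>))))"
        by (rule lim_imp_Liminf[OF sequentially_bot, symmetric])
    qed
    also have "\<dots> \<le> liminf (\<lambda>n. \<integral>\<^sup>+\<omega>. ennreal (norm (ring_sum r0 \<phi> l (Suc j) (Gn (Suc n) \<omega>))) \<partial>M)"
      using m_ring by (intro nn_integral_liminf) simp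
    also have "\<dots> \<le> b j"
      using b(2)[OF Gn] by (intro Liminf_le always_eventually allI) simp_all
    finally show ?thesis .
  qed
  have summable_G: "AE \<omega> in M. summable (\<lambda>j. ring_sum r0 \<phi> l (Suc j) (G \<omega>))"
  proof -
    have "(\<integral>\<^sup>+\<omega>. (\<Sum>j. ennreal (norm (ring_sum r0 \<phi> l (Suc j) (G \<omega>)))) \<partial>M)
        = (\<Sum>j. \<integral>\<^sup>+\<omega>. ennreal (norm (ring_sum r0 \<phi> l (Suc j) (G \<omega>))) \<partial>M)"
      using mG_ring by (intro nn_integral_suminf) simp
    also have "\<dots> \<le> (\<Sum>j. b j)" by (intro suminf_le G_bound summableI)
    also note b(1)
    finally have "(\<integral>\<^sup>+\<omega>. (\<Sum>j. ennreal (norm (ring_sum r0 \<phi> l (Suc j) (G \<omega>)))) \<partial>M) \<noteq> \<infinity>"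
      by (rule less_imp_neq)
    moreover have "(\<lambda>\<omega>. \<Sum>j. ennreal (norm (ring_sum r0 \<phi> l (Suc j) (G \<omega>)))) \<in> borel_measurable M"
      using mG_ring by (intro borel_measurable_suminf_order) simp
    ultimately have "AE \<omega> in M. (\<Sum>j. ennreal (norm (ring_sum r0 \<phi> l (Suc j) (G \<omega>)))) \<noteq> \<infinity>"
      by (intro nn_integral_PInf_AE)
    then show ?thesis
    proof (rule AE_mp[OF _ AE_I2], intro impI)
      fix \<omega> assume "(\<Sum>j. ennreal (norm (ring_sum r0 \<phi> l (Suc j) (G \<omega>)))) \<noteq> \<infinity>"
      then have "summable (\<lambda>j. norm (ring_sum r0 \<phi> l (Suc j) (G \<omega>)))"
        by (intro summable_suminf_not_top) auto
      then show "summable (\<lambda>j. ring_sum r0 \<phi> l (Suc j) (G \<omega>))" by (rule summable_norm_cancel)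
    qed
  qed
  let ?E = "\<lambda>n j. \<integral>\<^sup>+\<omega>. ennreal (min 1 (norm (ring_sum r0 \<phi> l (Suc j) (Gn n \<omega>) - ring_sum r0 \<phi> l (Suc j) (G \<omega>)))) \<partial>M"
  let ?F = "\<lambda>n. \<integral>\<^sup>+\<omega>. ennreal (min 1 (norm (core_sum r0 \<phi> l (Gn n \<omega>) - core_sum r0 \<phi> l (G \<omega>)))) \<partial>M"
  \<comment> \<open>Bounded convergence with majorant 1. This is where truncation replaces a moment
    bound for the core.\<close>
  have min_lim: "(\<lambda>n. \<integral>\<^sup>+\<omega>. ennreal (min 1 (norm (U (Suc n) \<omega> - V \<omega>))) \<partial>M) \<longlonglongrightarrow> 0"
    if U: "\<And>n. n \<ge> 1 \<Longrightarrow> U n \<in> borel_measurable M" "V \<in> borel_measurable M"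
      and UV: "AE \<omega> in M. (\<lambda>n. U n \<omega>) \<longlonglongrightarrow> V \<omega>" for U :: "nat \<Rightarrow> 'a \<Rightarrow> complex" and V
  proof -
    have "(\<lambda>n. \<integral>\<^sup>+\<omega>. ennreal (min 1 (norm (U (Suc n) \<omega> - V \<omega>))) \<partial>M) \<longlonglongrightarrow> (\<integral>\<^sup>+\<omega>. 0 \<partial>M)"
    proof (rule nn_integral_dominated_convergence[where w = "\<lambda>_. 1"])
      show "(\<lambda>\<omega>. ennreal (min 1 (norm (U (Suc n) \<omega> - V \<omega>)))) \<in> borel_measurable M" for n
        using U(1)[of "Suc n"] U(2) by measurable
      show "AE \<omega> in M. ennreal (min 1 (norm (U (Suc n) \<omega> - V \<omega>))) \<le> 1" for n
        by (intro AE_I2) (metis ennreal_1 ennreal_leI min.cobounded1)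
      show "AE \<omega> in M. (\<lambda>n. ennreal (min 1 (norm (U (Suc n) \<omega> - V \<omega>)))) \<longlonglongrightarrow> 0"
        using UV
      proof (rule AE_mp[OF _ AE_I2], intro impI)
        fix \<omega> assume "(\<lambda>n. U n \<omega>) \<longlonglongrightarrow> V \<omega>"
        then have "(\<lambda>n. ennreal (min 1 (norm (U (Suc n) \<omega> - V \<omega>)))) \<longlonglongrightarrow> ennreal (min 1 (norm (V \<omega> - V \<omega>)))"
          by (intro tendsto_ennrealI tendsto_min tendsto_const tendsto_norm tendsto_diff LIMSEQ_Suc)
        then show "(\<lambda>n. ennreal (min 1 (norm (U (Suc n) \<omega> - V \<omega>)))) \<longlonglongrightarrow> 0" by simp
      qed
    qed (simp_all add: emeasure_space_1)
    then show ?thesis by simp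
  qed
  have upper: "(\<lambda>n. ?F (Suc n) + (\<Sum>j. ?E (Suc n) j)) \<longlonglongrightarrow> 0 + 0"
  proof (rule tendsto_add)
    show "(\<lambda>n. ?F (Suc n)) \<longlonglongrightarrow> 0" by (rule min_lim[OF m_core mG_core core_lim])
    show "(\<lambda>n. \<Sum>j. ?E (Suc n) j) \<longlonglongrightarrow> 0"
    \<comment> \<open>One \<open>b j\<close> for the finite ensemble and one for its limit, by the
      triangle inequality.\<close>
    proof (rule suminf_ennreal_tendsto_0[where b = "\<lambda>j. b j + b j"])
      show "(\<lambda>n. ?E (Suc n) j) \<longlonglongrightarrow> 0" for j by (rule min_lim[OF m_ring mG_ring ring_lim])
      show "?E (Suc n) j \<le> b j + b j" for n j
      proof -
        have "?E (Suc n) j \<le> (\<integral>\<^sup>+\<omega>. ennreal (norm (ring_sum r0 \<phi> l (Suc j) (Gn (Suc n) \<omega>))) + ennreal (norm (ring_sum r0 \<phi> l (Suc j) (G \<omega>))) \<partial>M)"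
          by (intro nn_integral_mono) (simp add: ennreal_plus[symmetric] ennreal_leI min.coboundedI2 norm_triangle_ineq4 del: ennreal_plus)
        also have "\<dots> = (\<integral>\<^sup>+\<omega>. ennreal (norm (ring_sum r0 \<phi> l (Suc j) (Gn (Suc n) \<omega>))) \<partial>M) + (\<integral>\<^sup>+\<omega>. ennreal (norm (ring_sum r0 \<phi> l (Suc j) (G \<omega>))) \<partial>M)"
          using m_ring[of "Suc n"] mG_ring by (intro nn_integral_add) simp_all
        also have "\<dots> \<le> b j + b j"
          by (rule add_mono[OF b(2)[OF Gn] G_bound]) simp
        finally show ?thesis .
      qed
      show "(\<Sum>j. b j + b j) < \<infinity>"
        using b(1) by (subst suminf_add[symmetric]) (simp_all add: summableI)
    qed
  qed
  have le: "(\<integral>\<^sup>+\<omega>. ennreal (min 1 (norm (alpha_fin r0 l (Gn (Suc n) \<omega>) - alpha_inf r0 \<phi> l (G \<omega>)))) \<partial>M)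
      \<le> ?F (Suc n) + (\<Sum>j. ?E (Suc n) j)" for n
  proof -
    let ?f = "\<lambda>\<omega>. ennreal (min 1 (norm (core_sum r0 \<phi> l (Gn (Suc n) \<omega>) - core_sum r0 \<phi> l (G \<omega>))))"
    let ?e = "\<lambda>j \<omega>. ennreal (min 1 (norm (ring_sum r0 \<phi> l (Suc j) (Gn (Suc n) \<omega>) - ring_sum r0 \<phi> l (Suc j) (G \<omega>))))"
    have mf: "?f \<in> borel_measurable M" using m_core[of "Suc n"] mG_core by simp
    have me: "?e j \<in> borel_measurable M" for j using m_ring[of "Suc n"] mG_ring by simp
    have "(\<integral>\<^sup>+\<omega>. ennreal (min 1 (norm (alpha_fin r0 l (Gn (Suc n) \<omega>) - alpha_inf r0 \<phi> l (G \<omega>)))) \<partial>M)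
        \<le> (\<integral>\<^sup>+\<omega>. ?f \<omega> + (\<Sum>j. ?e j \<omega>) \<partial>M)"
    proof (rule nn_integral_mono_AE)
      have "AE \<omega> in M. finite (Gn (Suc n) \<omega>)"
        by (rule AE_finite_ginibre[OF M Gn]) simp
      with summable_G
      show "AE \<omega> in M. ennreal (min 1 (norm (alpha_fin r0 l (Gn (Suc n) \<omega>) - alpha_inf r0 \<phi> l (G \<omega>)))) \<le> ?f \<omega> + (\<Sum>j. ?e j \<omega>)"
      proof (rule AE_mp[OF AE_conjI AE_I2], intro impI)
        fix \<omega> assume \<omega>: "\<omega> \<in> space M"
          and *: "summable (\<lambda>j. ring_sum r0 \<phi> l (Suc j) (G \<omega>)) \<and> finite (Gn (Suc n) \<omega>)"
        have 1: "alpha_fin r0 l (Gn (Suc n) \<omega>) = core_sum r0 \<phi> l (Gn (Suc n) \<omega>) + (\<Sum>j. ring_sum r0 \<phi> l (Suc j) (Gn (Suc n) \<omega>))"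
          unfolding alpha_fin_eq_alpha_inf[OF c r0 conjunct2[OF *]]
          by (rule alpha_inf_eq[OF c r0]) (simp add: *)
        have 2: "alpha_inf r0 \<phi> l (G \<omega>) = core_sum r0 \<phi> l (G \<omega>) + (\<Sum>j. ring_sum r0 \<phi> l (Suc j) (G \<omega>))"
          by (rule alpha_inf_eq[OF c r0 lf[OF \<omega>]])
        show "ennreal (min 1 (norm (alpha_fin r0 l (Gn (Suc n) \<omega>) - alpha_inf r0 \<phi> l (G \<omega>)))) \<le> ?f \<omega> + (\<Sum>j. ?e j \<omega>)"
          unfolding 1 2
          by (rule ennreal_min_suminf_le[OF norm_ge_zero norm_ge_zero
                ennreal_norm_suminf_diff_le[OF summable_ring_sum_finite[OF c r0 conjunct2[OF *]] conjunct1[OF *]]])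
      qed
    qed
    also have "\<dots> = (\<integral>\<^sup>+\<omega>. ?f \<omega> \<partial>M) + (\<integral>\<^sup>+\<omega>. (\<Sum>j. ?e j \<omega>) \<partial>M)"
      by (intro nn_integral_add mf borel_measurable_suminf_order me)
    also have "(\<integral>\<^sup>+\<omega>. (\<Sum>j. ?e j \<omega>) \<partial>M) = (\<Sum>j. ?E (Suc n) j)"
      by (rule nn_integral_suminf[OF me])
    finally show ?thesis .
  qed
  have "(\<lambda>n. \<integral>\<^sup>+\<omega>. ennreal (min 1 (norm (alpha_fin r0 l (Gn (Suc n) \<omega>) - alpha_inf r0 \<phi> l (G \<omega>)))) \<partial>M) \<longlonglongrightarrow> 0"
  proof (rule tendsto_sandwich[OF always_eventually always_eventually tendsto_const])
    show "\<forall>n. 0 \<le> (\<integral>\<^sup>+\<omega>. ennreal (min 1 (norm (alpha_fin r0 l (Gn (Suc n) \<omega>) - alpha_inf r0 \<phi> l (G \<omega>)))) \<partial>M)"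
      by (rule allI, rule zero_le)
    show "(\<lambda>n. ?F (Suc n) + (\<Sum>j. ?E (Suc n) j)) \<longlonglongrightarrow> 0"
      using upper by (simp only: add_0)
  qed (rule allI, rule le)
  then show ?thesis by (rule LIMSEQ_imp_Suc)
qed

theorem proposition8p9:
  fixes M :: "'w measure"
    and Gn :: "nat \<Rightarrow> 'w \<Rightarrow> complex set"
    and G :: "'w \<Rightarrow> complex set"
    and r0 :: real
    and \<phi> :: "complex \<Rightarrow> real"
  assumes "prob_space M"
    and "r0 > 0"
    and "cutoff r0 \<phi>"
    and "\<And>n. n \<ge> 1 \<Longrightarrow> finite_ginibre M n (Gn n)"
    and "infinite_ginibre M G"
    and "AE \<omega> in M. \<forall>n\<ge>1. Gn n \<omega> \<subseteq> Gn (Suc n) \<omega> \<and> Gn (Suc n) \<omega> \<subseteq> G \<omega>"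
    and "AE \<omega> in M. config_tendsto (\<lambda>n. Gn n \<omega>) (G \<omega>)"
  shows "(\<forall>l\<ge>1. tendsto_in_prob M (\<lambda>n \<omega>. alpha_fin r0 l (Gn n \<omega>)) (\<lambda>\<omega>. alpha_inf r0 \<phi> l (G \<omega>)))
       \<and> (\<exists>s :: nat \<Rightarrow> nat. strict_mono s \<and>
            (AE \<omega> in M. \<forall>l\<ge>1. (\<lambda>i. alpha_fin r0 l (Gn (s i) \<omega>)) \<longlonglongrightarrow> alpha_inf r0 \<phi> l (G \<omega>)))"
proof -
  interpret prob_space M by fact
  have G: "G \<in> measurable M config_space"
    using assms(5) by (simp add: infinite_ginibre_def determinantal_process_def)
  have Gn: "Gn n \<in> measurable M config_space" if "n \<ge> 1" for n
    using assms(4)[OF that] by (simp add: finite_ginibre_def determinantal_process_def)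
  note meas = borel_measurable_config_functionals[OF assms(3,2)]
  have m: "(\<lambda>\<omega>. alpha_fin r0 l (Gn n \<omega>)) \<in> borel_measurable M" if "n \<ge> 1" for l n
    by (rule measurable_compose[OF Gn[OF that] meas(4)])
  have m': "(\<lambda>\<omega>. alpha_inf r0 \<phi> l (G \<omega>)) \<in> borel_measurable M" for l
    by (rule measurable_compose[OF G meas(3)])
  note L0 = ginibre_alpha_L0_limit[OF assms(1-3) _ assms(4) G assms(6,7)]
  show ?thesis
  proof (intro conjI allI impI)
    show "tendsto_in_prob M (\<lambda>n \<omega>. alpha_fin r0 l (Gn n \<omega>)) (\<lambda>\<omega>. alpha_inf r0 \<phi> l (G \<omega>))" if "l \<ge> 1" for l
      using m m' L0[OF that] by (intro tendsto_in_probI)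
    show "\<exists>s :: nat \<Rightarrow> nat. strict_mono s \<and>
            (AE \<omega> in M. \<forall>l\<ge>1. (\<lambda>i. alpha_fin r0 l (Gn (s i) \<omega>)) \<longlonglongrightarrow> alpha_inf r0 \<phi> l (G \<omega>))"
    proof (rule AE_common_subsequence)
      show "(\<lambda>\<omega>. alpha_fin r0 l (Gn n \<omega>)) \<in> borel_measurable M" if "n \<ge> 1" for l n
        by (rule m[OF that])
      show "(\<lambda>\<omega>. alpha_inf r0 \<phi> l (G \<omega>)) \<in> borel_measurable M" for l
        by (rule m')
      show "(\<lambda>n. \<integral>\<^sup>+\<omega>. ennreal (min 1 (norm (alpha_fin r0 l (Gn n \<omega>) - alpha_inf r0 \<phi> l (G \<omega>)))) \<partial>M) \<longlonglongrightarrow> 0"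
        if "l \<ge> 1" for l
        by (rule L0[OF that])
    qed
  qed
qed

end
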